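(* Let $P=\mathbb{N}^k\times F$ where $k\ge0$ and $F$ is a countable discrete abelian group, and let $G_P=\mathbb{Z}^k\times F$ be the Grothendieck group of $P$. Let $\Lambda$ be a row-finite $P$-graph with no sources, and fix $c\in Z^2(\Lambda,\mathbb{T})$. Let $t:\Lambda\to B$ be a Cuntz–Krieger $(\Lambda,c)$-family in a $C^*$-algebra $B$. Suppose that there is a strongly continuous action $\beta$ of $\widehat{G_P}$ on $B$ satisfying $\beta_\chi(t_\lambda)=\chi(d(\lambda))t_\lambda$ for all $\lambda\in\Lambda$ and $\chi\in\widehat{G_P}$. Then the induced homomorphism $\pi_t:C^*(\Lambda,c)\to B$ (with $\pi_t(s_\lambda)=t_\lambda$) is injective if and only if $t_v\ne0$ for all $v\in\Lambda^0$.
   Context: A $P$-graph is a countable small category $\Lambda$ with a functor $d:\Lambda\to P$ ($P$ regarded as a one-object category) satisfying the factorisation property: if $d(\lambda)=p+q$ then there are unique $\mu,\nu\in\Lambda$ with $d(\mu)=p$, $d(\nu)=q$, $\lambda=\mu\nu$. $r,s$ are the codomain and domain maps, $\Lambda^p=d^{-1}(p)$, $\Lambda^0=d^{-1}(0)$ is identified with the set of objects, $v\Lambda^p=\{\lambda\in\Lambda^p:r(\lambda)=v\}$. $\Lambda$ is row-finite if each $v\Lambda^p$ is finite, and has no sources if each $v\Lambda^p$ is nonempty ($v\in\Lambda^0$, $p\in P$). $Z^2(\Lambda,\mathbb{T})$ is the group of functions $c$ from composable pairs in $\Lambda$ to $\mathbb{T}$ with $c(\lambda,\mu)c(\lambda\mu,\nu)=c(\mu,\nu)c(\lambda,\mu\nu)$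 for composable triples and $c(r(\lambda),\lambda)=1=c(\lambda,s(\lambda))$. A Cuntz–Krieger $(\Lambda,c)$-family in $B$ is a function $t:\lambda\mapsto t_\lambda\in B$ such that: (CK1) $\{t_v:v\in\Lambda^0\}$ are mutually orthogonal projections; (CK2) $t_\mu t_\nu=c(\mu,\nu)t_{\mu\nu}$ whenever $s(\mu)=r(\nu)$; (CK3) $t_\lambda^*t_\lambda=t_{s(\lambda)}$; (CK4) $t_v=\sum_{\lambda\in v\Lambda^p}t_\lambda t_\lambda^*$ for all $v\in\Lambda^0$, $p\in P$. $C^*(\Lambda,c)$ is the universal $C^*$-algebra generated by a Cuntz–Krieger $(\Lambda,c)$-family $\{s_\lambda\}$. *)

theory Defs
  imports
    "HOL-Analysis.Analysis"
    "HOL-Algebra.Module"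
    "HOL-Library.Function_Algebras"
    "HOL-Library.Product_Plus"
    "HOL-Library.Countable"
begin

section \<open>C*-algebras\<close>

subsection \<open>C*-algebras as types\<close>

text \<open>Complex C*-algebras, not assumed to be unital.  The real structure required by the
  library classes is the restriction of the complex one.\<close>

class cstar_algebra = real_normed_algebra + banach +
  fixes scaleC :: "complex \<Rightarrow> 'a \<Rightarrow> 'a"  (infixr \<open>*\<^sub>C\<close> 75)
    and adj :: "'a \<Rightarrow> 'a"
  assumes scaleR_eq_scaleC: "scaleR r x = of_real r *\<^sub>C x"
    and scaleC_add_right: "z *\<^sub>C (x + y) = z *\<^sub>C x + z *\<^sub>C y"
    and scaleC_add_left: "(z + w) *\<^sub>C x = z *\<^sub>C x + w *\<^sub>C x"
    and scaleC_scaleC: "z *\<^sub>C w *\<^sub>C x = (z * w) *\<^sub>C x"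
    and mult_scaleC_left: "(z *\<^sub>C x) * y = z *\<^sub>C (x * y)"
    and mult_scaleC_right: "x * (z *\<^sub>C y) = z *\<^sub>C (x * y)"
    and norm_scaleC: "norm (z *\<^sub>C x) = cmod z * norm x"
    and adj_add: "adj (x + y) = adj x + adj y"
    and adj_scaleC: "adj (z *\<^sub>C x) = cnj z *\<^sub>C adj x"
    and adj_mult: "adj (x * y) = adj y * adj x"
    and adj_adj: "adj (adj x) = x"
    and cstar_identity: "norm (adj x * x) = (norm x)\<^sup>2"


subsection \<open>C*-algebras as structures on a set\<close>

text \<open>The universal property of \<open>C*(\<Lambda>,c)\<close> quantifies over C*-algebras.  Quantifiers cannot range
  over types, so C*-algebras are also needed as values.  The unit field \<open>one\<close> inherited from the
  library record is never referred to.\<close>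

record 'a cstar = "(complex, 'a) module" +
  star :: "'a \<Rightarrow> 'a"
  nrm :: "'a \<Rightarrow> real"

definition complex_field :: "complex ring" where
  "complex_field = \<lparr>carrier = UNIV, monoid.mult = (*), one = 1, zero = 0, add = (+)\<rparr>"

locale cstar_structure = module complex_field D for D :: "'a cstar" (structure) +
  assumes mult_closed: "\<lbrakk>x \<in> carrier D; y \<in> carrier D\<rbrakk> \<Longrightarrow> x \<otimes> y \<in> carrier D"
    and mult_assoc: "\<lbrakk>x \<in> carrier D; y \<in> carrier D; z \<in> carrier D\<rbrakk> \<Longrightarrow> (x \<otimes> y) \<otimes> z = x \<otimes> (y \<otimes> z)"
    and distrib_left:
      "\<lbrakk>x \<in> carrier D; y \<in> carrier D; z \<in> carrier D\<rbrakk> \<Longrightarrow> x \<otimes> (y \<oplus> z) = (x \<otimes> y) \<oplus> (x \<otimes> z)"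
    and distrib_right:
      "\<lbrakk>x \<in> carrier D; y \<in> carrier D; z \<in> carrier D\<rbrakk> \<Longrightarrow> (x \<oplus> y) \<otimes> z = (x \<otimes> z) \<oplus> (y \<otimes> z)"
    and smult_mult_left: "\<lbrakk>x \<in> carrier D; y \<in> carrier D\<rbrakk> \<Longrightarrow> (a \<odot> x) \<otimes> y = a \<odot> (x \<otimes> y)"
    and smult_mult_right: "\<lbrakk>x \<in> carrier D; y \<in> carrier D\<rbrakk> \<Longrightarrow> x \<otimes> (a \<odot> y) = a \<odot> (x \<otimes> y)"
    and star_closed: "x \<in> carrier D \<Longrightarrow> star D x \<in> carrier D"
    and star_add: "\<lbrakk>x \<in> carrier D; y \<in> carrier D\<rbrakk> \<Longrightarrow> star D (x \<oplus> y) = star D x \<oplus> star D y"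
    and star_smult: "x \<in> carrier D \<Longrightarrow> star D (a \<odot> x) = cnj a \<odot> star D x"
    and star_mult: "\<lbrakk>x \<in> carrier D; y \<in> carrier D\<rbrakk> \<Longrightarrow> star D (x \<otimes> y) = star D y \<otimes> star D x"
    and star_star: "x \<in> carrier D \<Longrightarrow> star D (star D x) = x"
    and nrm_nonneg: "x \<in> carrier D \<Longrightarrow> 0 \<le> nrm D x"
    and nrm_eq_0_iff: "x \<in> carrier D \<Longrightarrow> nrm D x = 0 \<longleftrightarrow> x = \<zero>"
    and nrm_triangle: "\<lbrakk>x \<in> carrier D; y \<in> carrier D\<rbrakk> \<Longrightarrow> nrm D (x \<oplus> y) \<le> nrm D x + nrm D y"
    and nrm_smult: "x \<in> carrier D \<Longrightarrow> nrm D (a \<odot> x) = cmod a * nrm D x"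
    and nrm_mult: "\<lbrakk>x \<in> carrier D; y \<in> carrier D\<rbrakk> \<Longrightarrow> nrm D (x \<otimes> y) \<le> nrm D x * nrm D y"
    and nrm_cstar: "x \<in> carrier D \<Longrightarrow> nrm D (star D x \<otimes> x) = (nrm D x)\<^sup>2"
    and complete: "Metric_space.mcomplete (carrier D) (\<lambda>x y. nrm D (x \<ominus> y))"

definition type_cstar :: "'a::cstar_algebra cstar" where
  "type_cstar = \<lparr>carrier = UNIV, monoid.mult = (*), one = undefined, zero = 0, add = (+),
     smult = scaleC, star = adj, nrm = norm\<rparr>"

lemma type_cstar_simps [simp]:
  "carrier type_cstar = UNIV" "monoid.mult type_cstar = (*)"
  "zero type_cstar = 0" "add type_cstar = (+)" "smult type_cstar = scaleC"
  "star type_cstar = adj" "nrm type_cstar = norm"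
  by (simp_all add: type_cstar_def)

lemma cstar_structure_type_cstar: "cstar_structure (type_cstar :: 'a::cstar_algebra cstar)"
proof -
  let ?D = "type_cstar :: 'a cstar"
  interpret cring complex_field
  proof -
    have "\<exists>y. x + y = 0" "\<exists>y. y + x = 0" for x :: complex
      by (metis add.right_inverse, metis add.left_inverse)
    then show "cring complex_field"
      by unfold_locales (auto simp: complex_field_def algebra_simps Units_def)
  qed
  interpret D: abelian_group ?D
  proof -
    have "\<exists>y. x + y = 0 \<and> y + x = 0" for x :: 'a
      by (intro exI[of _ "- x"]) simp
    then show "abelian_group ?D"
      by unfold_locales (auto simp: algebra_simps Units_def)
  qed
  have "1 *\<^sub>C x = x" for x :: 'a
    using scaleR_eq_scaleC[of 1 x] by simp
  then have mod: "module complex_field ?D"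
    by unfold_locales
      (auto simp: complex_field_def scaleC_add_left scaleC_add_right scaleC_scaleC)
  have "x \<oplus>\<^bsub>?D\<^esub> (- x) = \<zero>\<^bsub>?D\<^esub>" for x
    by simp
  then have "\<ominus>\<^bsub>?D\<^esub> x = - x" for x
    by (metis D.minus_equality add.commute UNIV_I type_cstar_simps(1,4))
  then have minus: "x \<ominus>\<^bsub>?D\<^esub> y = x - y" for x y
    by (simp add: a_minus_def)
  have "Metric_space.mcomplete UNIV (dist :: 'a \<Rightarrow> _)"
    using mcomplete_iff_complete[where 'a='a] complete_UNIV by simp
  then have "Metric_space.mcomplete (carrier ?D) (\<lambda>x y. nrm ?D (x \<ominus>\<^bsub>?D\<^esub> y))"
    by (simp add: minus dist_norm[abs_def])
  then show ?thesis
    by (intro cstar_structure.intro mod cstar_structure_axioms.intro)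
      (auto simp: algebra_simps mult_scaleC_left mult_scaleC_right norm_scaleC adj_add adj_scaleC
        adj_mult adj_adj cstar_identity norm_triangle_ineq norm_mult_ineq)
qed

definition star_hom :: "'a cstar \<Rightarrow> 'b cstar \<Rightarrow> ('a \<Rightarrow> 'b) \<Rightarrow> bool" where
  "star_hom A B \<phi> \<longleftrightarrow>
     \<phi> \<in> carrier A \<rightarrow> carrier B \<and>
     (\<forall>x\<in>carrier A. \<forall>y\<in>carrier A. \<phi> (x \<oplus>\<^bsub>A\<^esub> y) = \<phi> x \<oplus>\<^bsub>B\<^esub> \<phi> y \<and> \<phi> (x \<otimes>\<^bsub>A\<^esub> y) = \<phi> x \<otimes>\<^bsub>B\<^esub> \<phi> y) \<and>
     (\<forall>a. \<forall>x\<in>carrier A. \<phi> (a \<odot>\<^bsub>A\<^esub> x) = a \<odot>\<^bsub>B\<^esub> \<phi> x) \<and>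
     (\<forall>x\<in>carrier A. \<phi> (star A x) = star B (\<phi> x))"

definition star_subalgebra :: "'a::cstar_algebra set \<Rightarrow> bool" where
  "star_subalgebra S \<longleftrightarrow> 0 \<in> S \<and>
     (\<forall>x\<in>S. \<forall>y\<in>S. x + y \<in> S \<and> x * y \<in> S) \<and> (\<forall>a. \<forall>x\<in>S. a *\<^sub>C x \<in> S) \<and> (\<forall>x\<in>S. adj x \<in> S)"

definition generates_cstar :: "'a::cstar_algebra set \<Rightarrow> bool" where
  "generates_cstar X \<longleftrightarrow> (\<forall>S. closed S \<and> star_subalgebra S \<and> X \<subseteq> S \<longrightarrow> S = UNIV)"


section \<open>The monoid \<open>\<nat>\<^sup>k \<times> F\<close>, its Grothendieck group and the dual group\<close>

text \<open>Vectors of length \<open>k\<close> are functions on \<open>nat\<close> that vanish from \<open>k\<close> on, so that \<open>k\<close> is an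
  ordinary natural number and may be \<open>0\<close>.\<close>

definition NF :: "nat \<Rightarrow> ((nat \<Rightarrow> nat) \<times> 'f::ab_group_add) set" where
  "NF k = {p. \<forall>i\<ge>k. fst p i = 0}"

definition ZF :: "nat \<Rightarrow> ((nat \<Rightarrow> int) \<times> 'f::ab_group_add) set" where
  "ZF k = {g. \<forall>i\<ge>k. fst g i = 0}"

definition to_ZF :: "(nat \<Rightarrow> nat) \<times> 'f \<Rightarrow> (nat \<Rightarrow> int) \<times> 'f" where
  "to_ZF p = (\<lambda>i. int (fst p i), snd p)"

text \<open>Characters are extensional on \<open>ZF k\<close>.  The group is discrete, so the topology of its dual is
  that of pointwise convergence, which is the topology the library puts on function types.\<close>

definition dual :: "nat \<Rightarrow> ((nat \<Rightarrow> int) \<times> 'f::ab_group_add \<Rightarrow> complex) set" where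
  "dual k = {\<xi> \<in> ZF k \<rightarrow>\<^sub>E sphere 0 1. \<forall>g\<in>ZF k. \<forall>h\<in>ZF k. \<xi> (g + h) = \<xi> g * \<xi> h}"

definition dual_one :: "nat \<Rightarrow> (nat \<Rightarrow> int) \<times> 'f::ab_group_add \<Rightarrow> complex" where
  "dual_one k = (\<lambda>g\<in>ZF k. 1)"

definition dual_mult :: "nat \<Rightarrow> ((nat \<Rightarrow> int) \<times> 'f::ab_group_add \<Rightarrow> complex) \<Rightarrow>
    ((nat \<Rightarrow> int) \<times> 'f \<Rightarrow> complex) \<Rightarrow> (nat \<Rightarrow> int) \<times> 'f \<Rightarrow> complex" where
  "dual_mult k \<xi> \<psi> = (\<lambda>g\<in>ZF k. \<xi> g * \<psi> g)"

locale dual_action =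
  fixes k :: nat
    and \<beta> :: "((nat \<Rightarrow> int) \<times> 'f::ab_group_add \<Rightarrow> complex) \<Rightarrow> 'b::cstar_algebra \<Rightarrow> 'b"
  assumes hom: "\<xi> \<in> dual k \<Longrightarrow> star_hom type_cstar type_cstar (\<beta> \<xi>)"
    and bij: "\<xi> \<in> dual k \<Longrightarrow> bij (\<beta> \<xi>)"
    and one: "\<beta> (dual_one k) = id"
    and mult: "\<lbrakk>\<xi> \<in> dual k; \<psi> \<in> dual k\<rbrakk> \<Longrightarrow> \<beta> (dual_mult k \<xi> \<psi>) = \<beta> \<xi> \<circ> \<beta> \<psi>"
    and strongly_continuous: "continuous_on (dual k) (\<lambda>\<xi>. \<beta> \<xi> b)"


section \<open>\<open>P\<close>-graphs for \<open>P = \<nat>\<^sup>k \<times> F\<close>\<close>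

text \<open>A small category is given by its arrows, with each object identified with its identity
  arrow: \<open>rng\<close> and \<open>src\<close> return the identity arrows at the codomain and the domain, and
  \<open>cmp \<mu> \<nu>\<close> is the composite \<open>\<mu>\<nu>\<close>, meaningful when \<open>src \<mu> = rng \<nu>\<close>.\<close>

record ('l, 'p) graded_category =
  arr :: "'l set"
  rng :: "'l \<Rightarrow> 'l"
  src :: "'l \<Rightarrow> 'l"
  cmp :: "'l \<Rightarrow> 'l \<Rightarrow> 'l"
  deg :: "'l \<Rightarrow> 'p"

definition composable :: "('l, 'p) graded_category \<Rightarrow> 'l \<Rightarrow> 'l \<Rightarrow> bool" where
  "composable \<Lambda> \<mu> \<nu> \<longleftrightarrow> \<mu> \<in> arr \<Lambda> \<and> \<nu> \<in> arr \<Lambda> \<and> src \<Lambda> \<mu> = rng \<Lambda> \<nu>"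

locale pgraph =
  fixes k :: nat
    and \<Lambda> :: "('l, (nat \<Rightarrow> nat) \<times> 'f::{ab_group_add, countable}) graded_category"
  assumes countable_arr: "countable (arr \<Lambda>)"
    and rng_in: "\<alpha> \<in> arr \<Lambda> \<Longrightarrow> rng \<Lambda> \<alpha> \<in> arr \<Lambda>"
    and src_in: "\<alpha> \<in> arr \<Lambda> \<Longrightarrow> src \<Lambda> \<alpha> \<in> arr \<Lambda>"
    and rng_rng: "\<alpha> \<in> arr \<Lambda> \<Longrightarrow> rng \<Lambda> (rng \<Lambda> \<alpha>) = rng \<Lambda> \<alpha>"
    and src_rng: "\<alpha> \<in> arr \<Lambda> \<Longrightarrow> src \<Lambda> (rng \<Lambda> \<alpha>) = rng \<Lambda> \<alpha>"
    and rng_src: "\<alpha> \<in> arr \<Lambda> \<Longrightarrow> rng \<Lambda> (src \<Lambda> \<alpha>) = src \<Lambda> \<alpha>"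
    and src_src: "\<alpha> \<in> arr \<Lambda> \<Longrightarrow> src \<Lambda> (src \<Lambda> \<alpha>) = src \<Lambda> \<alpha>"
    and cmp_in: "composable \<Lambda> \<mu> \<nu> \<Longrightarrow> cmp \<Lambda> \<mu> \<nu> \<in> arr \<Lambda>"
    and rng_cmp: "composable \<Lambda> \<mu> \<nu> \<Longrightarrow> rng \<Lambda> (cmp \<Lambda> \<mu> \<nu>) = rng \<Lambda> \<mu>"
    and src_cmp: "composable \<Lambda> \<mu> \<nu> \<Longrightarrow> src \<Lambda> (cmp \<Lambda> \<mu> \<nu>) = src \<Lambda> \<nu>"
    and cmp_assoc: "\<lbrakk>composable \<Lambda> \<alpha> \<mu>; composable \<Lambda> \<mu> \<nu>\<rbrakk> \<Longrightarrow>
      cmp \<Lambda> (cmp \<Lambda> \<alpha> \<mu>) \<nu> = cmp \<Lambda> \<alpha> (cmp \<Lambda> \<mu> \<nu>)"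
    and cmp_rng: "\<alpha> \<in> arr \<Lambda> \<Longrightarrow> cmp \<Lambda> (rng \<Lambda> \<alpha>) \<alpha> = \<alpha>"
    and cmp_src: "\<alpha> \<in> arr \<Lambda> \<Longrightarrow> cmp \<Lambda> \<alpha> (src \<Lambda> \<alpha>) = \<alpha>"
    and deg_in: "\<alpha> \<in> arr \<Lambda> \<Longrightarrow> deg \<Lambda> \<alpha> \<in> NF k"
    and deg_identity: "\<alpha> \<in> arr \<Lambda> \<Longrightarrow> rng \<Lambda> \<alpha> = \<alpha> \<Longrightarrow> deg \<Lambda> \<alpha> = 0"
    and deg_cmp: "composable \<Lambda> \<mu> \<nu> \<Longrightarrow> deg \<Lambda> (cmp \<Lambda> \<mu> \<nu>) = deg \<Lambda> \<mu> + deg \<Lambda> \<nu>"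
    and factorisation: "\<lbrakk>\<alpha> \<in> arr \<Lambda>; p \<in> NF k; q \<in> NF k; deg \<Lambda> \<alpha> = p + q\<rbrakk> \<Longrightarrow>
      \<exists>!(\<mu>, \<nu>). composable \<Lambda> \<mu> \<nu> \<and> deg \<Lambda> \<mu> = p \<and> deg \<Lambda> \<nu> = q \<and> \<alpha> = cmp \<Lambda> \<mu> \<nu>"

definition vertices :: "('l, 'p::zero) graded_category \<Rightarrow> 'l set" where
  "vertices \<Lambda> = {\<alpha> \<in> arr \<Lambda>. deg \<Lambda> \<alpha> = 0}"

lemma (in pgraph) vertices_eq_identities: "vertices \<Lambda> = {\<alpha> \<in> arr \<Lambda>. rng \<Lambda> \<alpha> = \<alpha>}"
proof -
  have "rng \<Lambda> \<alpha> = \<alpha>" if l: "\<alpha> \<in> arr \<Lambda>" "deg \<Lambda> \<alpha> = 0" for \<alpha>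
  proof -
    have zero: "(0 :: (nat \<Rightarrow> nat) \<times> 'f) \<in> NF k"
      by (simp add: NF_def)
    have uniq: "\<exists>!(\<mu>, \<nu>). composable \<Lambda> \<mu> \<nu> \<and> deg \<Lambda> \<mu> = 0 \<and> deg \<Lambda> \<nu> = 0 \<and> \<alpha> = cmp \<Lambda> \<mu> \<nu>"
      using factorisation[OF l(1) zero zero] l(2) by simp
    have "deg \<Lambda> (rng \<Lambda> \<alpha>) = 0" "deg \<Lambda> (src \<Lambda> \<alpha>) = 0"
      using l(1) deg_identity rng_in src_in rng_rng rng_src by auto
    then have "composable \<Lambda> (rng \<Lambda> \<alpha>) \<alpha> \<and> deg \<Lambda> (rng \<Lambda> \<alpha>) = 0 \<and> deg \<Lambda> \<alpha> = 0 \<and>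
          \<alpha> = cmp \<Lambda> (rng \<Lambda> \<alpha>) \<alpha>"
        "composable \<Lambda> \<alpha> (src \<Lambda> \<alpha>) \<and> deg \<Lambda> \<alpha> = 0 \<and> deg \<Lambda> (src \<Lambda> \<alpha>) = 0 \<and>
          \<alpha> = cmp \<Lambda> \<alpha> (src \<Lambda> \<alpha>)"
      using l rng_in src_in src_rng rng_src cmp_rng cmp_src by (auto simp: composable_def)
    with uniq show ?thesis
      by blast
  qed
  with deg_identity show ?thesis
    by (auto simp: vertices_def)
qed

definition paths_from :: "('l, 'p) graded_category \<Rightarrow> 'l \<Rightarrow> 'p \<Rightarrow> 'l set" where
  "paths_from \<Lambda> v p = {\<alpha> \<in> arr \<Lambda>. deg \<Lambda> \<alpha> = p \<and> rng \<Lambda> \<alpha> = v}"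

definition row_finite :: "nat \<Rightarrow> ('l, (nat \<Rightarrow> nat) \<times> 'f::ab_group_add) graded_category \<Rightarrow> bool" where
  "row_finite k \<Lambda> \<longleftrightarrow> (\<forall>v\<in>vertices \<Lambda>. \<forall>p\<in>NF k. finite (paths_from \<Lambda> v p))"

definition no_sources :: "nat \<Rightarrow> ('l, (nat \<Rightarrow> nat) \<times> 'f::ab_group_add) graded_category \<Rightarrow> bool" where
  "no_sources k \<Lambda> \<longleftrightarrow> (\<forall>v\<in>vertices \<Lambda>. \<forall>p\<in>NF k. paths_from \<Lambda> v p \<noteq> {})"

text \<open>Values of a 2-cocycle on non-composable pairs are irrelevant.\<close>

definition cocycle :: "('l, 'p) graded_category \<Rightarrow> ('l \<Rightarrow> 'l \<Rightarrow> complex) \<Rightarrow> bool" where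
  "cocycle \<Lambda> c \<longleftrightarrow>
     (\<forall>\<mu> \<nu>. composable \<Lambda> \<mu> \<nu> \<longrightarrow> c \<mu> \<nu> \<in> sphere 0 1) \<and>
     (\<forall>\<alpha> \<mu> \<nu>. composable \<Lambda> \<alpha> \<mu> \<and> composable \<Lambda> \<mu> \<nu> \<longrightarrow>
        c \<alpha> \<mu> * c (cmp \<Lambda> \<alpha> \<mu>) \<nu> = c \<mu> \<nu> * c \<alpha> (cmp \<Lambda> \<mu> \<nu>)) \<and>
     (\<forall>\<alpha>\<in>arr \<Lambda>. c (rng \<Lambda> \<alpha>) \<alpha> = 1 \<and> c \<alpha> (src \<Lambda> \<alpha>) = 1)"


section \<open>Cuntz--Krieger families and \<open>C*(\<Lambda>,c)\<close>\<close>

locale CK_family =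
  fixes k :: nat
    and \<Lambda> :: "('l, (nat \<Rightarrow> nat) \<times> 'f::ab_group_add) graded_category"
    and c :: "'l \<Rightarrow> 'l \<Rightarrow> complex"
    and D :: "'d cstar" (structure)
    and t :: "'l \<Rightarrow> 'd"
  assumes closed: "\<alpha> \<in> arr \<Lambda> \<Longrightarrow> t \<alpha> \<in> carrier D"
    and CK1_projection: "v \<in> vertices \<Lambda> \<Longrightarrow> t v \<otimes> t v = t v \<and> star D (t v) = t v"
    and CK1_orthogonal: "\<lbrakk>v \<in> vertices \<Lambda>; w \<in> vertices \<Lambda>; v \<noteq> w\<rbrakk> \<Longrightarrow> t v \<otimes> t w = \<zero>"
    and CK2: "composable \<Lambda> \<mu> \<nu> \<Longrightarrow> t \<mu> \<otimes> t \<nu> = c \<mu> \<nu> \<odot> t (cmp \<Lambda> \<mu> \<nu>)"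
    and CK3: "\<alpha> \<in> arr \<Lambda> \<Longrightarrow> star D (t \<alpha>) \<otimes> t \<alpha> = t (src \<Lambda> \<alpha>)"
    and CK4: "\<lbrakk>v \<in> vertices \<Lambda>; p \<in> NF k\<rbrakk> \<Longrightarrow>
      t v = (\<Oplus>\<alpha>\<in>paths_from \<Lambda> v p. t \<alpha> \<otimes> star D (t \<alpha>))"

text \<open>\<open>is_universal k \<Lambda> c s\<close> says that the type \<open>'a\<close> together with \<open>s\<close> is \<open>C*(\<Lambda>,c)\<close>: the family
  \<open>s\<close> generates, and every family in every C*-algebra \<open>D\<close> is the image of \<open>s\<close> under a
  *-homomorphism (which is unique, since \<open>s\<close> generates).

  It is enough to let \<open>D\<close> range over the C*-algebras whose carrier is a set of real sequences.
  Indeed \<open>\<Lambda>\<close> is countable, so a family lies in a separable C*-subalgebra \<open>D\<close>; if \<open>q\<^sub>0, q\<^sub>1, \<dots>\<close> is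
  dense in \<open>D\<close> then \<open>x \<mapsto> (\<lambda>n. \<parallel>x - q\<^sub>n\<parallel>)\<close> is injective on \<open>D\<close>, and \<open>D\<close> may be replaced by its
  image with the transported structure.\<close>

definition is_universal :: "nat \<Rightarrow> ('l, (nat \<Rightarrow> nat) \<times> 'f::ab_group_add) graded_category \<Rightarrow>
    ('l \<Rightarrow> 'l \<Rightarrow> complex) \<Rightarrow> ('l \<Rightarrow> 'a::cstar_algebra) \<Rightarrow> bool" where
  "is_universal k \<Lambda> c s \<longleftrightarrow>
     CK_family k \<Lambda> c type_cstar s \<and>
     generates_cstar (s ` arr \<Lambda>) \<and>
     (\<forall>(D :: (nat \<Rightarrow> real) cstar) t. cstar_structure D \<and> CK_family k \<Lambda> c D t \<longrightarrow>
        (\<exists>\<phi>. star_hom type_cstar D \<phi> \<and> (\<forall>\<alpha>\<in>arr \<Lambda>. \<phi> (s \<alpha>) = t \<alpha>)))"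

definition is_induced_hom :: "('l, 'p) graded_category \<Rightarrow> ('l \<Rightarrow> 'a::cstar_algebra) \<Rightarrow>
    ('l \<Rightarrow> 'b::cstar_algebra) \<Rightarrow> ('a \<Rightarrow> 'b) \<Rightarrow> bool" where
  "is_induced_hom \<Lambda> s t \<pi> \<longleftrightarrow>
     star_hom type_cstar type_cstar \<pi> \<and> (\<forall>\<alpha>\<in>arr \<Lambda>. \<pi> (s \<alpha>) = t \<alpha>)"

end

theory Submission
  imports Defs "HOL-Real_Asymp.Real_Asymp"
begin

text \<open>
  The span of the products \<open>t\<^sub>\<mu> t\<^sub>\<nu>\<^sup>*\<close> is graded by \<open>d(\<mu>) - d(\<nu>)\<close>.  Its part of degree \<open>0\<close> is an
  increasing union of finite-dimensional matrix algebras, on which \<open>\<pi>\<close> is isometric as soon as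
  no \<open>t\<^sub>v\<close> vanishes; by the C*-identity \<open>\<pi>\<close> is isometric on every graded piece.  Averaging the action
  \<open>\<beta>\<close> over powers of characters shows that in \<open>B\<close> a homogeneous component is no longer than the whole
  sum.  Hence, if \<open>x = a\<^sup>*a\<close> has finitely many components, then the norm of \<open>x\<^sup>n\<close> is at most the norm of
  \<open>\<pi>(x)\<^sup>n\<close> times the number of degrees in \<open>x\<^sup>n\<close>, which is polynomial in \<open>n\<close>.  Taking \<open>n\<close>-th roots
  along \<open>n = 2\<^sup>m\<close> yields \<open>\<parallel>x\<parallel> \<le> \<parallel>\<pi>(x)\<parallel>\<close>, so no Haar integral, no gauge action on
  \<open>C*(\<Lambda>,c)\<close> and no faithful expectation are needed.

  Conversely, \<open>s\<^sub>v \<noteq> 0\<close> because there is a representation on a Hilbert space in which the projection at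
  \<open>v\<close> does not vanish.  It is a direct limit along an infinite path starting at \<open>v\<close>.
\<close>

section \<open>Elementary facts about C*-algebras\<close>

text \<open>Positivity enters through two facts: a *-homomorphism does not increase norms, and
  projections whose sum acts as the identity on each of them are mutually orthogonal. Both rest on
  one device, a square root of \<open>1 - k\<close> for \<open>norm k < 1\<close>, found as a fixed
  point. The second fact is indispensable: the relations assert orthogonality at vertices only, and
  for the range projections of distinct paths of equal degree it has to be extracted from (CK4).
  Powers are taken by repeated squaring because the C*-identity gives the norm of the square of a
  self-adjoint element exactly. The same argument also removes the constant, depending on the size
  of the matrix algebra, that the crude estimate in degree 0 produces. For the converse one infinite
  path per vertex is enough, since only the projection at its starting vertex has to survive. The
  twist shapes the limit: the cocycle need not be a coboundary, so the identifications between
  stages carry phases, and the cocycle identity is exactly what makes the coefficients of the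
  operators independent of the stage.\<close>

declare adj_add [simp] adj_mult [simp] adj_adj [simp] adj_scaleC [simp] norm_scaleC [simp]

lemma scaleC_one [simp]: "1 *\<^sub>C x = (x :: 'a::cstar_algebra)"
  using scaleR_eq_scaleC[of 1 x] by simp

lemma scaleC_zero_left [simp]: "0 *\<^sub>C x = (0 :: 'a::cstar_algebra)"
  using scaleR_eq_scaleC[of 0 x] by simp

lemma scaleC_zero_right [simp]: "z *\<^sub>C 0 = (0 :: 'a::cstar_algebra)"
  using scaleC_add_right[of z 0 "0 :: 'a"] by simp

lemma scaleC_minus_one: "(-1) *\<^sub>C x = - (x :: 'a::cstar_algebra)"
  using scaleR_eq_scaleC[of "-1" x] by simp

lemma scaleC_minus_left [simp]: "(- z) *\<^sub>C x = - (z *\<^sub>C x :: 'a::cstar_algebra)"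
  using scaleC_scaleC[of "-1" z x] by (simp add: scaleC_minus_one)

lemma scaleC_minus_right [simp]: "z *\<^sub>C (- x) = - (z *\<^sub>C x :: 'a::cstar_algebra)"
  using scaleC_scaleC[of z "-1" x] by (simp add: scaleC_minus_one)

lemma scaleC_diff_right: "z *\<^sub>C (x - y) = z *\<^sub>C x - z *\<^sub>C (y :: 'a::cstar_algebra)"
  using scaleC_add_right[of z x "- y"] by simp

lemma scaleC_sum_right: "z *\<^sub>C (\<Sum>i\<in>I. f i) = (\<Sum>i\<in>I. z *\<^sub>C (f i :: 'a::cstar_algebra))"
  by (induction I rule: infinite_finite_induct) (auto simp: scaleC_add_right)

lemma scaleC_sum_left: "(\<Sum>i\<in>I. f i) *\<^sub>C x = (\<Sum>i\<in>I. f i *\<^sub>C (x :: 'a::cstar_algebra))"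
  by (induction I rule: infinite_finite_induct) (auto simp: scaleC_add_left)

lemma adj_zero [simp]: "adj 0 = (0 :: 'a::cstar_algebra)"
  using adj_add[of 0 "0 :: 'a"] by simp

lemma adj_minus [simp]: "adj (- x) = - adj (x :: 'a::cstar_algebra)"
  using adj_add[of x "- x"] by (simp add: eq_neg_iff_add_eq_0 add.commute)

lemma adj_diff [simp]: "adj (x - y) = adj x - adj (y :: 'a::cstar_algebra)"
  using adj_add[of x "- y"] by simp

lemma adj_scaleR [simp]: "adj (r *\<^sub>R x) = r *\<^sub>R adj (x :: 'a::cstar_algebra)"
  by (simp add: scaleR_eq_scaleC)

lemma adj_sum [simp]: "adj (\<Sum>i\<in>I. f i) = (\<Sum>i\<in>I. adj (f i :: 'a::cstar_algebra))"
  by (induction I rule: infinite_finite_induct) auto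

lemma norm_adj [simp]: "norm (adj x) = norm (x :: 'a::cstar_algebra)"
proof -
  have le: "norm x \<le> norm (adj x)" for x :: 'a
  proof (cases "x = 0")
    case False
    have "norm x * norm x \<le> norm (adj x) * norm x"
      using norm_mult_ineq[of "adj x" x] by (simp add: cstar_identity power2_eq_square)
    with False show ?thesis by simp
  qed simp
  show ?thesis
    using le[of x] le[of "adj x"] by simp
qed

lemma norm_selfadjoint_square: "adj x = x \<Longrightarrow> norm (x * x) = (norm (x :: 'a::cstar_algebra))\<^sup>2"
  using cstar_identity[of x] by simp

lemma bounded_linear_adj: "bounded_linear (adj :: 'a::cstar_algebra \<Rightarrow> 'a)"
  by (rule bounded_linear_intro[of _ 1]) auto

lemma bounded_linear_scaleC: "bounded_linear ((*\<^sub>C) z :: 'a::cstar_algebra \<Rightarrow> 'a)"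
  by (rule bounded_linear_intro[of _ "cmod z"])
    (auto simp: scaleC_add_right scaleR_eq_scaleC scaleC_scaleC mult.commute)

lemmas continuous_on_adj [continuous_intros] =
  bounded_linear.continuous_on[OF bounded_linear_adj]

text \<open>This plays the role of the square root: \<open>(1 - w)\<^sup>2 = 1 - k\<close>.  The norm bound on \<open>w\<close> is the
  smaller root of \<open>2r - r\<^sup>2 = \<parallel>k\<parallel>\<close>, which makes \<open>x \<mapsto> (k + x\<^sup>2)/2\<close> a contraction of a ball into
  itself.\<close>

lemma sqrt_one_minus:
  fixes k :: "'a::cstar_algebra"
  assumes "norm k < 1" and "closed S" and "0 \<in> S" and step: "\<And>x. x \<in> S \<Longrightarrow> (1/2) *\<^sub>R (k + x * x) \<in> S"
  obtains w where "w \<in> S" and "w + w - w * w = k"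
proof -
  define r where "r = 1 - sqrt (1 - norm k)"
  have r: "0 \<le> r" "r < 1"
    using assms(1) by (auto simp: r_def)
  have "(1 - r)\<^sup>2 = 1 - norm k"
    using assms(1) by (simp add: r_def)
  then have rk: "norm k + r * r = 2 * r"
    by (simp add: power2_eq_square algebra_simps)
  define T where "T = S \<inter> cball 0 r"
  let ?f = "\<lambda>x. (1/2) *\<^sub>R (k + x * x)"
  have "\<exists>!x\<in>T. ?f x = x"
  proof (rule Banach_fix[where c = r])
    show "complete T"
      using assms(2) by (simp add: T_def complete_eq_closed closed_Int)
    show "T \<noteq> {}"
      using assms(3) r by (auto simp: T_def)
    show "?f ` T \<subseteq> T"
    proof safe
      fix x assume x: "x \<in> T"
      have "norm (x * x) \<le> r * r"
        using x r by (intro order_trans[OF norm_mult_ineq] mult_mono) (auto simp: T_def)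
      then have "norm (k + x * x) \<le> 2 * r"
        using norm_triangle_ineq[of k "x * x"] rk by linarith
      with x step show "?f x \<in> T"
        by (auto simp: T_def)
    qed
    show "dist (?f x) (?f y) \<le> r * dist x y" if "x \<in> T" "y \<in> T" for x y
    proof -
      have "x * x - y * y = x * (x - y) + (x - y) * y"
        by (simp add: algebra_simps)
      then have "norm (x * x - y * y) \<le> norm x * norm (x - y) + norm (x - y) * norm y"
        by (metis norm_triangle_le add_mono norm_mult_ineq)
      also have "\<dots> \<le> r * norm (x - y) + norm (x - y) * r"
        using that r by (intro add_mono mult_mono) (auto simp: T_def)
      finally have "norm (x * x - y * y) \<le> 2 * (r * norm (x - y))"
        by (simp add: algebra_simps)
      moreover have "?f x - ?f y = (1/2) *\<^sub>R (x * x - y * y)"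
        by (simp add: algebra_simps)
      ultimately show ?thesis
        unfolding dist_norm by (simp only: norm_scaleR)
    qed
  qed (use r in auto)
  then obtain w where w: "w \<in> S" "?f w = w"
    by (auto simp: T_def)
  have "k + w * w = 2 *\<^sub>R ?f w"
    by simp
  also have "\<dots> = w + w"
    unfolding w(2) by (simp add: scaleR_2)
  finally show ?thesis
    using that[of w] w by (simp add: algebra_simps)
qed

text \<open>The self-adjoint elements commuting with \<open>X\<close> form a closed set that the
  iteration preserves, so the fixed point inherits these properties from \<open>k\<close>.\<close>

lemma sqrt_one_minus_selfadjoint:
  fixes k :: "'a::cstar_algebra"
  assumes "norm k < 1" and "adj k = k" and X: "\<And>x. x \<in> X \<Longrightarrow> x * k = k * x"
  shows "\<exists>w. adj w = w \<and> w + w - w * w = k \<and> (\<forall>x\<in>X. x * w = w * x)"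
proof -
  define S where "S = {w. adj w = w} \<inter> (\<Inter>x\<in>X. {w. x * w = w * x})"
  have "closed S"
    unfolding S_def by (intro closed_Int closed_INT ballI closed_Collect_eq continuous_intros)
  moreover have "(1/2) *\<^sub>R (k + w * w) \<in> S" if "w \<in> S" for w
  proof -
    have "x * (w * w) = (w * w) * x" if "x \<in> X" for x
      using \<open>w \<in> S\<close> that by (simp add: S_def) (metis mult.assoc)
    with that assms show ?thesis
      by (auto simp: S_def algebra_simps)
  qed
  ultimately obtain w where "w \<in> S" "w + w - w * w = k"
    using sqrt_one_minus[OF assms(1), of S] by (auto simp: S_def)
  then show ?thesis
    by (auto simp: S_def)
qed

text \<open>With \<open>u = x + iy\<close> one has \<open>u\<^sup>*u = uu\<^sup>* = x\<^sup>2 + y\<^sup>2\<close> and \<open>x = (u + u\<^sup>*)/2\<close>.\<close>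

lemma norm_square_le_sum_squares:
  fixes x y :: "'a::cstar_algebra"
  assumes "adj x = x" and "adj y = y" and "x * y = y * x"
  shows "(norm x)\<^sup>2 \<le> norm (x * x + y * y)"
proof -
  define u where "u = x + \<i> *\<^sub>C y"
  have "adj u * u = x * x + y * y"
    using assms by (simp add: u_def algebra_simps mult_scaleC_left mult_scaleC_right scaleC_scaleC
      scaleC_add_right scaleC_diff_right)
  then have u: "(norm u)\<^sup>2 = norm (x * x + y * y)"
    using cstar_identity[of u] by simp
  have "u + adj u = 2 *\<^sub>R x"
    using assms by (simp add: u_def scaleR_2)
  then have "2 * norm x \<le> norm u + norm (adj u)"
    using norm_triangle_ineq[of u "adj u"] by simp
  then have "norm x \<le> norm u"
    by simp
  then have "(norm x)\<^sup>2 \<le> (norm u)\<^sup>2"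
    by (simp add: power_mono)
  with u show ?thesis
    by simp
qed

section \<open>Norm bounds for *-homomorphisms and the test for vanishing\<close>

lemma star_homD:
  assumes "star_hom type_cstar type_cstar (\<phi> :: 'a::cstar_algebra \<Rightarrow> 'b::cstar_algebra)"
  shows "\<phi> (x + y) = \<phi> x + \<phi> y" and "\<phi> (x * y) = \<phi> x * \<phi> y"
    and "\<phi> (z *\<^sub>C x) = z *\<^sub>C \<phi> x" and "\<phi> (adj x) = adj (\<phi> x)"
    and "\<phi> 0 = 0" and "\<phi> (- x) = - \<phi> x" and "\<phi> (x - y) = \<phi> x - \<phi> y"
    and "\<phi> (r *\<^sub>R x) = r *\<^sub>R \<phi> x" and "\<phi> (sum f I) = (\<Sum>i\<in>I. \<phi> (f i))"
proof -
  show add: "\<phi> (x + y) = \<phi> x + \<phi> y" for x y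
    using assms by (simp add: star_hom_def)
  show "\<phi> (x * y) = \<phi> x * \<phi> y" "\<phi> (adj x) = adj (\<phi> x)"
    and scale: "\<phi> (z *\<^sub>C x) = z *\<^sub>C \<phi> x" for z x y
    using assms by (simp_all add: star_hom_def)
  show zero: "\<phi> 0 = 0"
    using add[of 0 0] by simp
  show minus: "\<phi> (- x) = - \<phi> x" for x
    using scale[of "-1" x] by simp
  show "\<phi> (x - y) = \<phi> x - \<phi> y"
    using add[of x "- y"] by (simp add: minus)
  show "\<phi> (r *\<^sub>R x) = r *\<^sub>R \<phi> x"
    by (simp add: scaleR_eq_scaleC scale)
  show "\<phi> (sum f I) = (\<Sum>i\<in>I. \<phi> (f i))"
    by (induction I rule: infinite_finite_induct) (auto simp: zero add)
qed

text \<open>If \<open>h\<close> is self-adjoint and \<open>\<parallel>h\<parallel> < 1\<close>, then \<open>1 - h\<^sup>2 = (1 - w)\<^sup>2\<close>.  The identity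
  \<open>\<phi>(h)\<^sup>2 + (1 - \<phi>(w))\<^sup>2 = 1\<close> then bounds \<open>\<phi>(h)\<close>; it is read through left multiplication on
  \<open>z\<close>, because there is no unit.\<close>

lemma star_hom_norm_le:
  fixes \<phi> :: "'a::cstar_algebra \<Rightarrow> 'b::cstar_algebra"
  assumes "star_hom type_cstar type_cstar \<phi>"
  shows "norm (\<phi> x) \<le> norm x"
proof -
  note hom = star_homD[OF assms]
  have small: "norm (\<phi> h) \<le> 1" if h: "adj h = h" "norm h < 1" for h
  proof -
    have "norm (h * h) < 1"
      using h by (simp add: norm_selfadjoint_square power_less_one_iff)
    moreover have "adj (h * h) = h * h"
      using h by simp
    moreover have "g * (h * h) = h * h * g" if "g \<in> {h}" for g
      using that by (simp add: mult.assoc)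
    ultimately have "\<exists>w. adj w = w \<and> w + w - w * w = h * h \<and> (\<forall>g\<in>{h}. g * w = w * g)"
      by (rule sqrt_one_minus_selfadjoint)
    then obtain w where w: "adj w = w" "w + w - w * w = h * h" "h * w = w * h"
      by blast
    define b v where "b = \<phi> h" and "v = \<phi> w"
    have sa: "adj b = b" "adj v = v"
      using h(1) w(1) by (metis hom(4) b_def v_def)+
    have "v + v - v * v = b * b" "b * v = v * b"
      unfolding b_def v_def using w(2,3) by (simp_all flip: hom)
    then have bv: "b * b = v + v - v * v" "b * v = v * b"
      by simp_all
    have le: "norm (b * z) \<le> norm z" for z
    proof -
      \<comment> \<open>Formally \<open>p\<close> and \<open>m\<close> are b + i(1 - v) and b - i(1
        - v) applied to \<open>z\<close>. These two operators are unitary, because b^2 + (1 - v)^2 =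
        1 with b and v commuting, and \<open>b * z\<close> is the average of \<open>p\<close> and
        \<open>m\<close>.\<close>
      define p m y where "p = b * z + \<i> *\<^sub>C y" and "m = b * z - \<i> *\<^sub>C y" and "y = z - v * z"
      have vv: "v * (v * z) = v * z + v * z - b * (b * z)"
      proof -
        have "b * b * z = (v + v - v * v) * z"
          by (simp only: bv)
        then show ?thesis by (simp add: algebra_simps)
      qed
      have vb: "v * (b * z) = b * (v * z)"
        by (metis bv(2) mult.assoc)
      have "adj y * y = adj z * (z - b * (b * z))"
        by (simp add: y_def sa ring_distribs mult.assoc vv)
      moreover have "adj y * (b * z) = adj (b * z) * y"
        by (simp add: y_def sa ring_distribs mult.assoc vb)
      ultimately have "adj p * p = adj z * z" "adj m * m = adj z * z"
        unfolding p_def m_def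
        by (simp_all add: sa ring_distribs mult.assoc mult_scaleC_left mult_scaleC_right scaleC_scaleC
          scaleC_add_right scaleC_diff_right)
      then have "norm p = norm z" "norm m = norm z"
        by (metis cstar_identity norm_ge_zero power2_eq_imp_eq)+
      moreover have "p + m = 2 *\<^sub>R (b * z)"
        by (simp add: p_def m_def scaleR_2)
      then have "2 * norm (b * z) \<le> norm p + norm m"
        using norm_triangle_ineq[of p m] by simp
      ultimately show ?thesis by simp
    qed
    have "norm b * norm b \<le> norm b"
      using le[of b] norm_selfadjoint_square[OF sa(1)] by (simp add: power2_eq_square)
    then have "norm b \<le> 1"
      by (cases "b = 0") auto
    then show ?thesis
      by (simp add: b_def)
  qed
  \<comment> \<open>Dividing by \<open>norm h + e\<close> makes the norm strictly smaller than 1, as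
    \<open>small\<close> demands, and includes \<open>h = 0\<close>.\<close>
  have sa: "norm (\<phi> h) \<le> norm h" if "adj h = h" for h
  proof (rule field_le_epsilon)
    fix e :: real assume e: "e > 0"
    define r where "r = norm h + e"
    have r: "r > 0" using e by (auto simp: r_def intro: add_nonneg_pos)
    have "norm (\<phi> (inverse r *\<^sub>R h)) \<le> 1"
      using that e r by (intro small) (auto simp: r_def field_simps)
    then show "norm (\<phi> h) \<le> norm h + e"
      using r by (simp add: hom r_def field_simps)
  qed
  have "(norm (\<phi> x))\<^sup>2 \<le> (norm x)\<^sup>2"
    using sa[of "adj x * x"] by (simp add: hom cstar_identity)
  then show ?thesis
    by (rule power2_le_imp_le) simp
qed

lemma star_hom_bounded_linear:
  assumes "star_hom type_cstar type_cstar (\<phi> :: 'a::cstar_algebra \<Rightarrow> 'b::cstar_algebra)"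
  shows "bounded_linear \<phi>"
  by (rule bounded_linear_intro[of _ 1]) (auto simp: star_homD[OF assms] star_hom_norm_le[OF assms])

text \<open>With \<open>e\<close> the unit of the corner containing \<open>y\<close>, the hypotheses say that \<open>y\<close> and \<open>-y\<close> are both
  positive.  Then \<open>\<delta>e + (1-\<delta>)y\<close> and \<open>\<delta>e - (1-\<delta>)y\<close> are squares of commuting self-adjoint elements
  whose sum is \<open>2\<delta>e\<close>.\<close>

lemma eq_0_if_positive_and_negative:
  fixes e y :: "'a::cstar_algebra"
  assumes e: "e * e = e" "adj e = e" "norm e \<le> 1"
    and y: "adj y = y" "e * y = y" "y * e = y"
    and bound: "norm (e + y) \<le> 1" "norm (e - y) \<le> 1"
  shows "y = 0"
proof -
  \<comment> \<open>Origin of the 3: the two squares add up to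
    \<open>(2 * \<delta>) *\<^sub>R e\<close>, so \<open>u * u\<close> has norm at most
    \<open>2 * \<delta>\<close>, and
    \<open>(1 - \<delta>) *\<^sub>R y = \<delta> *\<^sub>R e - u * u\<close> costs one more
    \<delta>.\<close>
  have main: "norm ((1 - \<delta>) *\<^sub>R y) \<le> 3 * \<delta>" if \<delta>: "0 < \<delta>" "\<delta> < 1" for \<delta>
  proof -
    have root: "\<exists>x. adj x = x \<and> x * x = \<delta> *\<^sub>R e - (1 - \<delta>) *\<^sub>R z \<and> (\<forall>g\<in>X. g * x = x * g)"
      if z: "adj z = z" "e * z = z" "z * e = z" "norm (e + z) \<le> 1"
        and X: "\<And>g. g \<in> X \<Longrightarrow> g * e = e * g \<and> g * z = z * g" for z X
    proof -
      \<comment> \<open>Chosen so that \<open>e - q\<close> is the element whose root is wanted; the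
        factor \<open>1 - \<delta>\<close> brings the norm strictly below 1.\<close>
      define q where "q = (1 - \<delta>) *\<^sub>R (e + z)"
      have "norm q \<le> (1 - \<delta>) * 1"
        unfolding q_def norm_scaleR using \<delta> z(4) by (intro mult_mono) auto
      then have "norm q < 1"
        using \<delta> by simp
      moreover have "adj q = q" "g * q = q * g" if "g \<in> insert e X" for g
        using that z e X by (auto simp: q_def algebra_simps)
      ultimately have "\<exists>w. adj w = w \<and> w + w - w * w = q \<and> (\<forall>g\<in>insert e X. g * w = w * g)"
        by (intro sqrt_one_minus_selfadjoint) blast+
      then obtain w where w: "adj w = w" "w + w - w * w = q" "\<forall>g\<in>insert e X. g * w = w * g"
        by blast
      \<comment> \<open>The root of 1 - q cut down to the corner of \<open>e\<close>. Since
        \<open>e\<close> commutes with \<open>w\<close>, its square is e(1 - w)^2 = e - q.\<close>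
      define x where "x = e - e * w"
      have ew: "w * e = e * w"
        using w(3) by simp
      have ewe: "e * (e * w) = e * w" "e * w * e = e * w" "e * w * (e * w) = e * (w * w)"
        using e(1) ew by (metis mult.assoc, metis mult.assoc, metis mult.assoc)
      have "e * q = e * (w + w - w * w)"
        using w by simp
      also have "e * q = q"
        using e z by (simp add: q_def algebra_simps)
      finally have eq: "q = e * w + e * w - e * (w * w)"
        by (simp add: algebra_simps)
      have "x * x = e - q"
        unfolding x_def eq left_diff_distrib right_diff_distrib ewe e(1) by simp
      also have "\<dots> = \<delta> *\<^sub>R e - (1 - \<delta>) *\<^sub>R z"
        by (simp add: q_def algebra_simps)
      finally have "x * x = \<delta> *\<^sub>R e - (1 - \<delta>) *\<^sub>R z" .
      moreover have "adj x = x"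
        by (simp add: x_def e(2) w(1) ew)
      moreover have "g * x = x * g" if "g \<in> X" for g
      proof -
        have "g * w = w * g" "g * e = e * g"
          using w(3) X[OF that] that by blast+
        then have "g * (e * w) = e * w * g"
          by (metis mult.assoc)
        then show ?thesis
          using X[OF that] by (simp add: x_def left_diff_distrib right_diff_distrib)
      qed
      ultimately show ?thesis by blast
    qed
    obtain u where u: "adj u = u" "u * u = \<delta> *\<^sub>R e - (1 - \<delta>) *\<^sub>R y"
      "\<forall>g\<in>{e, y}. g * u = u * g"
    proof -
      have "g * e = e * g \<and> g * y = y * g" if "g \<in> {e, y}" for g
        using that y by auto
      then show ?thesis
        using root[of y "{e, y}"] y bound(1) that by blast
    qed
    obtain v where v: "adj v = v" "v * v = \<delta> *\<^sub>R e - (1 - \<delta>) *\<^sub>R (- y)" "\<forall>g\<in>{u}. g * v = v * g"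
    proof -
      have "g * e = e * g \<and> g * (- y) = (- y) * g" if "g \<in> {u}" for g
        using that u(3) by auto
      then show ?thesis
        using root[of "- y" "{u}"] y bound(2) that by auto
    qed
    have "(norm u)\<^sup>2 \<le> norm (u * u + v * v)"
      using u v by (intro norm_square_le_sum_squares) auto
    also have "u * u + v * v = (2 * \<delta>) *\<^sub>R e"
      using u v by (simp flip: scaleR_2)
    also have "norm \<dots> \<le> 2 * \<delta>"
      using \<delta> e(3) by (simp add: mult_left_le)
    finally have "norm (u * u) \<le> 2 * \<delta>"
      using norm_selfadjoint_square[OF u(1)] by simp
    moreover have "(1 - \<delta>) *\<^sub>R y = \<delta> *\<^sub>R e - u * u"
      using u by simp
    moreover have "norm (\<delta> *\<^sub>R e) \<le> \<delta>"
      using \<delta> e(3) by (simp add: mult_left_le)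
    ultimately show ?thesis
      using norm_triangle_ineq4[of "\<delta> *\<^sub>R e" "u * u"] by simp
  qed
  have "norm y \<le> 0"
  proof (rule tendsto_le)
    show "eventually (\<lambda>\<delta>. norm ((1 - \<delta>) *\<^sub>R y) \<le> 3 * \<delta>) (at_right 0)"
      using eventually_at_right_less eventually_at_right_real[of 0 1]
      by (rule eventually_elim2) (use main in auto)
    have "((\<lambda>\<delta>. norm ((1 - \<delta>) *\<^sub>R y)) \<longlongrightarrow> norm ((1 - 0) *\<^sub>R y)) (at_right 0)"
      by (intro tendsto_intros)
    then show "((\<lambda>\<delta>. norm ((1 - \<delta>) *\<^sub>R y)) \<longlongrightarrow> norm y) (at_right 0)"
      by simp
    have "((\<lambda>\<delta>. 3 * \<delta>) \<longlongrightarrow> 3 * (0::real)) (at_right 0)"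
      by (intro tendsto_intros)
    then show "((\<lambda>\<delta>. 3 * \<delta>) \<longlongrightarrow> (0::real)) (at_right 0)"
      by simp
  qed simp
  then show ?thesis by simp
qed

section \<open>Orthogonality of projections\<close>

lemma norm_projection_le_1:
  fixes p :: "'a::cstar_algebra"
  assumes "p * p = p" and "adj p = p"
  shows "norm p \<le> 1"
proof -
  have "norm p * norm p = norm p"
    using cstar_identity[of p] assms by (simp add: power2_eq_square)
  then show ?thesis by auto
qed

text \<open>\<open>1 - p\<close> is the average of the unitaries \<open>1\<close> and \<open>1 - 2p\<close>.\<close>

lemma norm_projection_complement_le:
  fixes p :: "'a::cstar_algebra"
  assumes "p * p = p" and "adj p = p"
  shows "norm (z - p * z) \<le> norm z"
proof -
  define r where "r = z - p * z - p * z"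
  have "p * (p * z) = p * z"
    by (metis assms(1) mult.assoc)
  then have "adj r * r = adj z * z"
    by (simp add: r_def algebra_simps assms)
  then have "norm r = norm z"
    by (metis cstar_identity norm_ge_zero power2_eq_imp_eq)
  moreover have "2 *\<^sub>R (z - p * z) = z + r"
    by (simp add: r_def scaleR_2)
  then have "2 * norm (z - p * z) \<le> norm z + norm r"
    by (metis norm_triangle_ineq norm_scaleR abs_numeral)
  ultimately show ?thesis by simp
qed

text \<open>Compression by \<open>e = p j\<close> turns the other projections into positive elements
  \<open>y k\<close> of the corner of \<open>e\<close> with sum 0. Hence \<open>y i\<close> and its
  negative are both positive and \<open>y i = 0\<close>; but \<open>y i\<close> is
  \<open>adj (p i * p j) * (p i * p j)\<close>. Positivity of \<open>y k\<close> is expressed by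
  \<open>norm (e - y k) \<le> 1\<close>.\<close>

lemma sum_projections_orthogonal:
  fixes p :: "'i \<Rightarrow> 'a::cstar_algebra"
  assumes "finite I" and proj: "\<And>i. i \<in> I \<Longrightarrow> p i * p i = p i \<and> adj (p i) = p i"
    and below: "\<And>i. i \<in> I \<Longrightarrow> sum p I * p i = p i"
    and "i \<in> I" and "j \<in> I" and "i \<noteq> j"
  shows "p i * p j = 0"
proof -
  define e where "e = p j"
  define y where "y k = e * p k * e" for k
  define J where "J = I - {j}"
  have e: "e * e = e" "adj e = e" "norm e \<le> 1"
    using proj[OF \<open>j \<in> I\<close>] norm_projection_le_1[of e] by (auto simp: e_def)
  have IJ: "I = insert j J" "j \<notin> J" "finite J"
    using assms by (auto simp: J_def)
  have "e * (sum p I * e) = e"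
    using below[OF \<open>j \<in> I\<close>] e by (simp add: e_def)
  moreover have "e * (sum p I * e) = e * (e * e) + sum y J"
    by (simp add: IJ e_def y_def sum_distrib_left sum_distrib_right algebra_simps)
  ultimately have sum0: "sum y J = 0"
    using e by simp
  have ye: "adj (y k) = y k" "e * y k = y k" "y k * e = y k" "norm (e - y k) \<le> 1"
    if k: "k \<in> J" for k
  proof -
    have pk: "p k * p k = p k" "adj (p k) = p k"
      using k proj by (auto simp: J_def)
    show "adj (y k) = y k" "e * y k = y k" "y k * e = y k"
      using e pk by (simp_all add: y_def mult.assoc) (metis e(1) mult.assoc)
    define d where "d = e - p k * e"
    have "p k * (p k * e) = p k * e"
      by (metis pk(1) mult.assoc)
    then have "adj d * d = e - y k"
      using pk e by (simp add: d_def algebra_simps y_def)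
    then have "norm (e - y k) = (norm d)\<^sup>2"
      using cstar_identity[of d] by simp
    moreover have "norm d \<le> 1"
      using norm_projection_complement_le[OF pk, of e] e(3) by (simp add: d_def)
    ultimately show "norm (e - y k) \<le> 1"
      by (simp add: power_le_one)
  qed
  have i: "i \<in> J" using assms by (auto simp: J_def)
  define N where "N = real (card J)"
  have "card J > 0"
    using i IJ(3) card_gt_0_iff by blast
  then have N: "N \<ge> 1" by (simp add: N_def)
  have "(inverse N) *\<^sub>R y i = 0"
  proof (rule eq_0_if_positive_and_negative[OF e])
    show "adj (inverse N *\<^sub>R y i) = inverse N *\<^sub>R y i" "e * inverse N *\<^sub>R y i = inverse N *\<^sub>R y i"
      "inverse N *\<^sub>R y i * e = inverse N *\<^sub>R y i"
      using ye[OF i] by simp_all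
    have card': "real (card (J - {i})) = N - 1"
      using i \<open>card J > 0\<close> by (simp add: N_def card_Diff_singleton of_nat_diff Suc_leI)
    have s: "sum y (J - {i}) = - y i"
      using sum0 i IJ(3) by (simp add: sum_diff1)
    \<comment> \<open>As minus \<open>y i\<close> is the sum of the other \<open>y k\<close>, this
      is a sum of \<open>N - 1\<close> contractions \<open>e - y k\<close>. Adding one more
      \<open>e\<close> and dividing by \<open>N\<close> gives the bound for
      \<open>e + inverse N *\<^sub>R y i\<close>.\<close>
    have "(N - 1) *\<^sub>R e + y i = (\<Sum>k\<in>J - {i}. e - y k)"
      unfolding sum_subtractf s using card' by (simp add: sum_constant_scaleR)
    then have "norm ((N - 1) *\<^sub>R e + y i) \<le> (\<Sum>k\<in>J - {i}. norm (e - y k))"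
      by (simp add: norm_sum)
    also have "\<dots> \<le> (\<Sum>k\<in>J - {i}. 1)"
      by (intro sum_mono) (use ye in auto)
    finally have "norm ((N - 1) *\<^sub>R e + y i) \<le> N - 1"
      using card' by simp
    then have "norm (e + ((N - 1) *\<^sub>R e + y i)) \<le> 1 + (N - 1)"
      using e(3) norm_triangle_ineq[of e "(N - 1) *\<^sub>R e + y i"] by linarith
    moreover have "e + ((N - 1) *\<^sub>R e + y i) = N *\<^sub>R e + y i"
      by (simp add: algebra_simps)
    ultimately have 1: "norm (N *\<^sub>R e + y i) \<le> N"
      by simp
    have "norm ((N - 1) *\<^sub>R e) \<le> N - 1"
      using N e(3) by (simp add: mult_left_le)
    then have "norm ((N - 1) *\<^sub>R e + (e - y i)) \<le> (N - 1) + 1"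
      using norm_triangle_ineq[of "(N - 1) *\<^sub>R e" "e - y i"] ye(4)[OF i] by linarith
    moreover have "(N - 1) *\<^sub>R e + (e - y i) = N *\<^sub>R e - y i"
      by (simp add: algebra_simps)
    ultimately have 2: "norm (N *\<^sub>R e - y i) \<le> N"
      by simp
    have scale: "e + inverse N *\<^sub>R y i = inverse N *\<^sub>R (N *\<^sub>R e + y i)"
      "e - inverse N *\<^sub>R y i = inverse N *\<^sub>R (N *\<^sub>R e - y i)"
      using N by (simp_all add: algebra_simps)
    show "norm (e + inverse N *\<^sub>R y i) \<le> 1" "norm (e - inverse N *\<^sub>R y i) \<le> 1"
      unfolding scale norm_scaleR using 1 2 N by (simp_all add: divide_simps)
  qed
  then have "y i = 0" using N by simp
  moreover have "adj (p i * p j) * (p i * p j) = y i"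
    using proj[OF \<open>i \<in> I\<close>] e(2) by (simp add: y_def e_def) (metis mult.assoc)
  ultimately show ?thesis
    using cstar_identity[of "p i * p j"] by simp
qed

text \<open>Squares of self-adjoint elements are self-adjoint again, so the C*-identity can be
  iterated without loss. For the exponents 2^m no spectral radius is needed.\<close>

lemma norm_selfadjoint_iterated_square:
  fixes x :: "'a::cstar_algebra"
  assumes "adj x = x"
  shows "adj (((\<lambda>y. y * y) ^^ m) x) = ((\<lambda>y. y * y) ^^ m) x"
    and "norm (((\<lambda>y. y * y) ^^ m) x) = norm x ^ (2 ^ m)"
proof -
  have "adj (((\<lambda>y. y * y) ^^ m) x) = ((\<lambda>y. y * y) ^^ m) x \<and>
      norm (((\<lambda>y. y * y) ^^ m) x) = norm x ^ (2 ^ m)"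
    by (induction m) (simp_all add: assms norm_selfadjoint_square mult.commute flip: power_mult)
  then show "adj (((\<lambda>y. y * y) ^^ m) x) = ((\<lambda>y. y * y) ^^ m) x"
    and "norm (((\<lambda>y. y * y) ^^ m) x) = norm x ^ (2 ^ m)"
    by auto
qed

lemma star_hom_iterated_square:
  assumes "star_hom type_cstar type_cstar \<phi>"
  shows "\<phi> (((\<lambda>y. y * y) ^^ m) x) = ((\<lambda>y. y * y) ^^ m) (\<phi> x)"
  by (induction m) (simp_all add: star_homD[OF assms])

text \<open>If r < R, then (r/R)^n decays faster than any polynomial in n grows, and the exponents
  2^m tend to infinity.\<close>

lemma le_if_powers_le_polynomial:
  fixes R r :: real
  assumes "R \<ge> 0" and "r \<ge> 0" and le: "\<And>m::nat. R ^ (2 ^ m) \<le> C * (2 ^ m + 1) ^ d * r ^ (2 ^ m)"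
  shows "R \<le> r"
proof (rule ccontr)
  assume "\<not> R \<le> r"
  then have Rr: "r < R" by simp
  show False
  proof (cases "r = 0")
    case True
    with le[of 0] Rr show False by simp
  next
    case False
    define q where "q = r / R"
    have q: "0 < q" "q < 1"
      using False Rr assms by (auto simp: q_def)
    have "((\<lambda>n. C * (real n + 1) ^ d * q ^ n) \<longlongrightarrow> 0) sequentially"
      using q by real_asymp
    moreover have "filterlim (\<lambda>m::nat. 2 ^ m :: nat) sequentially sequentially"
      by real_asymp
    ultimately have "((\<lambda>m. C * (real (2 ^ m) + 1) ^ d * q ^ (2 ^ m)) \<longlongrightarrow> 0) sequentially"
      by (rule filterlim_compose)
    then have "eventually (\<lambda>m. C * (real (2 ^ m) + 1) ^ d * q ^ (2 ^ m) < 1) sequentially"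
      by (rule order_tendstoD) simp
    then obtain m where m: "C * (2 ^ m + 1) ^ d * q ^ (2 ^ m) < 1"
      by (auto simp: eventually_sequentially)
    then have "C * (2 ^ m + 1) ^ d * r ^ (2 ^ m) < R ^ (2 ^ m)"
      using Rr assms by (simp add: q_def power_divide divide_simps split: if_splits)
    with le[of m] show False by simp
  qed
qed

text \<open>A lower bound on \<phi> that is lossy by a polynomial factor improves to an isometry. It
  serves twice: with \<open>d = 0\<close> and a fixed constant inside a matrix algebra, and with
  \<open>d\<close> the number of degrees occurring in \<open>adj x * x\<close>.\<close>

lemma star_hom_norm_eq_if_polynomial_growth:
  fixes \<phi> :: "'a::cstar_algebra \<Rightarrow> 'b::cstar_algebra"
  assumes "star_hom type_cstar type_cstar \<phi>"
    and "\<And>m. norm (((\<lambda>y. y * y) ^^ m) (adj x * x)) \<le>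
      C * (2 ^ m + 1) ^ d * norm (\<phi> (((\<lambda>y. y * y) ^^ m) (adj x * x)))"
  shows "norm (\<phi> x) = norm x"
proof -
  note hom = star_homD[OF assms(1)]
  have "norm (adj x * x) \<le> norm (\<phi> (adj x * x))"
  proof (rule le_if_powers_le_polynomial)
    show "norm (adj x * x) ^ 2 ^ m \<le> C * (2 ^ m + 1) ^ d * norm (\<phi> (adj x * x)) ^ 2 ^ m" for m
      using assms(2)[of m]
      by (simp add: star_hom_iterated_square[OF assms(1)] norm_selfadjoint_iterated_square hom)
  qed auto
  then have "(norm x)\<^sup>2 \<le> (norm (\<phi> x))\<^sup>2"
    by (simp add: cstar_identity hom)
  then show ?thesis
    using star_hom_norm_le[OF assms(1), of x] power2_le_imp_le by fastforce
qed

lemma star_subalgebraD: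
  assumes "star_subalgebra (S :: 'a::cstar_algebra set)"
  shows "0 \<in> S" "x \<in> S \<Longrightarrow> y \<in> S \<Longrightarrow> x + y \<in> S" "x \<in> S \<Longrightarrow> y \<in> S \<Longrightarrow> x * y \<in> S"
    "x \<in> S \<Longrightarrow> z *\<^sub>C x \<in> S" "x \<in> S \<Longrightarrow> adj x \<in> S"
  using assms by (auto simp: star_subalgebra_def)

lemma star_subalgebra_minus:
  assumes "star_subalgebra (S :: 'a::cstar_algebra set)"
  shows "x \<in> S \<Longrightarrow> - x \<in> S" "x \<in> S \<Longrightarrow> y \<in> S \<Longrightarrow> x - y \<in> S"
proof -
  show minus: "- x \<in> S" if "x \<in> S" for x
    using star_subalgebraD(4)[OF assms that, of "-1"] by simp
  show "x \<in> S \<Longrightarrow> y \<in> S \<Longrightarrow> x - y \<in> S"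
    using star_subalgebraD(2)[OF assms _ minus, of x y] by simp
qed

lemma star_subalgebra_closure:
  assumes "star_subalgebra (S :: 'a::cstar_algebra set)"
  shows "star_subalgebra (closure S)"
proof -
  note S = star_subalgebraD[OF assms]
  have "x + y \<in> closure S \<and> x * y \<in> closure S" if xy: "x \<in> closure S" "y \<in> closure S" for x y
  proof -
    obtain f g where fg: "\<forall>n. f n \<in> S" "f \<longlonglongrightarrow> x" "\<forall>n. g n \<in> S" "g \<longlonglongrightarrow> y"
      using xy unfolding closure_sequential by blast
    then show ?thesis
      unfolding closure_sequential
      using S tendsto_add[OF fg(2,4)] tendsto_mult[OF fg(2,4)]
      by (intro conjI exI[of _ "\<lambda>n. f n + g n"] exI[of _ "\<lambda>n. f n * g n"]) auto
  qed
  moreover have "z *\<^sub>C x \<in> closure S \<and> adj x \<in> closure S" if x: "x \<in> closure S" for x z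
  proof -
    obtain f where f: "\<forall>n. f n \<in> S" "f \<longlonglongrightarrow> x"
      using x unfolding closure_sequential by blast
    then show ?thesis
      unfolding closure_sequential
      using S bounded_linear.tendsto[OF bounded_linear_scaleC f(2), of z]
        bounded_linear.tendsto[OF bounded_linear_adj f(2)]
      by (intro conjI exI[of _ "\<lambda>n. z *\<^sub>C f n"] exI[of _ "\<lambda>n. adj (f n)"]) auto
  qed
  moreover have "0 \<in> closure S"
    using S(1) closure_subset by blast
  ultimately show ?thesis
    by (simp add: star_subalgebra_def)
qed

section \<open>Complex spans\<close>

inductive_set cspan :: "'a::cstar_algebra set \<Rightarrow> 'a set" for X where
  zero: "0 \<in> cspan X"
| step: "x \<in> X \<Longrightarrow> y \<in> cspan X \<Longrightarrow> z *\<^sub>C x + y \<in> cspan X"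

lemma cspan_base: "x \<in> X \<Longrightarrow> x \<in> cspan X"
  using cspan.step[OF _ cspan.zero, of x X 1] by simp

lemma cspan_add: "x \<in> cspan X \<Longrightarrow> y \<in> cspan X \<Longrightarrow> x + y \<in> cspan X"
  by (induction rule: cspan.induct) (auto simp: add.assoc intro: cspan.intros)

lemma cspan_scale: "x \<in> cspan X \<Longrightarrow> z *\<^sub>C x \<in> cspan X"
  by (induction rule: cspan.induct) (auto simp: scaleC_add_right scaleC_scaleC intro: cspan.intros)

lemma cspan_sum: "(\<And>i. i \<in> I \<Longrightarrow> f i \<in> cspan X) \<Longrightarrow> sum f I \<in> cspan X"
  by (induction I rule: infinite_finite_induct) (auto intro: cspan.zero cspan_add)

lemma cspan_bind:
  assumes "x \<in> cspan X" and "\<And>x. x \<in> X \<Longrightarrow> f x \<in> cspan Y"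
    and "\<And>x y. f (x + y) = f x + f y" and "\<And>z x. f (z *\<^sub>C x) = z *\<^sub>C f x"
  shows "f x \<in> cspan Y"
proof -
  have zero: "f 0 = 0"
    using assms(4)[of 0 0] by simp
  from assms(1) show ?thesis
  proof (induction rule: cspan.induct)
    case (step x y z)
    show ?case
      unfolding assms(3,4) by (rule cspan_add[OF cspan_scale[OF assms(2)[OF step.hyps(1)]] step.IH])
  qed (simp add: cspan.zero zero)
qed

lemma cspan_mono: "X \<subseteq> Y \<Longrightarrow> x \<in> cspan X \<Longrightarrow> x \<in> cspan Y"
  using cspan_bind[of x X "\<lambda>x. x" Y] by (auto intro: cspan_base)

lemma cspan_mult:
  assumes "x \<in> cspan X" and "y \<in> cspan Y" and "\<And>x y. x \<in> X \<Longrightarrow> y \<in> Y \<Longrightarrow> x * y \<in> cspan Z"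
  shows "x * y \<in> cspan Z"
proof -
  have "x * b \<in> cspan Z" if "b \<in> Y" for b
    using assms(1,3) that
    by (rule_tac cspan_bind[of x X "\<lambda>x. x * b"]) (auto simp: algebra_simps mult_scaleC_left)
  with assms(2) show ?thesis
    by (rule_tac cspan_bind[of y Y "\<lambda>y. x * y"]) (auto simp: algebra_simps mult_scaleC_right)
qed

lemma cspan_adj:
  assumes "x \<in> cspan X" and "\<And>x. x \<in> X \<Longrightarrow> adj x \<in> cspan Y"
  shows "adj x \<in> cspan Y"
  using assms by (induction rule: cspan.induct) (auto intro: cspan.zero cspan_add cspan_scale)

lemma cspan_finite:
  assumes "x \<in> cspan X"
  obtains F where "finite F" and "F \<subseteq> X" and "x \<in> cspan F"
proof -
  from assms have "\<exists>F. finite F \<and> F \<subseteq> X \<and> x \<in> cspan F"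
  proof (induction rule: cspan.induct)
    case zero
    then show ?case by (auto intro!: exI[of _ "{}"] cspan.zero)
  next
    case (step x y z)
    then obtain F where F: "finite F" "F \<subseteq> X" "y \<in> cspan F" by blast
    have "z *\<^sub>C x + y \<in> cspan (insert x F)"
      using cspan_mono[of F "insert x F"] F by (intro cspan.step) auto
    with F step.hyps show ?case
      by (intro exI[of _ "insert x F"]) auto
  qed
  with that show thesis by blast
qed

lemma cspan_star_hom_image:
  assumes "star_hom type_cstar type_cstar \<phi>" and "x \<in> cspan X" and "\<And>x. x \<in> X \<Longrightarrow> \<phi> x \<in> cspan Y"
  shows "\<phi> x \<in> cspan Y"
  using assms(2,3)
  by (induction rule: cspan.induct)
    (auto simp: star_homD[OF assms(1)] intro: cspan.zero cspan_add cspan_scale)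

section \<open>Cuntz--Krieger families\<close>

lemma finsum_type_cstar:
  "finite I \<Longrightarrow> finsum (type_cstar :: 'a::cstar_algebra cstar) f I = sum f I"
proof -
  interpret cstar_structure "type_cstar :: 'a cstar"
    by (rule cstar_structure_type_cstar)
  show "finite I \<Longrightarrow> finsum (type_cstar :: 'a cstar) f I = sum f I"
    by (induction I rule: finite_induct) (simp_all add: finsum_insert Pi_def)
qed

section \<open>Degrees, paths and the Cuntz-Krieger relations\<close>

lemma zero_in_NF: "0 \<in> NF k"
  by (simp add: NF_def)

lemma add_in_NF: "p \<in> NF k \<Longrightarrow> q \<in> NF k \<Longrightarrow> p + q \<in> NF k"
  by (simp add: NF_def)

lemma to_ZF_in: "p \<in> NF k \<Longrightarrow> to_ZF p \<in> ZF k"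
  by (simp add: NF_def ZF_def to_ZF_def)

lemma to_ZF_add: "to_ZF (p + q) = to_ZF p + to_ZF q"
  by (simp add: to_ZF_def prod_eq_iff fun_eq_iff)

lemma to_ZF_eq_iff: "to_ZF p = to_ZF q \<longleftrightarrow> p = q"
  by (auto simp: to_ZF_def prod_eq_iff fun_eq_iff)

lemma ZF_add: "g \<in> ZF k \<Longrightarrow> h \<in> ZF k \<Longrightarrow> g + h \<in> ZF k"
  by (simp add: ZF_def)

lemma ZF_diff: "g \<in> ZF k \<Longrightarrow> h \<in> ZF k \<Longrightarrow> g - h \<in> ZF k"
  by (simp add: ZF_def)

lemma ZF_zero: "0 \<in> ZF k"
  by (simp add: ZF_def)

context pgraph
begin

lemma rng_vertex: "\<alpha> \<in> arr \<Lambda> \<Longrightarrow> rng \<Lambda> \<alpha> \<in> vertices \<Lambda>"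
  by (simp add: vertices_eq_identities rng_in rng_rng)

lemma src_vertex: "\<alpha> \<in> arr \<Lambda> \<Longrightarrow> src \<Lambda> \<alpha> \<in> vertices \<Lambda>"
  by (simp add: vertices_eq_identities src_in rng_src)

lemma vertexD: "v \<in> vertices \<Lambda> \<Longrightarrow> v \<in> arr \<Lambda> \<and> rng \<Lambda> v = v \<and> src \<Lambda> v = v \<and> deg \<Lambda> v = 0"
  using src_rng[of v] by (simp add: vertices_eq_identities deg_identity)

lemma composable_rng: "\<alpha> \<in> arr \<Lambda> \<Longrightarrow> composable \<Lambda> (rng \<Lambda> \<alpha>) \<alpha>"
  by (simp add: composable_def rng_in src_rng)

lemma composable_src: "\<alpha> \<in> arr \<Lambda> \<Longrightarrow> composable \<Lambda> \<alpha> (src \<Lambda> \<alpha>)"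
  by (simp add: composable_def src_in rng_src)

lemma cmp_eqD:
  assumes "composable \<Lambda> \<mu> \<nu>" "composable \<Lambda> \<mu>' \<nu>'" "deg \<Lambda> \<mu> = deg \<Lambda> \<mu>'" "deg \<Lambda> \<nu> = deg \<Lambda> \<nu>'"
    and "cmp \<Lambda> \<mu> \<nu> = cmp \<Lambda> \<mu>' \<nu>'"
  shows "\<mu> = \<mu>' \<and> \<nu> = \<nu>'"
proof -
  have "\<exists>!(\<mu>1, \<nu>1). composable \<Lambda> \<mu>1 \<nu>1 \<and> deg \<Lambda> \<mu>1 = deg \<Lambda> \<mu> \<and> deg \<Lambda> \<nu>1 = deg \<Lambda> \<nu> \<and>
      cmp \<Lambda> \<mu> \<nu> = cmp \<Lambda> \<mu>1 \<nu>1"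
    using assms(1) by (intro factorisation) (auto simp: cmp_in deg_in deg_cmp composable_def)
  then obtain z where "\<And>\<mu>1 \<nu>1. composable \<Lambda> \<mu>1 \<nu>1 \<Longrightarrow> deg \<Lambda> \<mu>1 = deg \<Lambda> \<mu> \<Longrightarrow>
      deg \<Lambda> \<nu>1 = deg \<Lambda> \<nu> \<Longrightarrow> cmp \<Lambda> \<mu> \<nu> = cmp \<Lambda> \<mu>1 \<nu>1 \<Longrightarrow> (\<mu>1, \<nu>1) = z"
    by (auto elim!: ex1E)
  from this[of \<mu> \<nu>] this[of \<mu>' \<nu>'] assms show ?thesis
    by auto
qed

end

locale ck_rep = pgraph k \<Lambda>
  for k :: nat
    and \<Lambda> :: "('l, (nat \<Rightarrow> nat) \<times> 'f::{ab_group_add, countable}) graded_category" +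
  fixes c :: "'l \<Rightarrow> 'l \<Rightarrow> complex"
    and t :: "'l \<Rightarrow> 'b::cstar_algebra"
  assumes row_finite: "row_finite k \<Lambda>"
    and cocycle: "cocycle \<Lambda> c"
    and family: "CK_family k \<Lambda> c type_cstar t"
begin

lemma finite_paths_from: "v \<in> vertices \<Lambda> \<Longrightarrow> p \<in> NF k \<Longrightarrow> finite (paths_from \<Lambda> v p)"
  using row_finite by (simp add: row_finite_def)

lemma t_vertex: "v \<in> vertices \<Lambda> \<Longrightarrow> t v * t v = t v" "v \<in> vertices \<Lambda> \<Longrightarrow> adj (t v) = t v"
  using CK_family.CK1_projection[OF family] by auto

lemma t_vertex_orthogonal: "v \<in> vertices \<Lambda> \<Longrightarrow> w \<in> vertices \<Lambda> \<Longrightarrow> v \<noteq> w \<Longrightarrow> t v * t w = 0"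
  using CK_family.CK1_orthogonal[OF family] by auto

lemma t_cmp: "composable \<Lambda> \<mu> \<nu> \<Longrightarrow> t \<mu> * t \<nu> = c \<mu> \<nu> *\<^sub>C t (cmp \<Lambda> \<mu> \<nu>)"
  using CK_family.CK2[OF family] by auto

lemma t_isometry: "\<alpha> \<in> arr \<Lambda> \<Longrightarrow> adj (t \<alpha>) * t \<alpha> = t (src \<Lambda> \<alpha>)"
  using CK_family.CK3[OF family] by auto

lemma t_vertex_sum:
  "v \<in> vertices \<Lambda> \<Longrightarrow> p \<in> NF k \<Longrightarrow> t v = (\<Sum>\<alpha>\<in>paths_from \<Lambda> v p. t \<alpha> * adj (t \<alpha>))"
  using CK_family.CK4[OF family] by (simp add: finsum_type_cstar finite_paths_from)

lemma t_rng: "\<alpha> \<in> arr \<Lambda> \<Longrightarrow> t (rng \<Lambda> \<alpha>) * t \<alpha> = t \<alpha>"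
  using t_cmp[OF composable_rng] cocycle by (simp add: cmp_rng cocycle_def)

lemma t_src: "\<alpha> \<in> arr \<Lambda> \<Longrightarrow> t \<alpha> * t (src \<Lambda> \<alpha>) = t \<alpha>"
  using t_cmp[OF composable_src] cocycle by (simp add: cmp_src cocycle_def)

lemma t_rng_left: "\<alpha> \<in> arr \<Lambda> \<Longrightarrow> t (rng \<Lambda> \<alpha>) * (t \<alpha> * x) = t \<alpha> * x"
  using t_rng by (metis mult.assoc)

lemma t_isometry_left: "\<alpha> \<in> arr \<Lambda> \<Longrightarrow> adj (t \<alpha>) * (t \<alpha> * x) = t (src \<Lambda> \<alpha>) * x"
  using t_isometry by (metis mult.assoc)

lemma adj_t_rng: "\<alpha> \<in> arr \<Lambda> \<Longrightarrow> adj (t \<alpha>) * t (rng \<Lambda> \<alpha>) = adj (t \<alpha>)"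
  using t_rng[of \<alpha>] t_vertex(2)[OF rng_vertex] by (metis adj_mult adj_adj)

lemma src_adj_t: "\<alpha> \<in> arr \<Lambda> \<Longrightarrow> t (src \<Lambda> \<alpha>) * adj (t \<alpha>) = adj (t \<alpha>)"
  using t_src[of \<alpha>] t_vertex(2)[OF src_vertex] by (metis adj_mult adj_adj)

lemma t_noncomposable:
  assumes "\<alpha> \<in> arr \<Lambda>" "\<beta> \<in> arr \<Lambda>" "\<not> composable \<Lambda> \<alpha> \<beta>"
  shows "t \<alpha> * t \<beta> = 0"
proof -
  have "t \<alpha> * t \<beta> = t \<alpha> * (t (src \<Lambda> \<alpha>) * t (rng \<Lambda> \<beta>)) * t \<beta>"
    using assms by (metis mult.assoc t_src t_rng)
  also have "t (src \<Lambda> \<alpha>) * t (rng \<Lambda> \<beta>) = 0"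
    using assms by (intro t_vertex_orthogonal src_vertex rng_vertex) (auto simp: composable_def)
  finally show ?thesis by simp
qed

lemma t_adj_t_src_neq:
  assumes "\<alpha> \<in> arr \<Lambda>" "\<beta> \<in> arr \<Lambda>" "src \<Lambda> \<alpha> \<noteq> src \<Lambda> \<beta>"
  shows "t \<alpha> * adj (t \<beta>) = 0"
proof -
  have "t \<alpha> * adj (t \<beta>) = t \<alpha> * (t (src \<Lambda> \<alpha>) * t (src \<Lambda> \<beta>)) * adj (t \<beta>)"
    using assms by (metis mult.assoc t_src src_adj_t)
  also have "t (src \<Lambda> \<alpha>) * t (src \<Lambda> \<beta>) = 0"
    using assms by (intro t_vertex_orthogonal src_vertex) auto
  finally show ?thesis by simp
qed

lemma norm_t_le_1: "\<alpha> \<in> arr \<Lambda> \<Longrightarrow> norm (t \<alpha>) \<le> 1"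
  using cstar_identity[of "t \<alpha>"] t_isometry[of \<alpha>]
    norm_projection_le_1[OF t_vertex[OF src_vertex], of \<alpha>]
  by (simp add: power_le_one_iff)

text \<open>For different ranges this is orthogonality of the vertex projections. For a common range
  \<open>v\<close>, (CK4) writes \<open>t v\<close> as the sum of the range projections of all paths
  of that degree, and \<open>t v\<close> fixes each of them; so they are orthogonal. Multiplying by
  \<open>adj (t \<alpha>)\<close> and \<open>t \<kappa>\<close> recovers the product.\<close>

lemma adj_t_t_orthogonal:
  assumes "\<alpha> \<in> arr \<Lambda>" "\<kappa> \<in> arr \<Lambda>" "deg \<Lambda> \<alpha> = deg \<Lambda> \<kappa>" "\<alpha> \<noteq> \<kappa>"
  shows "adj (t \<alpha>) * t \<kappa> = 0"
proof (cases "rng \<Lambda> \<alpha> = rng \<Lambda> \<kappa>")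
  case False
  have "adj (t \<alpha>) * t \<kappa> = adj (t \<alpha>) * (t (rng \<Lambda> \<alpha>) * t (rng \<Lambda> \<kappa>)) * t \<kappa>"
    using assms by (metis mult.assoc adj_t_rng t_rng)
  also have "t (rng \<Lambda> \<alpha>) * t (rng \<Lambda> \<kappa>) = 0"
    using assms False by (intro t_vertex_orthogonal rng_vertex) auto
  finally show ?thesis by simp
next
  case True
  define v where "v = rng \<Lambda> \<alpha>"
  define p where "p \<mu> = t \<mu> * adj (t \<mu>)" for \<mu>
  define I where "I = paths_from \<Lambda> v (deg \<Lambda> \<alpha>)"
  have v: "v \<in> vertices \<Lambda>"
    using assms by (simp add: v_def rng_vertex)
  have tv: "t v = sum p I"
    using v assms by (simp add: I_def p_def[abs_def] t_vertex_sum[OF v deg_in])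
  have "p \<alpha> * p \<kappa> = 0"
  proof (rule sum_projections_orthogonal[where p = p and I = I and i = \<alpha> and j = \<kappa>])
    show "finite I"
      using v assms by (simp add: I_def finite_paths_from deg_in)
    show "p \<mu> * p \<mu> = p \<mu> \<and> adj (p \<mu>) = p \<mu>" if "\<mu> \<in> I" for \<mu>
      using that
      by (simp add: p_def I_def paths_from_def mult.assoc t_isometry_left src_adj_t)
    show "sum p I * p \<mu> = p \<mu>" if "\<mu> \<in> I" for \<mu>
      using that unfolding tv[symmetric] p_def by (auto simp: I_def paths_from_def t_rng_left)
  qed (use assms True in \<open>auto simp: I_def v_def paths_from_def\<close>)
  moreover have "adj (t \<alpha>) * t \<kappa> = adj (t \<alpha>) * (p \<alpha> * p \<kappa>) * t \<kappa>"
    using assms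
    by (simp add: p_def mult.assoc t_isometry t_isometry_left t_src)
      (metis mult.assoc src_adj_t)
  ultimately show ?thesis by simp
qed

text \<open>Spans the homogeneous elements of degree \<open>g\<close>. Pairs with different sources
  need not be excluded, since their product is 0.\<close>

definition graded :: "(nat \<Rightarrow> int) \<times> 'f \<Rightarrow> 'b set" where
  "graded g = {t \<alpha> * adj (t \<beta>) | \<alpha> \<beta>. \<alpha> \<in> arr \<Lambda> \<and> \<beta> \<in> arr \<Lambda> \<and>
     to_ZF (deg \<Lambda> \<alpha>) - to_ZF (deg \<Lambda> \<beta>) = g}"

text \<open>Both \<open>\<alpha>\<close> and \<open>\<kappa>\<close> are compared with the paths of degree \<open>d(\<alpha>) + d(\<kappa>)\<close>.\<close>

lemma adj_t_t_in_cspan: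
  assumes "\<alpha> \<in> arr \<Lambda>" "\<kappa> \<in> arr \<Lambda>"
  shows "adj (t \<alpha>) * t \<kappa> \<in> cspan {t \<mu> * adj (t \<nu>) | \<mu> \<nu>. \<mu> \<in> arr \<Lambda> \<and> \<nu> \<in> arr \<Lambda> \<and>
    deg \<Lambda> \<mu> = deg \<Lambda> \<kappa> \<and> deg \<Lambda> \<nu> = deg \<Lambda> \<alpha>}" (is "_ \<in> cspan ?X")
proof -
  \<comment> \<open>Cut \<mu> after degree d(\<gamma>): its initial segment either is \<gamma>, and
    only the remainder \<nu> is left, or is orthogonal to it. In the second case \<nu> occurs with
    coefficient 0.\<close>
  have one: "\<exists>\<nu> a. \<nu> \<in> arr \<Lambda> \<and> deg \<Lambda> \<nu> = q \<and> adj (t \<gamma>) * t \<mu> = a *\<^sub>C t \<nu>"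
    if \<mu>: "\<gamma> \<in> arr \<Lambda>" "\<mu> \<in> arr \<Lambda>" "deg \<Lambda> \<mu> = deg \<Lambda> \<gamma> + q" "q \<in> NF k" for \<gamma> \<mu> q
  proof -
    obtain \<gamma>' \<nu> where f: "composable \<Lambda> \<gamma>' \<nu>" "deg \<Lambda> \<gamma>' = deg \<Lambda> \<gamma>" "deg \<Lambda> \<nu> = q" "\<mu> = cmp \<Lambda> \<gamma>' \<nu>"
      using ex1_implies_ex[OF factorisation[OF \<mu>(2) deg_in[OF \<mu>(1)] \<mu>(4,3)]] by blast
    then have arr: "\<gamma>' \<in> arr \<Lambda>" "\<nu> \<in> arr \<Lambda>" "src \<Lambda> \<gamma>' = rng \<Lambda> \<nu>"
      by (auto simp: composable_def)
    have "c \<gamma>' \<nu> \<noteq> 0"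
      using cocycle f(1) unfolding cocycle_def by (metis mem_sphere_0 norm_zero zero_neq_one)
    then have "t \<mu> = inverse (c \<gamma>' \<nu>) *\<^sub>C (t \<gamma>' * t \<nu>)"
      using t_cmp[OF f(1)] f(4) by (simp add: scaleC_scaleC)
    moreover have "adj (t \<gamma>) * (t \<gamma>' * t \<nu>) = (if \<gamma> = \<gamma>' then 1 else 0) *\<^sub>C t \<nu>"
    proof (cases "\<gamma> = \<gamma>'")
      case True
      then show ?thesis
        using arr by (simp add: t_isometry_left t_rng)
    next
      case False
      then show ?thesis
        using adj_t_t_orthogonal[of \<gamma> \<gamma>'] that arr f by (simp flip: mult.assoc)
    qed
    ultimately have "adj (t \<gamma>) * t \<mu> = (inverse (c \<gamma>' \<nu>) * (if \<gamma> = \<gamma>' then 1 else 0)) *\<^sub>C t \<nu>"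
      by (simp add: mult_scaleC_right scaleC_scaleC)
    with arr f show ?thesis by blast
  qed
  define p where "p = deg \<Lambda> \<alpha> + deg \<Lambda> \<kappa>"
  define I where "I = paths_from \<Lambda> (rng \<Lambda> \<alpha>) p"
  have "adj (t \<alpha>) * t \<kappa> = adj (t \<alpha>) * t (rng \<Lambda> \<alpha>) * t \<kappa>"
    using assms by (simp add: adj_t_rng)
  also have "t (rng \<Lambda> \<alpha>) = (\<Sum>\<mu>\<in>I. t \<mu> * adj (t \<mu>))"
    unfolding I_def using assms by (intro t_vertex_sum rng_vertex) (auto simp: p_def add_in_NF deg_in)
  also have "adj (t \<alpha>) * \<dots> * t \<kappa> = (\<Sum>\<mu>\<in>I. (adj (t \<alpha>) * t \<mu>) * adj (adj (t \<kappa>) * t \<mu>))"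
    by (simp add: sum_distrib_left sum_distrib_right mult.assoc)
  also have "\<dots> \<in> cspan ?X"
  proof (rule cspan_sum)
    fix \<mu> assume \<mu>: "\<mu> \<in> I"
    obtain \<nu> a where 1: "\<nu> \<in> arr \<Lambda>" "deg \<Lambda> \<nu> = deg \<Lambda> \<kappa>" "adj (t \<alpha>) * t \<mu> = a *\<^sub>C t \<nu>"
      using one[of \<alpha> \<mu> "deg \<Lambda> \<kappa>"] assms \<mu> deg_in by (auto simp: I_def paths_from_def p_def)
    obtain \<nu>' a' where 2: "\<nu>' \<in> arr \<Lambda>" "deg \<Lambda> \<nu>' = deg \<Lambda> \<alpha>" "adj (t \<kappa>) * t \<mu> = a' *\<^sub>C t \<nu>'"
      using one[of \<kappa> \<mu> "deg \<Lambda> \<alpha>"] assms \<mu> deg_in by (auto simp: I_def paths_from_def p_def add.commute)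
    have "(adj (t \<alpha>) * t \<mu>) * adj (adj (t \<kappa>) * t \<mu>) = (a * cnj a') *\<^sub>C (t \<nu> * adj (t \<nu>'))"
      unfolding 1(3) 2(3) by (simp add: mult_scaleC_left mult_scaleC_right scaleC_scaleC mult.commute)
    also have "\<dots> \<in> cspan ?X"
      using 1 2 by (intro cspan_scale cspan_base) auto
    finally show "(adj (t \<alpha>) * t \<mu>) * adj (adj (t \<kappa>) * t \<mu>) \<in> cspan ?X" .
  qed
  finally show ?thesis .
qed

text \<open>A product of non-composable arrows is 0; it is written with \<open>a = 0\<close> and an
  arbitrary \<gamma>, so the degree is controlled only for a nonzero coefficient.\<close>

lemma t_mult_t_cases:
  assumes "\<alpha> \<in> arr \<Lambda>" "\<beta> \<in> arr \<Lambda>"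
  obtains \<gamma> a where "\<gamma> \<in> arr \<Lambda>" "t \<alpha> * t \<beta> = a *\<^sub>C t \<gamma>" "a = 0 \<or> deg \<Lambda> \<gamma> = deg \<Lambda> \<alpha> + deg \<Lambda> \<beta>"
proof (cases "composable \<Lambda> \<alpha> \<beta>")
  case True
  with that show thesis
    using t_cmp deg_cmp cmp_in by blast
next
  case False
  with that[of \<alpha> 0] assms show thesis
    by (simp add: t_noncomposable)
qed

text \<open>The inner product \<open>adj (t \<beta>) * t \<kappa>\<close> expands into terms of
  degrees d(\<kappa>) and d(\<beta>). The outer paths thus acquire degrees d(\<alpha>) + d(\<kappa>)
  and d(\<tau>) + d(\<beta>), whose difference is g + h.\<close>

lemma graded_mult:
  assumes "x \<in> cspan (graded g)" "y \<in> cspan (graded h)"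
  shows "x * y \<in> cspan (graded (g + h))"
proof (rule cspan_mult[OF assms])
  fix x y assume "x \<in> graded g" "y \<in> graded h"
  then obtain \<alpha> \<beta> \<kappa> \<tau> where x: "x = t \<alpha> * adj (t \<beta>)" "\<alpha> \<in> arr \<Lambda>" "\<beta> \<in> arr \<Lambda>"
      "to_ZF (deg \<Lambda> \<alpha>) - to_ZF (deg \<Lambda> \<beta>) = g"
    and y: "y = t \<kappa> * adj (t \<tau>)" "\<kappa> \<in> arr \<Lambda>" "\<tau> \<in> arr \<Lambda>"
      "to_ZF (deg \<Lambda> \<kappa>) - to_ZF (deg \<Lambda> \<tau>) = h"
    by (auto simp: graded_def)
  have "t \<alpha> * (adj (t \<beta>) * t \<kappa>) * adj (t \<tau>) \<in> cspan (graded (g + h))"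
  proof (rule cspan_bind[OF adj_t_t_in_cspan[OF x(3) y(2)], of "\<lambda>z. t \<alpha> * z * adj (t \<tau>)"])
    fix z assume "z \<in> {t \<mu> * adj (t \<nu>) | \<mu> \<nu>. \<mu> \<in> arr \<Lambda> \<and> \<nu> \<in> arr \<Lambda> \<and>
      deg \<Lambda> \<mu> = deg \<Lambda> \<kappa> \<and> deg \<Lambda> \<nu> = deg \<Lambda> \<beta>}"
    then obtain \<mu> \<nu> where z: "z = t \<mu> * adj (t \<nu>)" "\<mu> \<in> arr \<Lambda>" "\<nu> \<in> arr \<Lambda>"
      "deg \<Lambda> \<mu> = deg \<Lambda> \<kappa>" "deg \<Lambda> \<nu> = deg \<Lambda> \<beta>" by blast
    obtain \<gamma> a where 1: "\<gamma> \<in> arr \<Lambda>" "t \<alpha> * t \<mu> = a *\<^sub>C t \<gamma>" "a = 0 \<or> deg \<Lambda> \<gamma> = deg \<Lambda> \<alpha> + deg \<Lambda> \<mu>"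
      using t_mult_t_cases x z by metis
    obtain \<gamma>' a' where 2: "\<gamma>' \<in> arr \<Lambda>" "t \<tau> * t \<nu> = a' *\<^sub>C t \<gamma>'"
        "a' = 0 \<or> deg \<Lambda> \<gamma>' = deg \<Lambda> \<tau> + deg \<Lambda> \<nu>"
      using t_mult_t_cases y z by metis
    have "t \<alpha> * z * adj (t \<tau>) = (t \<alpha> * t \<mu>) * adj (t \<tau> * t \<nu>)"
      by (simp add: z mult.assoc)
    also have "\<dots> = (a * cnj a') *\<^sub>C (t \<gamma> * adj (t \<gamma>'))"
      unfolding 1(2) 2(2) by (simp add: mult_scaleC_left mult_scaleC_right scaleC_scaleC mult.commute)
    also have "\<dots> \<in> cspan (graded (g + h))"
    proof (cases "a = 0 \<or> a' = 0")
      case True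
      then show ?thesis by (auto intro: cspan.zero)
    next
      case False
      then have "to_ZF (deg \<Lambda> \<gamma>) - to_ZF (deg \<Lambda> \<gamma>') = g + h"
        using 1 2 z x y by (simp add: to_ZF_add flip: x(4) y(4))
      then show ?thesis
        using 1 2 by (intro cspan_scale cspan_base) (auto simp: graded_def)
    qed
    finally show "t \<alpha> * z * adj (t \<tau>) \<in> cspan (graded (g + h))" .
  qed (auto simp: algebra_simps mult_scaleC_left mult_scaleC_right)
  then show "x * y \<in> cspan (graded (g + h))"
    by (simp add: x y mult.assoc)
qed

lemma graded_adj:
  assumes "x \<in> cspan (graded g)"
  shows "adj x \<in> cspan (graded (- g))"
proof (rule cspan_adj[OF assms])
  fix x assume "x \<in> graded g"
  then have "adj x \<in> graded (- g)"
    by (fastforce simp: graded_def)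
  then show "adj x \<in> cspan (graded (- g))"
    by (rule cspan_base)
qed

lemma t_in_graded: "\<alpha> \<in> arr \<Lambda> \<Longrightarrow> t \<alpha> \<in> graded (to_ZF (deg \<Lambda> \<alpha>))"
proof -
  assume \<alpha>: "\<alpha> \<in> arr \<Lambda>"
  define v where "v = src \<Lambda> \<alpha>"
  have v: "v \<in> vertices \<Lambda>" using \<alpha> by (simp add: v_def src_vertex)
  have "to_ZF (deg \<Lambda> v) = 0"
    using vertexD[OF v] by (simp add: to_ZF_def prod_eq_iff fun_eq_iff)
  moreover have "t \<alpha> = t \<alpha> * adj (t v)"
    using \<alpha> t_vertex(2)[OF v] t_src by (simp add: v_def)
  ultimately show ?thesis
    using \<alpha> vertexD[OF v] unfolding graded_def by force
qed

section \<open>Degree 0: the increasing union of matrix algebras\<close>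

definition core :: "(nat \<Rightarrow> nat) \<times> 'f \<Rightarrow> 'b set" where
  "core p = {t \<alpha> * adj (t \<beta>) | \<alpha> \<beta>. \<alpha> \<in> arr \<Lambda> \<and> \<beta> \<in> arr \<Lambda> \<and> deg \<Lambda> \<alpha> = p \<and> deg \<Lambda> \<beta> = p}"

text \<open>Inserting (CK4) of degree \<open>q\<close> at the common source of \<alpha> and \<beta>
  prolongs both by the same paths. These are the inclusions of the increasing union.\<close>

lemma core_add:
  assumes "x \<in> cspan (core p)" "q \<in> NF k"
  shows "x \<in> cspan (core (p + q))"
proof (rule cspan_bind[OF assms(1), where f = "\<lambda>x. x"])
  fix x assume "x \<in> core p"
  then obtain \<alpha> \<beta> where x: "x = t \<alpha> * adj (t \<beta>)" "\<alpha> \<in> arr \<Lambda>" "\<beta> \<in> arr \<Lambda>" "deg \<Lambda> \<alpha> = p" "deg \<Lambda> \<beta> = p"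
    by (auto simp: core_def)
  show "x \<in> cspan (core (p + q))"
  proof (cases "src \<Lambda> \<alpha> = src \<Lambda> \<beta>")
    case False
    then show ?thesis
      using x t_adj_t_src_neq by (simp add: cspan.zero)
  next
    case True
    let ?I = "paths_from \<Lambda> (src \<Lambda> \<alpha>) q"
    have "x = t \<alpha> * t (src \<Lambda> \<alpha>) * adj (t \<beta>)"
      using x by (simp add: t_src)
    also have "t (src \<Lambda> \<alpha>) = (\<Sum>\<mu>\<in>?I. t \<mu> * adj (t \<mu>))"
      using x assms by (intro t_vertex_sum src_vertex) auto
    also have "t \<alpha> * \<dots> * adj (t \<beta>) = (\<Sum>\<mu>\<in>?I. (t \<alpha> * t \<mu>) * adj (t \<beta> * t \<mu>))"
      by (simp add: sum_distrib_left sum_distrib_right mult.assoc)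
    also have "\<dots> \<in> cspan (core (p + q))"
    proof (rule cspan_sum)
      fix \<mu> assume \<mu>: "\<mu> \<in> ?I"
      have 1: "composable \<Lambda> \<alpha> \<mu>" "composable \<Lambda> \<beta> \<mu>"
        using \<mu> x True by (auto simp: composable_def paths_from_def)
      have "(t \<alpha> * t \<mu>) * adj (t \<beta> * t \<mu>) =
          (c \<alpha> \<mu> * cnj (c \<beta> \<mu>)) *\<^sub>C (t (cmp \<Lambda> \<alpha> \<mu>) * adj (t (cmp \<Lambda> \<beta> \<mu>)))"
        unfolding t_cmp[OF 1(1)] t_cmp[OF 1(2)]
        by (simp add: mult_scaleC_left mult_scaleC_right scaleC_scaleC mult.commute)
      also have "\<dots> \<in> cspan (core (p + q))"
      proof -
        have "t (cmp \<Lambda> \<alpha> \<mu>) * adj (t (cmp \<Lambda> \<beta> \<mu>)) \<in> core (p + q)"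
          unfolding core_def using 1 x \<mu> cmp_in deg_cmp
          by (intro CollectI exI[of _ "cmp \<Lambda> \<alpha> \<mu>"] exI[of _ "cmp \<Lambda> \<beta> \<mu>"]) (auto simp: paths_from_def)
        then show ?thesis by (intro cspan_scale cspan_base)
      qed
      finally show "(t \<alpha> * t \<mu>) * adj (t \<beta> * t \<mu>) \<in> cspan (core (p + q))" .
    qed
    finally show ?thesis .
  qed
qed auto

text \<open>The union is directed: the levels \<open>p\<close> and \<open>q\<close> both lie in the
  level \<open>q + p\<close>, so finitely many generators fit into a single level.\<close>

lemma graded_0_core:
  assumes "x \<in> cspan (graded 0)"
  shows "\<exists>p\<in>NF k. x \<in> cspan (core p)"
  using assms
proof (induction rule: cspan.induct)
  case zero
  then show ?case using zero_in_NF cspan.zero by blast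
next
  case (step x y z)
  then obtain p where p: "p \<in> NF k" "y \<in> cspan (core p)" by blast
  from step obtain \<alpha> \<beta> where x: "x = t \<alpha> * adj (t \<beta>)" "\<alpha> \<in> arr \<Lambda>" "\<beta> \<in> arr \<Lambda>" "deg \<Lambda> \<alpha> = deg \<Lambda> \<beta>"
    by (auto simp: graded_def to_ZF_eq_iff)
  define q where "q = deg \<Lambda> \<alpha>"
  have q: "q \<in> NF k" using x by (simp add: q_def deg_in)
  have "x \<in> core q" using x by (auto simp: core_def q_def)
  then have "z *\<^sub>C x \<in> cspan (core (q + p))"
    using p by (intro core_add cspan_scale cspan_base) auto
  moreover have "y \<in> cspan (core (q + p))"
    using core_add[OF p(2) q] by (simp add: add.commute)
  ultimately show ?case
    using cspan_add add_in_NF[OF q p(1)] by blast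
qed

text \<open>For paths of one degree these are matrix units, in one block for each source. A finite
  \<open>L\<close> is chosen for each element because row-finiteness bounds the paths of a given
  degree only at a fixed range, and there may be infinitely many vertices.\<close>

definition matrices :: "'l set \<Rightarrow> 'b set" where
  "matrices L = {t \<alpha> * adj (t \<beta>) | \<alpha> \<beta>. \<alpha> \<in> L \<and> \<beta> \<in> L}"

lemma core_matrices:
  assumes "x \<in> cspan (core p)"
  obtains L where "finite L" "L \<subseteq> arr \<Lambda>" "\<And>\<alpha>. \<alpha> \<in> L \<Longrightarrow> deg \<Lambda> \<alpha> = p" "x \<in> cspan (matrices L)"
proof -
  obtain F where F: "finite F" "F \<subseteq> core p" "x \<in> cspan F"
    using cspan_finite[OF assms] .
  let ?Z = "{\<alpha> \<in> arr \<Lambda>. deg \<Lambda> \<alpha> = p}"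
  have "F \<subseteq> (\<lambda>(\<alpha>, \<beta>). t \<alpha> * adj (t \<beta>)) ` (?Z \<times> ?Z)"
    using F(2) by (force simp: core_def)
  then obtain Z where Z: "finite Z" "Z \<subseteq> ?Z \<times> ?Z" "F = (\<lambda>(\<alpha>, \<beta>). t \<alpha> * adj (t \<beta>)) ` Z"
    using finite_subset_image[OF F(1), of "\<lambda>(\<alpha>, \<beta>). t \<alpha> * adj (t \<beta>)" "?Z \<times> ?Z"] by blast
  have "F \<subseteq> matrices (fst ` Z \<union> snd ` Z)"
    unfolding Z matrices_def by force
  with F(3) have "x \<in> cspan (matrices (fst ` Z \<union> snd ` Z))"
    by (rule_tac cspan_mono)
  moreover have "finite (fst ` Z \<union> snd ` Z)" "fst ` Z \<union> snd ` Z \<subseteq> ?Z"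
    using Z by auto
  ultimately show thesis
    using that[of "fst ` Z \<union> snd ` Z"] by blast
qed

context
  fixes L p
  assumes L: "finite L" "L \<subseteq> arr \<Lambda>" "\<And>\<alpha>. \<alpha> \<in> L \<Longrightarrow> deg \<Lambda> \<alpha> = p"
begin

lemma adj_t_t_matrices:
  "\<alpha> \<in> L \<Longrightarrow> \<beta> \<in> L \<Longrightarrow> adj (t \<alpha>) * t \<beta> = (if \<alpha> = \<beta> then t (src \<Lambda> \<alpha>) else 0)"
  using L adj_t_t_orthogonal[of \<alpha> \<beta>] t_isometry by auto

lemma matrices_mult:
  assumes "x \<in> cspan (matrices L)" "y \<in> cspan (matrices L)"
  shows "x * y \<in> cspan (matrices L)"
proof (rule cspan_mult[OF assms])
  fix x y assume "x \<in> matrices L" "y \<in> matrices L"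
  then obtain \<alpha> \<beta> \<kappa> \<tau> where xy: "x = t \<alpha> * adj (t \<beta>)" "y = t \<kappa> * adj (t \<tau>)"
    and l: "\<alpha> \<in> L" "\<beta> \<in> L" "\<kappa> \<in> L" "\<tau> \<in> L"
    by (auto simp: matrices_def)
  have "x * y = t \<alpha> * (adj (t \<beta>) * t \<kappa>) * adj (t \<tau>)"
    by (simp add: xy mult.assoc)
  moreover have "t \<alpha> * t (src \<Lambda> \<beta>) = (if src \<Lambda> \<alpha> = src \<Lambda> \<beta> then t \<alpha> else 0)"
    using l L t_noncomposable[of \<alpha> "src \<Lambda> \<beta>"] t_src[of \<alpha>] src_in rng_src
    by (auto simp: composable_def subset_iff)
  ultimately have "x * y = (if \<beta> = \<kappa> \<and> src \<Lambda> \<alpha> = src \<Lambda> \<beta> then t \<alpha> * adj (t \<tau>) else 0)"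
    using l by (auto simp: adj_t_t_matrices split: if_splits)
  then show "x * y \<in> cspan (matrices L)"
    using l by (auto intro!: cspan_base cspan.zero simp: matrices_def)
qed

text \<open>The scalar is the matrix entry of \<open>x\<close> at (\<alpha>, \<beta>). It can be
  read off in every representation in which the projection at the source of \<alpha> is
  nonzero.\<close>

lemma matrices_corner:
  assumes "x \<in> cspan (matrices L)" "\<alpha> \<in> L" "\<beta> \<in> L"
  shows "\<exists>a. adj (t \<alpha>) * x * t \<beta> = a *\<^sub>C t (src \<Lambda> \<alpha>)"
  using assms(1)
proof (induction rule: cspan.induct)
  case zero
  then show ?case by (intro exI[of _ 0]) simp
next
  case (step x y z)
  then obtain a where a: "adj (t \<alpha>) * y * t \<beta> = a *\<^sub>C t (src \<Lambda> \<alpha>)" by blast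
  from step obtain \<kappa> \<tau> where x: "x = t \<kappa> * adj (t \<tau>)" "\<kappa> \<in> L" "\<tau> \<in> L"
    by (auto simp: matrices_def)
  have "adj (t \<alpha>) * x * t \<beta> = (adj (t \<alpha>) * t \<kappa>) * (adj (t \<tau>) * t \<beta>)"
    by (simp add: x mult.assoc)
  also have "\<exists>b. \<dots> = b *\<^sub>C t (src \<Lambda> \<alpha>)"
  proof (cases "\<alpha> = \<kappa> \<and> \<tau> = \<beta> \<and> src \<Lambda> \<alpha> = src \<Lambda> \<beta>")
    case True
    then show ?thesis
      using x assms L by (intro exI[of _ 1]) (auto simp: t_isometry t_vertex src_vertex subset_iff)
  next
    case False
    moreover have "t (src \<Lambda> \<alpha>) * t (src \<Lambda> \<beta>) = 0" if "src \<Lambda> \<alpha> \<noteq> src \<Lambda> \<beta>"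
      using that assms L by (intro t_vertex_orthogonal src_vertex) auto
    ultimately show ?thesis
      using x assms L by (intro exI[of _ 0]) (auto simp: adj_t_t_matrices)
  qed
  finally obtain b where "adj (t \<alpha>) * x * t \<beta> = b *\<^sub>C t (src \<Lambda> \<alpha>)" by blast
  with a have "adj (t \<alpha>) * (z *\<^sub>C x + y) * t \<beta> = (z * b + a) *\<^sub>C t (src \<Lambda> \<alpha>)"
    by (simp add: distrib_left distrib_right mult_scaleC_left mult_scaleC_right scaleC_add_left scaleC_scaleC)
  then show ?case by blast
qed

text \<open>The sum of the range projections over \<open>L\<close> is a unit for this matrix
  algebra; multiplying by it on both sides recovers \<open>x\<close> from its entries.\<close>

lemma matrices_expansion:
  assumes "x \<in> cspan (matrices L)"
  shows "x = (\<Sum>\<alpha>\<in>L. \<Sum>\<beta>\<in>L. t \<alpha> * (adj (t \<alpha>) * x * t \<beta>) * adj (t \<beta>))"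
  using assms
proof (induction rule: cspan.induct)
  case zero
  then show ?case by simp
next
  case (step x y z)
  from step obtain \<kappa> \<tau> where x: "x = t \<kappa> * adj (t \<tau>)" and l: "\<kappa> \<in> L" "\<tau> \<in> L"
    by (auto simp: matrices_def)
  have arr: "\<kappa> \<in> arr \<Lambda>" "\<tau> \<in> arr \<Lambda>" using l L by auto
  have "t \<alpha> * (adj (t \<alpha>) * x * t \<beta>) * adj (t \<beta>) = (if \<beta> = \<tau> then if \<alpha> = \<kappa> then x else 0 else 0)"
    if "\<alpha> \<in> L" "\<beta> \<in> L" for \<alpha> \<beta>
  proof -
    have "t \<alpha> * (adj (t \<alpha>) * x * t \<beta>) * adj (t \<beta>) =
        t \<alpha> * (adj (t \<alpha>) * t \<kappa>) * ((adj (t \<tau>) * t \<beta>) * adj (t \<beta>))"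
      by (simp add: x mult.assoc)
    also have "\<dots> = (if \<beta> = \<tau> then if \<alpha> = \<kappa> then x else 0 else 0)"
      using that l arr by (auto simp: adj_t_t_matrices x t_src src_adj_t)
    finally show ?thesis .
  qed
  then have "(\<Sum>\<alpha>\<in>L. \<Sum>\<beta>\<in>L. t \<alpha> * (adj (t \<alpha>) * x * t \<beta>) * adj (t \<beta>)) = x"
    using L(1) l by simp
  moreover have "t \<alpha> * (adj (t \<alpha>) * (z *\<^sub>C x + y) * t \<beta>) * adj (t \<beta>) =
      z *\<^sub>C (t \<alpha> * (adj (t \<alpha>) * x * t \<beta>) * adj (t \<beta>)) + t \<alpha> * (adj (t \<alpha>) * y * t \<beta>) * adj (t \<beta>)"
    for \<alpha> \<beta>
    by (simp add: distrib_left distrib_right mult_scaleC_left mult_scaleC_right)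
  ultimately have "(\<Sum>\<alpha>\<in>L. \<Sum>\<beta>\<in>L. t \<alpha> * (adj (t \<alpha>) * (z *\<^sub>C x + y) * t \<beta>) * adj (t \<beta>)) =
      z *\<^sub>C x + (\<Sum>\<alpha>\<in>L. \<Sum>\<beta>\<in>L. t \<alpha> * (adj (t \<alpha>) * y * t \<beta>) * adj (t \<beta>))"
    by (simp only: sum.distrib flip: scaleC_sum_right)
  then show ?case
    by (simp only: step.IH[symmetric])
qed

end

end

section \<open>The universal property for C*-algebras given as types\<close>

lemma bounded_bilinear_scaleC: "bounded_bilinear ((*\<^sub>C) :: complex \<Rightarrow> 'a::cstar_algebra \<Rightarrow> 'a)"
proof
  show "\<exists>K. \<forall>z (x :: 'a). norm (z *\<^sub>C x) \<le> norm z * norm x * K"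
    by (intro exI[of _ 1]) simp
qed (auto simp: scaleC_add_left scaleC_add_right scaleR_eq_scaleC scaleC_scaleC scaleR_conv_of_real
    mult.commute)

text \<open>Close \<open>X\<close> under the algebraic operations, with scalars from a countable
  dense set \<open>D\<close> only, so that the result \<open>Q\<close> stays countable. The closure
  of \<open>Q\<close> admits all complex scalars because scalar multiplication is jointly
  continuous.\<close>

lemma separable_star_subalgebra:
  fixes X :: "'a::cstar_algebra set"
  assumes "countable X"
  obtains U and q :: "nat \<Rightarrow> 'a"
  where "closed U" "star_subalgebra U" "X \<subseteq> U" "U \<subseteq> closure (range q)"
proof -
  obtain D :: "complex set" where D: "countable D" "\<And>Y. open Y \<Longrightarrow> Y \<noteq> {} \<Longrightarrow> \<exists>d\<in>D. d \<in> Y"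
    using countable_dense_setE by blast
  define step where "step S = S \<union> (\<lambda>(x, y). x + y) ` (S \<times> S) \<union> (\<lambda>(x, y). x * y) ` (S \<times> S) \<union>
      (\<lambda>(z, x). z *\<^sub>C x) ` (D \<times> S) \<union> adj ` S" for S :: "'a set"
  define Q where "Q = (\<Union>n. (step ^^ n) (insert 0 X))"
  have "countable ((step ^^ n) (insert 0 X))" for n
    by (induction n) (auto simp: assms step_def D(1))
  then have "countable Q"
    by (simp add: Q_def)
  have X: "insert 0 X \<subseteq> Q"
    unfolding Q_def by (metis UN_upper UNIV_I funpow_0)
  have mono: "(step ^^ m) S \<subseteq> (step ^^ n) S" if "m \<le> n" for m n S
    using that by (rule lift_Suc_mono_le[rotated]) (auto simp: step_def)
  have stage: "\<exists>n. x \<in> (step ^^ n) (insert 0 X) \<and> y \<in> (step ^^ n) (insert 0 X)"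
    if xy: "x \<in> Q" "y \<in> Q" for x y
  proof -
    obtain m n where "x \<in> (step ^^ m) (insert 0 X)" "y \<in> (step ^^ n) (insert 0 X)"
      using xy by (auto simp: Q_def)
    then show ?thesis
      using mono[of m "max m n"] mono[of n "max m n"] by (intro exI[of _ "max m n"]) auto
  qed
  have closed: "x + y \<in> Q \<and> x * y \<in> Q \<and> adj x \<in> Q \<and> (z \<in> D \<longrightarrow> z *\<^sub>C x \<in> Q)" if xy: "x \<in> Q" "y \<in> Q" for x y z
  proof -
    obtain n where n: "x \<in> (step ^^ n) (insert 0 X)" "y \<in> (step ^^ n) (insert 0 X)"
      using stage[OF xy] by blast
    define S where "S = (step ^^ n) (insert 0 X)"
    have "step S \<subseteq> Q"
      unfolding Q_def S_def by (intro UN_upper[of "Suc n" UNIV, THEN subset_trans[rotated]]) auto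
    moreover have "x + y \<in> step S \<and> x * y \<in> step S \<and> adj x \<in> step S \<and> (z \<in> D \<longrightarrow> z *\<^sub>C x \<in> step S)"
      using n[folded S_def] by (force simp: step_def)
    ultimately show ?thesis by blast
  qed
  have "star_subalgebra (closure Q)"
  proof -
    have "x + y \<in> closure Q \<and> x * y \<in> closure Q \<and> adj x \<in> closure Q \<and> z *\<^sub>C x \<in> closure Q"
      if xy: "x \<in> closure Q" "y \<in> closure Q" for x y z
    proof -
      obtain f g where fg: "\<forall>n. f n \<in> Q" "f \<longlonglongrightarrow> x" "\<forall>n. g n \<in> Q" "g \<longlonglongrightarrow> y"
        using xy unfolding closure_sequential by blast
      have "z \<in> closure D"
        unfolding closure_iff_nhds_not_empty using D(2) by (metis IntI empty_iff subsetD)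
      then obtain d where d: "\<forall>n. d n \<in> D" "d \<longlonglongrightarrow> z"
        unfolding closure_sequential by blast
      have "f n + g n \<in> Q" "f n * g n \<in> Q" "adj (f n) \<in> Q" "d n *\<^sub>C f n \<in> Q" for n
        using closed[of "f n" "g n" "d n"] fg d by auto
      moreover note tendsto_add[OF fg(2,4)] tendsto_mult[OF fg(2,4)]
        bounded_linear.tendsto[OF bounded_linear_adj fg(2)]
        bounded_bilinear.tendsto[OF bounded_bilinear_scaleC d(2) fg(2)]
      ultimately show ?thesis
        unfolding closure_sequential
        by (intro conjI exI[of _ "\<lambda>n. f n + g n"] exI[of _ "\<lambda>n. f n * g n"] exI[of _ "\<lambda>n. adj (f n)"]
          exI[of _ "\<lambda>n. d n *\<^sub>C f n"]) auto
    qed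
    moreover have "0 \<in> closure Q"
      using X closure_subset by blast
    ultimately show ?thesis
      unfolding star_subalgebra_def by blast
  qed
  moreover obtain q :: "nat \<Rightarrow> 'a" where "range q = Q"
    using uncountable_def[of Q] \<open>countable Q\<close> X by auto
  ultimately show thesis
    using X closure_subset[of Q] by (intro that[of "closure Q" q]) auto
qed

text \<open>Points outside \<open>e ` U\<close> are decoded to \<open>0\<close>, so that the distance is symmetric on the whole type,
  as \<^locale>\<open>Metric_space\<close> demands.\<close>

definition decode :: "'a::zero set \<Rightarrow> ('a \<Rightarrow> 'b) \<Rightarrow> 'b \<Rightarrow> 'a" where
  "decode U e y = (if y \<in> e ` U then inv_into U e y else 0)"

definition copy_cstar :: "'a::cstar_algebra set \<Rightarrow> ('a \<Rightarrow> 'b) \<Rightarrow> 'b cstar" where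
  "copy_cstar U e = (let d = decode U e in
     \<lparr>carrier = e ` U, monoid.mult = (\<lambda>x y. e (d x * d y)), one = undefined, zero = e 0,
      add = (\<lambda>x y. e (d x + d y)), smult = (\<lambda>z x. e (z *\<^sub>C d x)), star = (\<lambda>x. e (adj (d x))),
      nrm = (\<lambda>x. norm (d x))\<rparr>)"

context
  fixes U :: "'a::cstar_algebra set" and e :: "'a \<Rightarrow> 'b"
  assumes U: "star_subalgebra U" and inj: "inj_on e U"
begin

interpretation type: cstar_structure "type_cstar :: 'a cstar"
  by (rule cstar_structure_type_cstar)

lemma decode_simps: "x \<in> U \<Longrightarrow> decode U e (e x) = x" "decode U e y \<in> U"
  using inj star_subalgebraD(1)[OF U] by (auto simp: decode_def inv_into_into)

lemma copy_cstar_simps: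
  "carrier (copy_cstar U e) = e ` U" "zero (copy_cstar U e) = e 0"
  "monoid.mult (copy_cstar U e) x y = e (decode U e x * decode U e y)"
  "add (copy_cstar U e) x y = e (decode U e x + decode U e y)"
  "smult (copy_cstar U e) z x = e (z *\<^sub>C decode U e x)"
  "star (copy_cstar U e) x = e (adj (decode U e x))"
  "nrm (copy_cstar U e) x = norm (decode U e x)"
  by (simp_all add: copy_cstar_def Let_def)

lemma abelian_group_copy: "abelian_group (copy_cstar U e)"
proof (rule abelian_groupI)
  fix x assume "x \<in> carrier (copy_cstar U e)"
  then obtain a where "x = e a" "a \<in> U" by (auto simp: copy_cstar_simps)
  then show "\<exists>y\<in>carrier (copy_cstar U e). y \<oplus>\<^bsub>copy_cstar U e\<^esub> x = \<zero>\<^bsub>copy_cstar U e\<^esub>"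
    by (intro bexI[of _ "e (- a)"]) (simp_all add: copy_cstar_simps star_subalgebraD[OF U] star_subalgebra_minus[OF U] decode_simps)
qed (auto simp: copy_cstar_simps star_subalgebraD[OF U] decode_simps add_ac)

text \<open>Claimed also for arguments outside the carrier, because symmetry of the distance is
  required on the whole type. The group laws say nothing there, so the inverse is computed from its
  definite description.\<close>

lemma copy_cstar_minus: "x \<ominus>\<^bsub>copy_cstar U e\<^esub> y = e (decode U e x - decode U e y)"
proof -
  let ?d = "decode U e"
  have "e z = \<ominus>\<^bsub>copy_cstar U e\<^esub> y" if "z = - ?d y" for z
    unfolding a_inv_def m_inv_def
  proof (rule the_equality[symmetric])
    show "e z \<in> carrier (add_monoid (copy_cstar U e)) \<and>
      y \<otimes>\<^bsub>add_monoid (copy_cstar U e)\<^esub> e z = \<one>\<^bsub>add_monoid (copy_cstar U e)\<^esub> \<and>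
      e z \<otimes>\<^bsub>add_monoid (copy_cstar U e)\<^esub> y = \<one>\<^bsub>add_monoid (copy_cstar U e)\<^esub>"
      using that by (simp add: copy_cstar_simps decode_simps star_subalgebra_minus[OF U])
    fix w assume "w \<in> carrier (add_monoid (copy_cstar U e)) \<and>
      y \<otimes>\<^bsub>add_monoid (copy_cstar U e)\<^esub> w = \<one>\<^bsub>add_monoid (copy_cstar U e)\<^esub> \<and>
      w \<otimes>\<^bsub>add_monoid (copy_cstar U e)\<^esub> y = \<one>\<^bsub>add_monoid (copy_cstar U e)\<^esub>"
    then obtain a where a: "w = e a" "a \<in> U" "e (?d y + a) = e 0"
      by (auto simp: copy_cstar_simps decode_simps)
    then have "?d y + a = 0"
      using inj decode_simps(2) star_subalgebraD[OF U] by (auto simp: inj_on_eq_iff)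
    then show "w = e z"
      using a(1) that by (metis minus_unique)
  qed
  then show ?thesis
    by (simp add: a_minus_def copy_cstar_simps decode_simps star_subalgebra_minus[OF U] flip: \<open>\<And>z. z = - ?d y \<Longrightarrow> e z = _\<close>)
qed

lemma cstar_structure_copy:
  assumes "closed U"
  shows "cstar_structure (copy_cstar U e)"
proof -
  let ?D = "copy_cstar U e" and ?d = "decode U e"
  have "module complex_field ?D"
  proof (rule module.intro)
    show "module_axioms complex_field ?D"
      by unfold_locales
        (auto simp: copy_cstar_simps decode_simps star_subalgebraD[OF U] complex_field_def scaleC_add_left scaleC_add_right
          scaleC_scaleC)
  qed (rule type.R.is_cring abelian_group_copy)+
  moreover have "Metric_space.mcomplete (carrier ?D) (\<lambda>x y. nrm ?D (x \<ominus>\<^bsub>?D\<^esub> y))"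
  proof -
    let ?\<delta> = "\<lambda>x y. nrm ?D (x \<ominus>\<^bsub>?D\<^esub> y)"
    have \<delta>: "?\<delta> = (\<lambda>x y. dist (?d x) (?d y))"
      by (simp add: fun_eq_iff copy_cstar_minus copy_cstar_simps decode_simps star_subalgebra_minus[OF U] dist_norm)
    interpret M: Metric_space "carrier ?D" "\<lambda>x y. dist (?d x) (?d y)"
      by unfold_locales (auto simp: dist_commute dist_triangle copy_cstar_simps decode_simps)
    show ?thesis
      unfolding \<delta> M.mcomplete_def
    proof (intro allI impI)
      fix \<sigma> assume \<sigma>: "M.MCauchy \<sigma>"
      then have "Cauchy (\<lambda>n. ?d (\<sigma> n))"
        by (fastforce simp: M.MCauchy_def Cauchy_def)
      then obtain a where a: "(\<lambda>n. ?d (\<sigma> n)) \<longlonglongrightarrow> a"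
        using Cauchy_convergent_iff convergent_def by blast
      have "a \<in> U"
        using a assms decode_simps(2) by (rule_tac closed_sequentially[of U "\<lambda>n. ?d (\<sigma> n)"]) auto
      have "limitin M.mtopology \<sigma> (e a) sequentially"
        unfolding M.limit_metric_sequentially
      proof (intro conjI allI impI)
        show "e a \<in> carrier ?D"
          using \<open>a \<in> U\<close> by (simp add: copy_cstar_simps)
        fix \<epsilon> :: real assume "\<epsilon> > 0"
        then show "\<exists>N. \<forall>n\<ge>N. \<sigma> n \<in> carrier ?D \<and> dist (?d (\<sigma> n)) (?d (e a)) < \<epsilon>"
          using a \<sigma> \<open>a \<in> U\<close>
          by (simp add: decode_simps lim_sequentially M.MCauchy_def image_subset_iff)
      qed
      then show "\<exists>x. limitin M.mtopology \<sigma> x sequentially" ..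
    qed
  qed
  ultimately show ?thesis
    by (intro cstar_structure.intro cstar_structure_axioms.intro)
      (auto simp: copy_cstar_simps decode_simps star_subalgebraD[OF U] mult.assoc distrib_left distrib_right
        mult_scaleC_left mult_scaleC_right norm_triangle_ineq norm_mult_ineq cstar_identity)
qed

lemma star_hom_copy: "star_hom (copy_cstar U e) type_cstar (decode U e)"
  by (auto simp: star_hom_def copy_cstar_simps star_subalgebraD[OF U] decode_simps)

lemma finsum_copy:
  assumes "finite I" "\<And>i. i \<in> I \<Longrightarrow> f i \<in> U"
  shows "finsum (copy_cstar U e) (\<lambda>i. e (f i)) I = e (sum f I) \<and> sum f I \<in> U"
proof -
  interpret abelian_group "copy_cstar U e"
    by (rule abelian_group_copy)
  show ?thesis
    using assms
    by (induction I rule: finite_induct) (auto simp: copy_cstar_simps star_subalgebraD[OF U] decode_simps finsum_insert Pi_def)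
qed

end

text \<open>The family is moved into an algebra of real sequences by recording distances to a dense
  sequence; the homomorphism obtained there is composed with the decoding.\<close>

theorem ex_induced_hom:
  fixes \<Lambda> :: "('l, (nat \<Rightarrow> nat) \<times> 'f::{ab_group_add, countable}) graded_category"
    and s :: "'l \<Rightarrow> 'a::cstar_algebra" and t :: "'l \<Rightarrow> 'b::cstar_algebra"
  assumes "ck_rep k \<Lambda> c t" and "is_universal k \<Lambda> c s"
  shows "\<exists>\<pi>. is_induced_hom \<Lambda> s t \<pi>"
proof -
  interpret ck_rep k \<Lambda> c t by fact
  obtain U and q :: "nat \<Rightarrow> 'b"
    where U: "closed U" "star_subalgebra U" "t ` arr \<Lambda> \<subseteq> U" "U \<subseteq> closure (range q)"
    using separable_star_subalgebra[OF countable_image[OF countable_arr]] .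
  define e where "e x = (\<lambda>n. norm (x - q n))" for x
  have inj: "inj_on e U"
  proof
    fix x y assume xy: "x \<in> U" "y \<in> U" "e x = e y"
    show "x = y"
    proof (rule ccontr)
      assume "x \<noteq> y"
      \<comment> \<open>A point \<open>q n\<close> closer to \<open>x\<close> than half of
        \<open>dist x y\<close> cannot have the same distance to \<open>x\<close> and
        \<open>y\<close>, by the triangle inequality.\<close>
      then obtain n where "dist (q n) x < dist x y / 2"
        using U(4) xy(1) closure_approachable[of x "range q"] by (metis rangeE half_gt_zero subsetD zero_less_dist_iff)
      moreover have "dist x (q n) = dist y (q n)"
        using fun_cong[OF xy(3), of n] by (simp add: e_def dist_norm)
      ultimately show False
        using dist_triangle[of x y "q n"] by (simp add: dist_commute)
    qed
  qed
  let ?D = "copy_cstar U e"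
  note simps = copy_cstar_simps[OF U(2) inj] decode_simps[OF U(2) inj]
  note Uc = star_subalgebraD[OF U(2)]
  have tU: "t \<alpha> \<in> U" if "\<alpha> \<in> arr \<Lambda>" for \<alpha>
    using U(3) that by blast
  have "CK_family k \<Lambda> c ?D (\<lambda>\<alpha>. e (t \<alpha>))"
  proof
    fix v and p :: "(nat \<Rightarrow> nat) \<times> 'f" assume v: "v \<in> vertices \<Lambda>" and p: "p \<in> NF k"
    have "t v = (\<Sum>\<alpha>\<in>paths_from \<Lambda> v p. t \<alpha> * adj (t \<alpha>))"
      using v p by (rule t_vertex_sum)
    moreover have "t \<alpha> * adj (t \<alpha>) \<in> U" if "\<alpha> \<in> paths_from \<Lambda> v p" for \<alpha>
      using that by (simp add: paths_from_def tU Uc)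
    note finsum_copy[OF U(2) inj finite_paths_from[OF v p] this]
    ultimately have "e (t v) = finsum ?D (\<lambda>\<alpha>. e (t \<alpha> * adj (t \<alpha>))) (paths_from \<Lambda> v p)"
      by simp
    also have "\<dots> = finsum ?D (\<lambda>\<alpha>. e (t \<alpha>) \<otimes>\<^bsub>?D\<^esub> star ?D (e (t \<alpha>))) (paths_from \<Lambda> v p)"
      using abelian_group.axioms(1)[OF abelian_group_copy[OF U(2) inj]]
      by (intro abelian_monoid.finsum_cong') (auto simp: simps paths_from_def tU Uc)
    finally show "e (t v) = (\<Oplus>\<^bsub>?D\<^esub>\<alpha>\<in>paths_from \<Lambda> v p. e (t \<alpha>) \<otimes>\<^bsub>?D\<^esub> star ?D (e (t \<alpha>)))" .
  next
    fix \<mu> \<nu> assume "composable \<Lambda> \<mu> \<nu>"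
    then show "e (t \<mu>) \<otimes>\<^bsub>?D\<^esub> e (t \<nu>) = c \<mu> \<nu> \<odot>\<^bsub>?D\<^esub> e (t (cmp \<Lambda> \<mu> \<nu>))"
      using cmp_in t_cmp by (auto simp: composable_def simps tU)
  qed (auto simp: simps tU Uc vertexD t_vertex t_vertex_orthogonal t_isometry src_in)
  then obtain \<phi> where \<phi>: "star_hom type_cstar ?D \<phi>" "\<forall>\<alpha>\<in>arr \<Lambda>. \<phi> (s \<alpha>) = e (t \<alpha>)"
    using assms(2) cstar_structure_copy[OF U(2) inj U(1)] unfolding is_universal_def by blast
  have "star_hom type_cstar type_cstar (decode U e \<circ> \<phi>)"
    using \<phi>(1) star_hom_copy[OF U(2) inj] unfolding star_hom_def by (simp add: Pi_def)
  moreover have "decode U e (\<phi> (s \<alpha>)) = t \<alpha>" if "\<alpha> \<in> arr \<Lambda>" for \<alpha>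
    using that \<phi>(2) tU by (simp add: simps)
  ultimately show ?thesis
    unfolding is_induced_hom_def by auto
qed

section \<open>Characters\<close>

text \<open>The graph of a homomorphism from a subgroup to the circle.\<close>

definition partial_character :: "('a::ab_group_add \<times> complex) set \<Rightarrow> bool" where
  "partial_character \<Gamma> \<longleftrightarrow> (0, 1) \<in> \<Gamma> \<and>
     (\<forall>a z b w. (a, z) \<in> \<Gamma> \<longrightarrow> (b, w) \<in> \<Gamma> \<longrightarrow> (a + b, z * w) \<in> \<Gamma>) \<and>
     (\<forall>a z. (a, z) \<in> \<Gamma> \<longrightarrow> (- a, inverse z) \<in> \<Gamma> \<and> cmod z = 1) \<and>
     (\<forall>z. (0, z) \<in> \<Gamma> \<longrightarrow> z = 1)"

lemma partial_characterD:
  assumes "partial_character \<Gamma>"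
  shows "(0, 1) \<in> \<Gamma>" "(a, z) \<in> \<Gamma> \<Longrightarrow> (b, w) \<in> \<Gamma> \<Longrightarrow> (a + b, z * w) \<in> \<Gamma>"
    "(a, z) \<in> \<Gamma> \<Longrightarrow> (- a, inverse z) \<in> \<Gamma>" "(a, z) \<in> \<Gamma> \<Longrightarrow> cmod z = 1" "(0, z) \<in> \<Gamma> \<Longrightarrow> z = 1"
  using assms by (auto simp: partial_character_def)

lemma partial_character_unique:
  assumes "partial_character \<Gamma>" "(a, z) \<in> \<Gamma>" "(a, w) \<in> \<Gamma>"
  shows "z = w"
proof -
  have "(a + - a, z * inverse w) \<in> \<Gamma>"
    using assms partial_characterD(2,3) by blast
  then have "z * inverse w = 1"
    using partial_characterD(5)[OF assms(1)] by simp
  moreover have "w \<noteq> 0"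
    using partial_characterD(4)[OF assms(1,3)] by auto
  ultimately show ?thesis
    by (simp add: field_simps)
qed

lemma sum_lessThan_const_add:
  "(\<Sum>i<m + n. g) = (\<Sum>i<m. g) + (\<Sum>i<n::nat. g :: 'g::ab_group_add)"
  by (induction n) (auto simp: algebra_simps)

lemma partial_character_multiple:
  "partial_character \<Gamma> \<Longrightarrow> (g, z) \<in> \<Gamma> \<Longrightarrow> ((\<Sum>i<n::nat. g), z ^ n) \<in> \<Gamma>"
  by (induction n) (auto intro: partial_characterD simp: power_Suc2 simp del: power_Suc)

text \<open>The value \<open>w\<close> at \<open>g\<close> is free if no positive multiple of
  \<open>g\<close> lies in the domain, and then -1 is taken. Otherwise let \<open>d\<close> be the
  least such multiplier: \<open>w\<close> must be a \<open>d\<close>-th root of the value prescribed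
  at \<open>m d\<close>. As \<open>g\<close> itself is outside the domain, \<open>d\<close> is at
  least 2, which leaves a root other than 1.\<close>

lemma partial_character_extend:
  fixes g :: "'a::ab_group_add"
  assumes \<Gamma>: "partial_character \<Gamma>" and g: "g \<notin> Domain \<Gamma>"
  obtains \<Gamma>' w where "\<Gamma> \<subseteq> \<Gamma>'" "partial_character \<Gamma>'" "(g, w) \<in> \<Gamma>'" "w \<noteq> 1"
proof -
  define m where "m n = (\<Sum>i<n::nat. g)" for n
  note P = partial_characterD[OF \<Gamma>]
  have m_add: "m (i + j) = m i + m j" for i j
    by (simp add: m_def sum_lessThan_const_add)
  have m0: "m 0 = 0" "m 1 = g"
    by (simp_all add: m_def)
  have "\<exists>w. w \<noteq> 1 \<and> cmod w = 1 \<and> (\<forall>j z. (m j, z) \<in> \<Gamma> \<longrightarrow> z = w ^ j)"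
  proof (cases "\<exists>d>0. m d \<in> Domain \<Gamma>")
    case False
    then have "j = 0" if "(m j, z) \<in> \<Gamma>" for j z
      using that by auto
    then have "\<forall>j z. (m j, z) \<in> \<Gamma> \<longrightarrow> z = (-1) ^ j"
      using P(5) by (metis m0(1) power_0)
    then show ?thesis
      by (intro exI[of _ "-1"]) auto
  next
    case True
    define d where "d = (LEAST d. d > 0 \<and> m d \<in> Domain \<Gamma>)"
    have d: "d > 0" "m d \<in> Domain \<Gamma>"
      using LeastI_ex[OF True] by (auto simp: d_def)
    have least: "r = 0" if "r < d" "m r \<in> Domain \<Gamma>" for r
      using that not_less_Least[of r "\<lambda>d. d > 0 \<and> m d \<in> Domain \<Gamma>"] by (auto simp: d_def)
    obtain z where z: "(m d, z) \<in> \<Gamma>"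
      using d by auto
    have z1: "cmod z = 1"
      using P(4)[OF z] .
    have "d \<noteq> 1"
      using d g m0 by auto
    with d have "card {w. w ^ d = z} \<ge> 2"
      using card_nth_roots[of z d] z1 by fastforce
    have "\<not> {w. w ^ d = z} \<subseteq> {1}"
    proof
      assume "{w. w ^ d = z} \<subseteq> {1}"
      then have "card {w. w ^ d = z} \<le> card {1::complex}"
        by (intro card_mono) auto
      with \<open>card {w. w ^ d = z} \<ge> 2\<close> show False by simp
    qed
    then obtain w where w: "w ^ d = z" "w \<noteq> 1" by auto
    have "cmod w ^ d = 1"
      using w(1) z1 by (metis norm_power)
    then have w1: "cmod w = 1"
      using d power_eq_iff_eq_base[of d "cmod w" 1] by simp
    \<comment> \<open>Division with remainder by \<open>d\<close>: subtracting the multiple of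
      \<open>m d\<close> puts \<open>m r\<close> into the domain, so \<open>r = 0\<close> by
      minimality of \<open>d\<close>.\<close>
    have "y = w ^ j" if y: "(m j, y) \<in> \<Gamma>" for j y
    proof -
      define q r where "q = j div d" and "r = j mod d"
      have j: "j = d * q + r"
        by (simp add: q_def r_def)
      have dq: "m (d * q) = (\<Sum>i<q. m d)" for q
        by (induction q) (auto simp: m_add m0 algebra_simps)
      have "(m (d * q), z ^ q) \<in> \<Gamma>"
        using partial_character_multiple[OF \<Gamma> z, of q] by (simp add: dq)
      then have "(m j + - m (d * q), y * inverse (z ^ q)) \<in> \<Gamma>"
        using y P(2,3) by blast
      then have "m r \<in> Domain \<Gamma>"
        by (auto simp: j m_add)
      then have "r = 0"
        using least d by (simp add: r_def)
      then have "(m j, z ^ q) \<in> \<Gamma>"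
        using \<open>(m (d * q), z ^ q) \<in> \<Gamma>\<close> by (simp add: j)
      then have "y = z ^ q"
        using partial_character_unique[OF \<Gamma> y] by blast
      then show ?thesis
        using \<open>r = 0\<close> by (simp add: j w(1) power_mult)
    qed
    with w w1 show ?thesis by blast
  qed
  then obtain w where w: "w \<noteq> 1" "cmod w = 1" "\<And>j z. (m j, z) \<in> \<Gamma> \<Longrightarrow> z = w ^ j"
    by blast
  have w0: "w \<noteq> 0" using w(2) by auto
  \<comment> \<open>The integer multiples of \<open>g\<close> are written as differences of two
    natural ones.\<close>
  define \<Gamma>' where "\<Gamma>' = {(h + m i - m j, z * w ^ i * inverse (w ^ j)) | h z i j. (h, z) \<in> \<Gamma>}"
  have "\<Gamma> \<subseteq> \<Gamma>'"
  proof
    fix x assume x: "x \<in> \<Gamma>"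
    show "x \<in> \<Gamma>'"
      unfolding \<Gamma>'_def using x
      by (intro CollectI exI[of _ "fst x"] exI[of _ "snd x"] exI[of _ "0::nat"]) (simp add: m0)
  qed
  moreover have "partial_character \<Gamma>'"
    unfolding partial_character_def
  proof (intro conjI allI impI)
    show "(0, 1) \<in> \<Gamma>'"
      using P(1) \<open>\<Gamma> \<subseteq> \<Gamma>'\<close> by blast
    fix a z assume "(a, z) \<in> \<Gamma>'"
    then obtain h x i j where 1: "a = h + m i - m j" "z = x * w ^ i * inverse (w ^ j)" "(h, x) \<in> \<Gamma>"
      by (auto simp: \<Gamma>'_def)
    show "cmod z = 1"
      using 1 P(4) w by (simp add: norm_mult norm_power norm_inverse)
    have "- a = - h + m j - m i" "inverse z = inverse x * w ^ j * inverse (w ^ i)"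
      by (simp_all add: 1)
    then show "(- a, inverse z) \<in> \<Gamma>'"
      using P(3)[OF 1(3)] unfolding \<Gamma>'_def by blast
    fix b y assume "(b, y) \<in> \<Gamma>'"
    then obtain h' x' i' j' where 2: "b = h' + m i' - m j'" "y = x' * w ^ i' * inverse (w ^ j')"
        "(h', x') \<in> \<Gamma>"
      by (auto simp: \<Gamma>'_def)
    have "a + b = (h + h') + m (i + i') - m (j + j')"
      "z * y = (x * x') * w ^ (i + i') * inverse (w ^ (j + j'))"
      by (simp_all add: 1 2 m_add algebra_simps power_add)
    then show "(a + b, z * y) \<in> \<Gamma>'"
      using P(2)[OF 1(3) 2(3)] unfolding \<Gamma>'_def by blast
  next
    fix z assume "(0, z) \<in> \<Gamma>'"
    then obtain h x i j where 1: "h + m i - m j = 0" "z = x * w ^ i * inverse (w ^ j)" "(h, x) \<in> \<Gamma>"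
      by (auto simp: \<Gamma>'_def)
    show "z = 1"
    proof (cases "i \<le> j")
      case True
      then have "m j = m i + m (j - i)"
        using m_add[of i "j - i"] by simp
      then have "h = m (j - i)"
        using 1(1) by (simp add: algebra_simps)
      then have "x = w ^ (j - i)"
        using w(3) 1(3) by blast
      then show ?thesis
        using True w0 by (simp add: 1(2) flip: power_add)
    next
      case False
      then have "m i = m j + m (i - j)"
        using m_add[of j "i - j"] by simp
      then have "- h = m (i - j)"
        using 1(1) by (intro minus_unique) (simp add: algebra_simps)
      then have "inverse x = w ^ (i - j)"
        using w(3) P(3)[OF 1(3)] by simp
      then have "x = inverse (w ^ (i - j))"
        by (metis inverse_inverse_eq)
      then show ?thesis
        using False w0 by (simp add: 1(2) power_diff)
    qed
  qed
  moreover have "(0 + m 1 - m 0, 1 * w ^ 1 * inverse (w ^ 0)) \<in> \<Gamma>'"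
    unfolding \<Gamma>'_def using P(1) by blast
  then have "(g, w) \<in> \<Gamma>'"
    unfolding m0 by simp
  ultimately show thesis
    using that w(1) by blast
qed

text \<open>The first extension already fixes a value other than 1 at \<open>f\<close>. Zorn's lemma
  above it gives a maximal partial character, and by the extension step its domain is the whole
  group.\<close>

lemma character_separates:
  fixes f :: "'a::ab_group_add"
  assumes "f \<noteq> 0"
  obtains \<phi> where "\<And>a b. \<phi> (a + b) = \<phi> a * \<phi> b" "\<And>a. cmod (\<phi> a) = 1" "\<phi> f \<noteq> 1"
proof -
  have "partial_character {(0::'a, 1)}"
    by (simp add: partial_character_def)
  then obtain \<Gamma>1 w where \<Gamma>1: "partial_character \<Gamma>1" "(f, w) \<in> \<Gamma>1" "w \<noteq> 1"
    by (rule partial_character_extend[where g = f]) (use assms in auto)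
  define \<A> where "\<A> = {\<Gamma>. partial_character \<Gamma> \<and> \<Gamma>1 \<subseteq> \<Gamma>}"
  have "\<exists>M\<in>\<A>. \<forall>X\<in>\<A>. M \<subseteq> X \<longrightarrow> X = M"
  proof (rule subset_Zorn_nonempty)
    show "\<A> \<noteq> {}"
      using \<Gamma>1 by (auto simp: \<A>_def)
    fix C assume C: "C \<noteq> {}" "subset.chain \<A> C"
    have pc: "partial_character \<Gamma>" "\<Gamma>1 \<subseteq> \<Gamma>" if "\<Gamma> \<in> C" for \<Gamma>
      using C that by (auto simp: subset.chain_def \<A>_def)
    have "partial_character (\<Union>C)"
      unfolding partial_character_def
    proof (intro conjI allI impI)
      show "(0, 1) \<in> \<Union>C"
        using C(1) partial_characterD(1)[OF pc(1)] by blast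
      show "z = 1" if "(0, z) \<in> \<Union>C" for z
        using that partial_characterD(5)[OF pc(1)] by blast
      fix a z assume az: "(a, z) \<in> \<Union>C"
      show "(- a, inverse z) \<in> \<Union>C" "cmod z = 1"
        using az partial_characterD(3,4)[OF pc(1)] by blast+
      fix b y assume "(b, y) \<in> \<Union>C"
      with az obtain X Y where XY: "X \<in> C" "Y \<in> C" "(a, z) \<in> X" "(b, y) \<in> Y" by blast
      then have "X \<subseteq> Y \<or> Y \<subseteq> X"
        using C(2) by (auto simp: subset.chain_def)
      then obtain Z where "Z \<in> C" "(a, z) \<in> Z" "(b, y) \<in> Z"
        using XY by blast
      then show "(a + b, z * y) \<in> \<Union>C"
        using partial_characterD(2)[OF pc(1)] by blast
    qed
    moreover have "\<Gamma>1 \<subseteq> \<Union>C"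
      using C(1) pc(2) by blast
    ultimately show "\<Union>C \<in> \<A>"
      by (simp add: \<A>_def)
  qed
  then obtain \<Gamma> where \<Gamma>: "partial_character \<Gamma>" "\<Gamma>1 \<subseteq> \<Gamma>"
    and max: "\<And>X. partial_character X \<Longrightarrow> \<Gamma>1 \<subseteq> X \<Longrightarrow> \<Gamma> \<subseteq> X \<Longrightarrow> X = \<Gamma>"
    by (auto simp: \<A>_def)
  have dom: "a \<in> Domain \<Gamma>" for a
  proof (rule ccontr)
    assume a: "a \<notin> Domain \<Gamma>"
    obtain X v where X: "\<Gamma> \<subseteq> X" "partial_character X" "(a, v) \<in> X"
      by (rule partial_character_extend[OF \<Gamma>(1) a])
    then have "X = \<Gamma>"
      using max \<Gamma>(2) by (meson subset_trans)
    then show False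
      using X(3) a by blast
  qed
  define \<phi> where "\<phi> a = (THE z. (a, z) \<in> \<Gamma>)" for a
  have eq: "\<phi> a = z" if "(a, z) \<in> \<Gamma>" for a z
    unfolding \<phi>_def using that partial_character_unique[OF \<Gamma>(1)] by blast
  have in_\<Gamma>: "(a, \<phi> a) \<in> \<Gamma>" for a
    using dom[of a] eq by auto
  show thesis
  proof (rule that)
    show "\<phi> (a + b) = \<phi> a * \<phi> b" for a b
      by (intro eq partial_characterD(2)[OF \<Gamma>(1)] in_\<Gamma>)
    show "cmod (\<phi> a) = 1" for a
      by (rule partial_characterD(4)[OF \<Gamma>(1) in_\<Gamma>])
    have "(f, w) \<in> \<Gamma>"
      using \<Gamma>(2) \<Gamma>1(2) by blast
    with eq \<Gamma>1(3) show "\<phi> f \<noteq> 1"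
      by simp
  qed
qed

lemma dual_separates:
  fixes g h :: "(nat \<Rightarrow> int) \<times> 'f::ab_group_add"
  assumes "g \<in> ZF k" "h \<in> ZF k" "g \<noteq> h"
  obtains \<xi> where "\<xi> \<in> dual k" "\<xi> g \<noteq> \<xi> h"
proof (cases "snd g = snd h")
  case False
  obtain \<phi> where \<phi>: "\<And>a b. \<phi> (a + b) = \<phi> a * \<phi> b" "\<And>a. cmod (\<phi> a) = 1" "\<phi> (snd g - snd h) \<noteq> 1"
    using character_separates[of "snd g - snd h"] False by auto
  have "\<phi> (snd g) = \<phi> (snd g - snd h) * \<phi> (snd h)"
    by (simp flip: \<phi>(1))
  then have "\<phi> (snd g) \<noteq> \<phi> (snd h)"
    using \<phi>(2)[of "snd h"] \<phi>(3) by auto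
  then show thesis
    using assms \<phi> by (intro that[of "\<lambda>x\<in>ZF k. \<phi> (snd x)"]) (auto simp: dual_def ZF_add)
next
  case True
  then obtain i where i: "fst g i \<noteq> fst h i"
    using assms(3) by (auto simp: prod_eq_iff fun_eq_iff)
  \<comment> \<open>With this angle the character x -> exp(i \<theta> x_i) takes opposite values at
    \<open>g\<close> and \<open>h\<close>.\<close>
  define \<theta> where "\<theta> = pi / of_int (fst g i - fst h i)"
  have "\<theta> * of_int (fst g i) = \<theta> * of_int (fst h i) + pi"
    using i by (simp add: \<theta>_def field_simps)
  then have "cis (\<theta> * of_int (fst g i)) = - cis (\<theta> * of_int (fst h i))"
    by (simp flip: cis_mult)
  moreover have "- cis x \<noteq> cis x" for x
  proof
    assume "- cis x = cis x"
    then have "cis x + cis x = 0"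
      by (metis add.right_inverse)
    then show False
      using cis_neq_zero[of x] by simp
  qed
  ultimately show thesis
    using assms
    by (intro that[of "\<lambda>x\<in>ZF k. cis (\<theta> * of_int (fst x i))"])
      (auto simp: dual_def ZF_add distrib_left simp flip: cis_mult)
qed

section \<open>Fourier coefficients\<close>

text \<open>The component at \<open>h\<close> survives averaging \<open>\<xi>(h)\<^sup>-\<^sup>n \<beta>\<^sub>\<xi>\<^sup>n\<close>, while a component at \<open>g\<close> with
  \<open>\<xi>(g) \<noteq> \<xi>(h)\<close> is averaged to \<open>0\<close>; the remaining components are only multiplied by scalars.\<close>

lemma norm_eigenvector_le:
  fixes \<beta> :: "'i \<Rightarrow> 'b::cstar_algebra \<Rightarrow> 'b" and f :: "'g \<Rightarrow> 'b" and \<phi> :: "'i \<Rightarrow> 'g \<Rightarrow> complex"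
  assumes hom: "\<And>\<xi>. \<xi> \<in> X \<Longrightarrow> star_hom type_cstar type_cstar (\<beta> \<xi>)"
    and unit: "\<And>\<xi> g. \<xi> \<in> X \<Longrightarrow> g \<in> G \<Longrightarrow> cmod (\<phi> \<xi> g) = 1"
    and separates: "\<And>g h. g \<in> G \<Longrightarrow> h \<in> G \<Longrightarrow> g \<noteq> h \<Longrightarrow> \<exists>\<xi>\<in>X. \<phi> \<xi> g \<noteq> \<phi> \<xi> h"
    and "finite S" "h \<notin> S" "insert h S \<subseteq> G"
    and "\<And>\<xi> g. \<xi> \<in> X \<Longrightarrow> g \<in> insert h S \<Longrightarrow> \<beta> \<xi> (f g) = \<phi> \<xi> g *\<^sub>C f g"
  shows "norm (f h) \<le> norm (f h + sum f S)"
  using assms(4-)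
proof (induction S arbitrary: f)
  case empty
  then show ?case by simp
next
  case (insert g S)
  from insert.prems insert.hyps have gh: "g \<in> G" "h \<in> G" "g \<noteq> h" by auto
  then obtain \<xi> where \<xi>: "\<xi> \<in> X" "\<phi> \<xi> g \<noteq> \<phi> \<xi> h"
    using separates by blast
  note homD = star_homD[OF hom[OF \<xi>(1)]]
  \<comment> \<open>Eigenvalues rescaled so that the one at \<open>h\<close> is 1: iteration then
    fixes \<open>f h\<close>, while \<open>f g\<close>, with \<open>z g \<noteq> 1\<close>, is
    averaged out.\<close>
  define z where "z u = cnj (\<phi> \<xi> h) * \<phi> \<xi> u" for u
  have cnj1: "cnj (\<phi> \<xi> h) * \<phi> \<xi> h = 1"
    using unit[OF \<xi>(1) gh(2)] by (metis complex_norm_square mult.commute of_real_1 one_power2)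
  have zh: "z h = 1"
    by (simp add: z_def cnj1)
  have zg: "z g \<noteq> 1"
    using \<xi>(2) cnj1 by (auto simp: z_def) (metis mult.commute mult.left_commute mult.right_neutral)
  have z1: "cmod (z u) = 1" if "u \<in> G" for u
    using unit[OF \<xi>(1)] gh(2) that by (simp add: z_def norm_mult)
  have iter: "((\<lambda>x. cnj (\<phi> \<xi> h) *\<^sub>C \<beta> \<xi> x) ^^ n) (f u) = z u ^ n *\<^sub>C f u"
    if "u \<in> insert h (insert g S)" for u n
    using insert.prems(3)[OF \<xi>(1) that]
    by (induction n) (simp_all add: homD scaleC_scaleC z_def mult_ac)
  define b where "b = f h + sum f (insert g S)"
  define T where "T = (\<lambda>x. cnj (\<phi> \<xi> h) *\<^sub>C \<beta> \<xi> x)"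
  have T_add: "(T ^^ n) (x + y) = (T ^^ n) x + (T ^^ n) y" and T_sum0: "(T ^^ n) 0 = 0" for n x y
    by (induction n) (simp_all add: T_def homD scaleC_add_right)
  have T_sum: "(T ^^ n) (sum f' I) = (\<Sum>i\<in>I. (T ^^ n) (f' i))" for n I and f' :: "'g \<Rightarrow> 'b"
    by (induction I rule: infinite_finite_induct) (auto simp: T_add T_sum0)
  have T_norm: "norm ((T ^^ n) x) \<le> norm x" for n x
  proof (induction n)
    case (Suc n)
    have "norm ((T ^^ Suc n) x) \<le> norm ((T ^^ n) x)"
      using star_hom_norm_le[OF hom[OF \<xi>(1)]] unit[OF \<xi>(1) gh(2)] by (simp add: T_def)
    with Suc show ?case by simp
  qed simp
  define m where "m N u = (\<Sum>n<N. z u ^ n) / of_nat N" for N u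
  have bound: "norm (f h) \<le> norm b + 2 / (real N * cmod (z g - 1)) * norm (f g)" if N: "N > 0" for N
  proof -
    define a where "a = (1 / real N) *\<^sub>R (\<Sum>n<N. (T ^^ n) b)"
    have "norm a \<le> (1 / real N) * (\<Sum>n<N. norm b)"
      unfolding a_def norm_scaleR using N by (intro mult_mono sum_norm_le T_norm) auto
    then have a_le: "norm a \<le> norm b"
      using N by simp
    have Tb: "(T ^^ n) b = f h + (z g ^ n *\<^sub>C f g + (\<Sum>u\<in>S. z u ^ n *\<^sub>C f u))" for n
      using insert.hyps iter[folded T_def]
      by (simp add: b_def T_add T_sum zh)
    have "(\<Sum>n<N. (T ^^ n) b) = (\<Sum>n<N. f h) +
        ((\<Sum>n<N. z g ^ n) *\<^sub>C f g + (\<Sum>u\<in>S. (\<Sum>n<N. z u ^ n) *\<^sub>C f u))"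
      unfolding Tb sum.distrib scaleC_sum_left by (subst sum.swap) simp
    moreover have "(1 / real N) *\<^sub>R (\<Sum>n<N. f h) = f h"
      using N by (simp add: sum_constant_scaleR)
    moreover have "(1 / real N) *\<^sub>R (x *\<^sub>C y) = (x / of_nat N) *\<^sub>C y" for x and y :: 'b
      by (simp add: scaleR_eq_scaleC scaleC_scaleC)
    ultimately have a_eq: "a = f h + (m N g *\<^sub>C f g + (\<Sum>u\<in>S. m N u *\<^sub>C f u))"
      unfolding a_def m_def by (simp only: scaleR_add_right scaleR_sum_right)
    \<comment> \<open>The averaged components are multiples of the old ones, hence still
      eigenvectors. The induction hypothesis for \<open>f'\<close> handles all of them except the
      one at \<open>g\<close>, which becomes an error term.\<close>
    define f' where "f' u = (if u = h then f h else m N u *\<^sub>C f u)" for u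
    have "norm (f' h) \<le> norm (f' h + sum f' S)"
    proof (rule insert.IH)
      show "h \<notin> S" "insert h S \<subseteq> G"
        using insert.prems by auto
      fix \<zeta> u assume "\<zeta> \<in> X" "u \<in> insert h S"
      then show "\<beta> \<zeta> (f' u) = \<phi> \<zeta> u *\<^sub>C f' u"
        using insert.prems(3)[of \<zeta> u] star_homD[OF hom[of \<zeta>]]
        by (auto simp: f'_def scaleC_scaleC mult.commute)
    qed
    also have "f' h + sum f' S = a - m N g *\<^sub>C f g"
    proof -
      have "sum f' S = (\<Sum>u\<in>S. m N u *\<^sub>C f u)"
        using insert.prems by (intro sum.cong) (auto simp: f'_def)
      then show ?thesis by (simp add: a_eq f'_def)
    qed
    also have "norm \<dots> \<le> norm b + cmod (m N g) * norm (f g)"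
      using norm_triangle_ineq4[of a "m N g *\<^sub>C f g"] a_le by simp
    \<comment> \<open>A geometric sum: its numerator is a difference of two points of the circle,
      which accounts for the 2.\<close>
    also have "cmod (m N g) \<le> 2 / (real N * cmod (z g - 1))"
    proof -
      have "cmod (z g ^ N - 1) \<le> 2"
        using norm_triangle_ineq4[of "z g ^ N" 1] z1[OF gh(1)] by (simp add: norm_power)
      also have "z g ^ N - 1 = (z g - 1) * (\<Sum>n<N. z g ^ n)"
        by (rule power_diff_1_eq)
      finally have "cmod (z g - 1) * cmod (\<Sum>n<N. z g ^ n) \<le> 2"
        by (simp add: norm_mult)
      then show ?thesis
        using N zg by (simp add: m_def norm_divide divide_simps mult.commute)
    qed
    finally show ?thesis
      by (simp add: f'_def mult_right_mono)
  qed
  have "norm (f h) \<le> norm b"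
  proof (rule tendsto_le)
    show "eventually (\<lambda>N. norm (f h) \<le> norm b + 2 / (real N * cmod (z g - 1)) * norm (f g)) sequentially"
      using bound by (intro eventually_sequentiallyI[of 1]) auto
    have "cmod (z g - 1) > 0" using zg by simp
    then have "((\<lambda>N. 2 / (real N * cmod (z g - 1)) * norm (f g)) \<longlongrightarrow> 0) sequentially"
      by real_asymp
    then show "((\<lambda>N. norm b + 2 / (real N * cmod (z g - 1)) * norm (f g)) \<longlongrightarrow> norm b) sequentially"
      using tendsto_add[OF tendsto_const[of "norm b"]] by fastforce
  qed auto
  then show ?case
    by (simp add: b_def)
qed

section \<open>Homomorphisms that are isometric on the graded pieces\<close>

locale ck_morphism = A: ck_rep k \<Lambda> c s + B: ck_rep k \<Lambda> c t
  for k :: nat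
    and \<Lambda> :: "('l, (nat \<Rightarrow> nat) \<times> 'f::{ab_group_add, countable}) graded_category"
    and c :: "'l \<Rightarrow> 'l \<Rightarrow> complex"
    and s :: "'l \<Rightarrow> 'a::cstar_algebra"
    and t :: "'l \<Rightarrow> 'b::cstar_algebra" +
  fixes \<pi> :: "'a \<Rightarrow> 'b"
  assumes hom: "star_hom type_cstar type_cstar \<pi>"
    and \<pi>_s: "\<alpha> \<in> arr \<Lambda> \<Longrightarrow> \<pi> (s \<alpha>) = t \<alpha>"
    and nonzero: "v \<in> vertices \<Lambda> \<Longrightarrow> t v \<noteq> 0"
begin

lemmas homD = star_homD[OF hom]

lemma norm_t_vertex:
  assumes "v \<in> vertices \<Lambda>"
  shows "norm (t v) = 1"
proof -
  have "norm (t v) * norm (t v) = norm (t v)"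
    using cstar_identity[of "t v"] B.t_vertex[OF assms] by (simp add: power2_eq_square)
  with nonzero[OF assms] show ?thesis by simp
qed

text \<open>Each entry of \<open>x\<close> is a scalar whose modulus is seen by \<pi>, since a
  nonzero vertex projection has norm 1. Adding up all entries is crude, but any constant that
  depends only on \<open>L\<close> will do.\<close>

lemma matrices_bound:
  assumes L: "finite L" "L \<subseteq> arr \<Lambda>" "\<And>\<alpha>. \<alpha> \<in> L \<Longrightarrow> deg \<Lambda> \<alpha> = p"
    and x: "x \<in> cspan (A.matrices L)"
  shows "norm x \<le> (real (card L))\<^sup>2 * norm (\<pi> x)"
proof -
  have "norm (s \<alpha> * (adj (s \<alpha>) * x * s \<beta>) * adj (s \<beta>)) \<le> norm (\<pi> x)" if l: "\<alpha> \<in> L" "\<beta> \<in> L" for \<alpha> \<beta>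
  proof -
    have arr: "\<alpha> \<in> arr \<Lambda>" "\<beta> \<in> arr \<Lambda>" using l L by auto
    obtain a where a: "adj (s \<alpha>) * x * s \<beta> = a *\<^sub>C s (src \<Lambda> \<alpha>)"
      using A.matrices_corner[OF L x l] by blast
    have "norm (s \<alpha> * (adj (s \<alpha>) * x * s \<beta>) * adj (s \<beta>)) = cmod a * norm (s \<alpha> * adj (s \<beta>))"
      unfolding a using arr by (simp add: mult_scaleC_left mult_scaleC_right A.t_src)
    also have "\<dots> \<le> cmod a * (norm (s \<alpha>) * norm (adj (s \<beta>)))"
      by (intro mult_left_mono norm_mult_ineq) auto
    also have "\<dots> \<le> cmod a * (1 * 1)"
      using arr A.norm_t_le_1 by (intro mult_left_mono mult_mono) auto
    finally have 1: "norm (s \<alpha> * (adj (s \<alpha>) * x * s \<beta>) * adj (s \<beta>)) \<le> cmod a"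
      by simp
    have "\<pi> (adj (s \<alpha>) * x * s \<beta>) = \<pi> (a *\<^sub>C s (src \<Lambda> \<alpha>))"
      using a by simp
    then have "adj (t \<alpha>) * \<pi> x * t \<beta> = a *\<^sub>C t (src \<Lambda> \<alpha>)"
      using arr by (simp add: homD \<pi>_s A.src_in)
    then have "cmod a = norm (adj (t \<alpha>) * \<pi> x * t \<beta>)"
      using norm_t_vertex[OF A.src_vertex[OF arr(1)]] by simp
    also have "\<dots> \<le> norm (adj (t \<alpha>)) * norm (\<pi> x) * norm (t \<beta>)"
      by (meson norm_mult_ineq mult_right_mono norm_ge_zero order_trans)
    also have "\<dots> \<le> 1 * norm (\<pi> x) * 1"
      using arr B.norm_t_le_1 by (intro mult_mono mult_right_mono) auto
    finally show ?thesis using 1 by simp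
  qed
  then have "norm (\<Sum>\<alpha>\<in>L. \<Sum>\<beta>\<in>L. s \<alpha> * (adj (s \<alpha>) * x * s \<beta>) * adj (s \<beta>)) \<le>
      (\<Sum>\<alpha>\<in>L. \<Sum>\<beta>\<in>L. norm (\<pi> x))"
    by (intro sum_norm_le)
  also have "\<dots> = (real (card L))\<^sup>2 * norm (\<pi> x)"
    by (simp add: power2_eq_square)
  finally show ?thesis
    by (subst A.matrices_expansion[OF L x])
qed

text \<open>The element \<open>adj x * x\<close> has degree 0 and so lies in the matrix algebra of
  some finite \<open>L\<close>. All its iterated squares stay there, so one constant bounds them
  all.\<close>

lemma graded_isometric:
  assumes "x \<in> cspan (A.graded g)"
  shows "norm (\<pi> x) = norm x"
proof -
  have "adj x * x \<in> cspan (A.graded (- g + g))"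
    using assms A.graded_adj A.graded_mult by blast
  then obtain p where "adj x * x \<in> cspan (A.core p)"
    using A.graded_0_core[of "adj x * x"] unfolding left_minus by blast
  then obtain L where L: "finite L" "L \<subseteq> arr \<Lambda>" "\<And>\<alpha>. \<alpha> \<in> L \<Longrightarrow> deg \<Lambda> \<alpha> = p"
    and x: "adj x * x \<in> cspan (A.matrices L)"
    using A.core_matrices by blast
  have "((\<lambda>y. y * y) ^^ m) (adj x * x) \<in> cspan (A.matrices L)" for m
    by (induction m) (auto simp: x intro: A.matrices_mult[OF L])
  then have "norm (((\<lambda>y. y * y) ^^ m) (adj x * x)) \<le> (real (card L))\<^sup>2 * (2 ^ m + 1) ^ 0 *
      norm (\<pi> (((\<lambda>y. y * y) ^^ m) (adj x * x)))" for m
    using matrices_bound[OF L] by simp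
  then show ?thesis
    by (rule star_hom_norm_eq_if_polynomial_growth[OF hom])
qed

lemma graded_image: "x \<in> cspan (A.graded g) \<Longrightarrow> \<pi> x \<in> cspan (B.graded g)"
proof (rule cspan_star_hom_image[OF hom])
  fix x assume "x \<in> A.graded g"
  then have "\<pi> x \<in> B.graded g"
    by (force simp: A.graded_def B.graded_def homD \<pi>_s)
  then show "\<pi> x \<in> cspan (B.graded g)"
    by (rule cspan_base)
qed

text \<open>Only existence of homogeneous components is recorded. Uniqueness is not asserted, and
  the estimates below hold for every choice of \<open>f\<close>.\<close>

definition supported :: "((nat \<Rightarrow> int) \<times> 'f) set \<Rightarrow> 'a set" where
  "supported S = {x. \<exists>f. (\<forall>g\<in>S. f g \<in> cspan (A.graded g)) \<and> x = sum f S}"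

lemma supported_mono:
  assumes "x \<in> supported S" "S \<subseteq> T" "finite T"
  shows "x \<in> supported T"
proof -
  obtain f where f: "\<forall>g\<in>S. f g \<in> cspan (A.graded g)" "x = sum f S"
    using assms by (auto simp: supported_def)
  let ?f = "\<lambda>g. if g \<in> S then f g else 0"
  have "sum ?f T = sum f S"
    using assms by (subst sum.inter_restrict[symmetric]) (auto simp: Int_absorb1)
  then show ?thesis
    using f by (auto simp: supported_def intro!: exI[of _ ?f] cspan.zero)
qed

lemma supported_add: "x \<in> supported S \<Longrightarrow> y \<in> supported S \<Longrightarrow> x + y \<in> supported S"
proof -
  assume "x \<in> supported S" "y \<in> supported S"
  then obtain f f' where "\<forall>g\<in>S. f g \<in> cspan (A.graded g)" "x = sum f S"
    "\<forall>g\<in>S. f' g \<in> cspan (A.graded g)" "y = sum f' S"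
    by (auto simp: supported_def)
  then show ?thesis
    by (auto simp: supported_def sum.distrib intro!: exI[of _ "\<lambda>g. f g + f' g"] cspan_add)
qed

lemma supported_mult:
  assumes "x \<in> supported S" "y \<in> supported T" "finite S" "finite T"
  shows "x * y \<in> supported ((\<lambda>(g, h). g + h) ` (S \<times> T))" (is "_ \<in> supported ?U")
proof -
  obtain f f' where f: "\<forall>g\<in>S. f g \<in> cspan (A.graded g)" "x = sum f S"
    "\<forall>g\<in>T. f' g \<in> cspan (A.graded g)" "y = sum f' T"
    using assms by (auto simp: supported_def)
  let ?h = "\<lambda>u. \<Sum>(g, h)\<in>{p \<in> S \<times> T. (case p of (g, h) \<Rightarrow> g + h) = u}. f g * f' h"
  have "x * y = (\<Sum>(g, h)\<in>S \<times> T. f g * f' h)"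
    by (simp add: f sum_product sum.cartesian_product)
  also have "\<dots> = sum ?h ?U"
    using assms by (intro sum.image_gen) auto
  finally have "x * y = sum ?h ?U" .
  moreover have "?h u \<in> cspan (A.graded u)" for u
    using f by (intro cspan_sum) (auto intro!: A.graded_mult)
  ultimately show ?thesis
    unfolding supported_def by (intro CollectI exI[of _ ?h]) simp
qed

lemma supported_adj:
  assumes "x \<in> supported S"
  shows "adj x \<in> supported (uminus ` S)"
proof -
  obtain f where f: "\<forall>g\<in>S. f g \<in> cspan (A.graded g)" "x = sum f S"
    using assms by (auto simp: supported_def)
  have "adj x = (\<Sum>g\<in>uminus ` S. adj (f (- g)))"
    by (subst sum.reindex) (auto simp: f)
  moreover have "adj (f (- g)) \<in> cspan (A.graded g)" if "g \<in> uminus ` S" for g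
    using f A.graded_adj[of "f (- g)" "- g"] that by auto
  ultimately show ?thesis
    unfolding supported_def by (intro CollectI exI[of _ "\<lambda>g. adj (f (- g))"]) simp
qed

definition dense_part :: "'a set" where
  "dense_part = {x. \<exists>S. finite S \<and> S \<subseteq> ZF k \<and> x \<in> supported S}"

lemma star_subalgebra_dense_part: "star_subalgebra dense_part"
proof -
  have "0 \<in> dense_part"
    by (auto simp: dense_part_def supported_def intro!: exI[of _ "{}"])
  moreover have "x + y \<in> dense_part" if xy: "x \<in> dense_part" "y \<in> dense_part" for x y
  proof -
    obtain S T where "finite S" "S \<subseteq> ZF k" "x \<in> supported S" "finite T" "T \<subseteq> ZF k" "y \<in> supported T"
      using xy by (auto simp: dense_part_def)
    then show ?thesis
      unfolding dense_part_def
      using supported_add[OF supported_mono[of x S "S \<union> T"] supported_mono[of y T "S \<union> T"]]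
      by (intro CollectI exI[of _ "S \<union> T"]) auto
  qed
  moreover have "x * y \<in> dense_part" if xy: "x \<in> dense_part" "y \<in> dense_part" for x y
  proof -
    obtain S T where "finite S" "S \<subseteq> ZF k" "x \<in> supported S" "finite T" "T \<subseteq> ZF k" "y \<in> supported T"
      using xy by (auto simp: dense_part_def)
    moreover have "(\<lambda>(g, h). g + h) ` (S \<times> T) \<subseteq> ZF k"
    proof (intro image_subsetI)
      fix p assume "p \<in> S \<times> T"
      then have "fst p \<in> ZF k" "snd p \<in> ZF k"
        using \<open>S \<subseteq> ZF k\<close> \<open>T \<subseteq> ZF k\<close> by auto
      then show "(case p of (g, h) \<Rightarrow> g + h) \<in> ZF k"
        by (simp add: case_prod_unfold ZF_add)
    qed
    ultimately show ?thesis
      unfolding dense_part_def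
      by (intro CollectI exI[of _ "(\<lambda>(g, h). g + h) ` (S \<times> T)"]) (simp add: supported_mult)
  qed
  moreover have "z *\<^sub>C x \<in> dense_part" if x: "x \<in> dense_part" for x z
  proof -
    obtain S f where S: "finite S" "S \<subseteq> ZF k" "\<forall>g\<in>S. f g \<in> cspan (A.graded g)" "x = sum f S"
      using x by (auto simp: dense_part_def supported_def)
    then have "z *\<^sub>C x \<in> supported S"
      unfolding supported_def
      by (intro CollectI exI[of _ "\<lambda>g. z *\<^sub>C f g"]) (auto simp: scaleC_sum_right intro: cspan_scale)
    with S show ?thesis
      by (auto simp: dense_part_def)
  qed
  moreover have "adj x \<in> dense_part" if x: "x \<in> dense_part" for x
  proof -
    obtain S where "finite S" "S \<subseteq> ZF k" "x \<in> supported S"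
      using x by (auto simp: dense_part_def)
    then show ?thesis
      unfolding dense_part_def
      by (intro CollectI exI[of _ "uminus ` S"]) (auto intro!: supported_adj simp: ZF_def)
  qed
  ultimately show ?thesis
    by (simp add: star_subalgebra_def)
qed

lemma s_in_dense_part:
  assumes "\<alpha> \<in> arr \<Lambda>"
  shows "s \<alpha> \<in> dense_part"
proof -
  have "s \<alpha> \<in> supported {to_ZF (deg \<Lambda> \<alpha>)}"
    unfolding supported_def
    using A.t_in_graded[OF assms] by (auto intro!: exI[of _ "\<lambda>_. s \<alpha>"] cspan_base)
  then show ?thesis
    unfolding dense_part_def using assms A.deg_in to_ZF_in by blast
qed

text \<open>A box that contains all sums of \<open>n\<close> elements of \<open>S\<close> and is visibly of polynomial size in \<open>n\<close>.\<close>

definition multiples :: "nat \<Rightarrow> ((nat \<Rightarrow> int) \<times> 'f) set \<Rightarrow> ((nat \<Rightarrow> int) \<times> 'f) set" where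
  "multiples n S = (\<lambda>m. \<Sum>g\<in>S. \<Sum>i<m g. g) ` (S \<rightarrow>\<^sub>E {..n})"

lemma multiples_one: "finite S \<Longrightarrow> S \<subseteq> multiples 1 S"
proof
  fix g assume S: "finite S" "g \<in> S"
  have "(\<Sum>h\<in>S. \<Sum>i<(if h = g then 1 else 0::nat). h) = (\<Sum>h\<in>S. if h = g then h else 0)"
    by (intro sum.cong) auto
  also have "\<dots> = g"
    using S by simp
  finally have "g = (\<Sum>h\<in>S. \<Sum>i<(\<lambda>h\<in>S. if h = g then 1 else 0::nat) h. h)"
    by (simp cong: sum.cong)
  moreover have "(\<lambda>h\<in>S. if h = g then 1 else 0) \<in> S \<rightarrow>\<^sub>E {..1::nat}"
    by (auto simp: PiE_iff)
  ultimately show "g \<in> multiples 1 S"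
    unfolding multiples_def by (rule image_eqI[where x = "\<lambda>h\<in>S. if h = g then 1 else 0"])
qed

lemma multiples_add:
  "g \<in> multiples m S \<Longrightarrow> h \<in> multiples n S \<Longrightarrow> g + h \<in> multiples (m + n) S"
proof -
  assume "g \<in> multiples m S" "h \<in> multiples n S"
  then obtain a b where ab: "a \<in> S \<rightarrow>\<^sub>E {..m}" "b \<in> S \<rightarrow>\<^sub>E {..n}"
    "g = (\<Sum>x\<in>S. \<Sum>i<a x. x)" "h = (\<Sum>x\<in>S. \<Sum>i<b x. x)"
    by (auto simp: multiples_def)
  have "(\<Sum>x\<in>S. \<Sum>i<(\<lambda>x\<in>S. a x + b x) x. x) = g + h"
    by (simp add: ab sum_lessThan_const_add sum.distrib cong: sum.cong)
  moreover have "(\<lambda>x\<in>S. a x + b x) \<in> S \<rightarrow>\<^sub>E {..m + n}"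
    using ab(1,2) unfolding PiE_iff by (simp add: add_mono)
  ultimately show ?thesis
    unfolding multiples_def by (intro image_eqI[where x = "\<lambda>x\<in>S. a x + b x"]) simp_all
qed

lemma finite_multiples: "finite S \<Longrightarrow> finite (multiples n S)"
  by (simp add: multiples_def finite_PiE)

lemma card_multiples: "finite S \<Longrightarrow> card (multiples n S) \<le> (n + 1) ^ card S"
  using card_image_le[of "S \<rightarrow>\<^sub>E {..n}" "\<lambda>m. \<Sum>g\<in>S. \<Sum>i<m g. g"]
  by (simp add: multiples_def finite_PiE card_PiE)

lemma ZF_sum: "(\<And>i. i \<in> I \<Longrightarrow> f i \<in> ZF k) \<Longrightarrow> sum f I \<in> ZF k"
  by (induction I rule: infinite_finite_induct) (auto intro: ZF_add ZF_zero)

lemma multiples_ZF: "S \<subseteq> ZF k \<Longrightarrow> multiples n S \<subseteq> ZF k"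
  by (auto simp: multiples_def intro!: ZF_sum)

lemma iterated_square_supported:
  assumes "x \<in> supported S" "finite S"
  shows "((\<lambda>y. y * y) ^^ m) x \<in> supported (multiples (2 ^ m) S)"
proof (induction m)
  case 0
  then show ?case
    using assms supported_mono[OF assms(1) multiples_one] by (simp add: finite_multiples)
next
  case (Suc m)
  have sub: "(\<lambda>(g, h). g + h) ` (multiples (2 ^ m) S \<times> multiples (2 ^ m) S) \<subseteq> multiples (2 ^ Suc m) S"
    using multiples_add[of _ "2 ^ m" S _ "2 ^ m"] by (auto simp: mult_2)
  show ?case
    using supported_mono[OF supported_mult[OF Suc Suc] sub] assms by (simp add: finite_multiples)
qed

theorem isometric:
  assumes gen: "generates_cstar (s ` arr \<Lambda>)"
    and fourier: "\<And>S f h. finite S \<Longrightarrow> S \<subseteq> ZF k \<Longrightarrow> (\<And>g. g \<in> S \<Longrightarrow> f g \<in> cspan (B.graded g)) \<Longrightarrow>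
      h \<in> S \<Longrightarrow> norm (f h) \<le> norm (sum f S)"
  shows "norm (\<pi> x) = norm x"
proof -
  \<comment> \<open>Triangle inequality for the components in \<open>'a\<close>, isometry of \<pi>
    on each, and the Fourier bound in \<open>'b\<close>: the only loss is the number of
    degrees.\<close>
  have bound: "norm x \<le> real (card S) * norm (\<pi> x)"
    if S: "finite S" "S \<subseteq> ZF k" and x: "x \<in> supported S" for S x
  proof -
    obtain f where f: "\<forall>g\<in>S. f g \<in> cspan (A.graded g)" "x = sum f S"
      using x by (auto simp: supported_def)
    have "norm (f g) \<le> norm (\<pi> x)" if "g \<in> S" for g
      using fourier[of S "\<lambda>g. \<pi> (f g)" g] f S that graded_image graded_isometric[of "f g" g]
      by (simp add: homD)
    then have "norm (sum f S) \<le> (\<Sum>g\<in>S. norm (\<pi> x))"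
      by (intro sum_norm_le)
    then show ?thesis
      by (simp add: f)
  qed
  have "norm (\<pi> x) = norm x" if "x \<in> dense_part" for x
  proof -
    have "adj x * x \<in> dense_part"
      using that star_subalgebra_dense_part by (simp add: star_subalgebra_def)
    then obtain S where S: "finite S" "S \<subseteq> ZF k" "adj x * x \<in> supported S"
      by (auto simp: dense_part_def)
    show ?thesis
    proof (rule star_hom_norm_eq_if_polynomial_growth[OF hom])
      fix m
      let ?y = "((\<lambda>y. y * y) ^^ m) (adj x * x)"
      have "norm ?y \<le> real (card (multiples (2 ^ m) S)) * norm (\<pi> ?y)"
        using S by (intro bound finite_multiples multiples_ZF iterated_square_supported)
      also have "\<dots> \<le> real ((2 ^ m + 1) ^ card S) * norm (\<pi> ?y)"
        using S by (intro mult_right_mono of_nat_mono card_multiples) auto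
      finally show "norm ?y \<le> 1 * (2 ^ m + 1) ^ card S * norm (\<pi> ?y)"
        by (simp add: add.commute)
    qed
  qed
  then have "dense_part \<subseteq> {x. norm (\<pi> x) = norm x}" by blast
  moreover have "closed {x. norm (\<pi> x) = norm x}"
    by (intro closed_Collect_eq continuous_on_norm continuous_on_id
        bounded_linear.continuous_on[OF star_hom_bounded_linear[OF hom]])
  ultimately have "closure dense_part \<subseteq> {x. norm (\<pi> x) = norm x}"
    by (rule closure_minimal)
  moreover have "closure dense_part = UNIV"
    using gen s_in_dense_part closure_subset star_subalgebra_closure[OF star_subalgebra_dense_part]
    unfolding generates_cstar_def by (metis closed_closure image_subsetI subset_trans)
  ultimately show ?thesis by auto
qed

end

section \<open>Square-summable functions\<close>

lemma summable_on_comparison: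
  fixes f :: "'x \<Rightarrow> 'b::banach" and g :: "'x \<Rightarrow> real"
  assumes "g summable_on A" "\<And>x. x \<in> A \<Longrightarrow> norm (f x) \<le> g x"
  shows "f summable_on A"
proof (rule abs_summable_summable, rule nonneg_bdd_above_summable_on)
  show "bdd_above (sum (\<lambda>x. norm (f x)) ` {F. F \<subseteq> A \<and> finite F})"
  proof (rule bdd_aboveI2)
    fix F assume F: "F \<in> {F. F \<subseteq> A \<and> finite F}"
    then have "(\<Sum>x\<in>F. norm (f x)) \<le> sum g F"
      by (intro sum_mono assms(2)) auto
    also have "\<dots> \<le> infsum g A"
      using F assms order_trans[OF norm_ge_zero assms(2)] by (intro finite_sum_le_infsum) auto
    finally show "(\<Sum>x\<in>F. norm (f x)) \<le> infsum g A" .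
  qed
qed auto

typedef 'x ell2 = "{f :: 'x \<Rightarrow> complex. (\<lambda>x. (cmod (f x))\<^sup>2) summable_on UNIV}"
  by (intro exI[of _ "\<lambda>_. 0"]) simp

setup_lifting type_definition_ell2

lemma ell2_summable: "(\<lambda>x. (cmod (Rep_ell2 f x))\<^sup>2) summable_on UNIV"
  using Rep_ell2[of f] by simp

lemma norm_add_square_le: "(norm (a + b))\<^sup>2 \<le> 2 * (norm a)\<^sup>2 + 2 * (norm (b :: 'v::real_normed_vector))\<^sup>2"
proof -
  have "(norm (a + b))\<^sup>2 \<le> (norm a + norm b)\<^sup>2"
    by (intro power_mono norm_triangle_ineq) auto
  also have "\<dots> \<le> 2 * (norm a)\<^sup>2 + 2 * (norm b)\<^sup>2"
    using zero_le_power2[of "norm a - norm b"] by (simp add: power2_sum power2_diff)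
  finally show ?thesis .
qed

instantiation ell2 :: (type) "{zero, plus, uminus, minus, scaleR}"
begin

lift_definition zero_ell2 :: "'a ell2" is "\<lambda>_. 0" by simp

lift_definition plus_ell2 :: "'a ell2 \<Rightarrow> 'a ell2 \<Rightarrow> 'a ell2" is "\<lambda>f g x. f x + g x"
proof -
  fix f g :: "'a \<Rightarrow> complex"
  assume "(\<lambda>x. (cmod (f x))\<^sup>2) summable_on UNIV" "(\<lambda>x. (cmod (g x))\<^sup>2) summable_on UNIV"
  then have "(\<lambda>x. 2 * (cmod (f x))\<^sup>2 + 2 * (cmod (g x))\<^sup>2) summable_on UNIV"
    by (intro summable_on_add summable_on_cmult_right)
  then show "(\<lambda>x. (cmod (f x + g x))\<^sup>2) summable_on UNIV"
    by (rule summable_on_comparison) (simp add: norm_add_square_le)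
qed

lift_definition uminus_ell2 :: "'a ell2 \<Rightarrow> 'a ell2" is "\<lambda>f x. - f x" by simp

definition minus_ell2 :: "'a ell2 \<Rightarrow> 'a ell2 \<Rightarrow> 'a ell2" where "f - g = f + - (g :: 'a ell2)"

lift_definition scaleR_ell2 :: "real \<Rightarrow> 'a ell2 \<Rightarrow> 'a ell2" is "\<lambda>r f x. r *\<^sub>R f x"
  by (simp add: power_mult_distrib summable_on_cmult_right)

instance ..

end

lift_definition cmult_ell2 :: "complex \<Rightarrow> 'x ell2 \<Rightarrow> 'x ell2" is "\<lambda>z f x. z * f x"
  by (simp add: norm_mult power_mult_distrib summable_on_cmult_right)

lemma Rep_ell2_simps:
  "Rep_ell2 (f + g) x = Rep_ell2 f x + Rep_ell2 g x" "Rep_ell2 (f - g) x = Rep_ell2 f x - Rep_ell2 g x"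
  "Rep_ell2 (- f) x = - Rep_ell2 f x" "Rep_ell2 0 x = 0" "Rep_ell2 (r *\<^sub>R f) x = r *\<^sub>R Rep_ell2 f x"
  "Rep_ell2 (cmult_ell2 z f) x = z * Rep_ell2 f x"
  by (simp_all add: plus_ell2.rep_eq minus_ell2_def uminus_ell2.rep_eq zero_ell2.rep_eq
      scaleR_ell2.rep_eq cmult_ell2.rep_eq)

lemma ell2_eqI: "(\<And>x. Rep_ell2 f x = Rep_ell2 g x) \<Longrightarrow> f = g"
  by (simp add: fun_eq_iff flip: Rep_ell2_inject)

instance ell2 :: (type) real_vector
  by standard (rule ell2_eqI, simp add: Rep_ell2_simps algebra_simps)+

lemma ell2_inner_summable: "(\<lambda>x. inner (Rep_ell2 f x) (Rep_ell2 g x)) summable_on UNIV"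
proof (rule summable_on_comparison)
  show "(\<lambda>x. (cmod (Rep_ell2 f x))\<^sup>2 + (cmod (Rep_ell2 g x))\<^sup>2) summable_on UNIV"
    by (intro summable_on_add ell2_summable)
  fix x
  have "\<bar>inner (Rep_ell2 f x) (Rep_ell2 g x)\<bar> \<le> cmod (Rep_ell2 f x) * cmod (Rep_ell2 g x)"
    by (rule Cauchy_Schwarz_ineq2)
  moreover have "2 * (cmod (Rep_ell2 f x) * cmod (Rep_ell2 g x)) \<le> (cmod (Rep_ell2 f x))\<^sup>2 + (cmod (Rep_ell2 g x))\<^sup>2"
    using sum_squares_bound[of "cmod (Rep_ell2 f x)" "cmod (Rep_ell2 g x)"] by simp
  moreover have "0 \<le> cmod (Rep_ell2 f x) * cmod (Rep_ell2 g x)"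
    by simp
  ultimately show "norm (inner (Rep_ell2 f x) (Rep_ell2 g x)) \<le> (cmod (Rep_ell2 f x))\<^sup>2 + (cmod (Rep_ell2 g x))\<^sup>2"
    unfolding real_norm_def by linarith
qed

instantiation ell2 :: (type) real_inner
begin

text \<open>The real part of the usual complex inner product. Complex-linear operators have the same
  adjoints for both, so the complex scalars can be kept apart, as the operators
  \<open>cmult_ell2 z\<close>.\<close>

definition inner_ell2 :: "'a ell2 \<Rightarrow> 'a ell2 \<Rightarrow> real" where
  "inner_ell2 f g = (\<Sum>\<^sub>\<infinity>x. inner (Rep_ell2 f x) (Rep_ell2 g x))"

definition norm_ell2 :: "'a ell2 \<Rightarrow> real" where "norm_ell2 f = sqrt (inner f f)"

definition dist_ell2 :: "'a ell2 \<Rightarrow> 'a ell2 \<Rightarrow> real" where "dist_ell2 f g = norm (f - g)"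

definition sgn_ell2 :: "'a ell2 \<Rightarrow> 'a ell2" where "sgn_ell2 f = inverse (norm f) *\<^sub>R f"

definition uniformity_ell2 :: "('a ell2 \<times> 'a ell2) filter" where
  "uniformity_ell2 = (INF e\<in>{0 <..}. principal {(x, y). dist x y < e})"

definition open_ell2 :: "'a ell2 set \<Rightarrow> bool" where
  "open_ell2 S \<longleftrightarrow> (\<forall>x\<in>S. \<forall>\<^sub>F (x', y) in uniformity. x' = x \<longrightarrow> y \<in> S)"

instance
proof
  fix f g h :: "'a ell2" and r :: real
  show "inner f g = inner g f"
    by (simp add: inner_ell2_def inner_commute)
  show "inner (f + g) h = inner f h + inner g h"
    by (simp add: inner_ell2_def Rep_ell2_simps inner_add_left infsum_add ell2_inner_summable)
  show "inner (r *\<^sub>R f) g = r * inner f g"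
    by (simp add: inner_ell2_def Rep_ell2_simps infsum_cmult_right ell2_inner_summable)
  show "0 \<le> inner f f"
    by (simp add: inner_ell2_def infsum_nonneg)
  show "inner f f = 0 \<longleftrightarrow> f = 0"
  proof
    assume "inner f f = 0"
    then have "inner (Rep_ell2 f x) (Rep_ell2 f x) = 0" for x
      unfolding inner_ell2_def by (rule_tac nonneg_infsum_le_0D[OF _ ell2_inner_summable]) auto
    then show "f = 0"
      by (intro ell2_eqI) (simp add: Rep_ell2_simps)
  qed (simp add: inner_ell2_def Rep_ell2_simps)
qed (simp_all add: norm_ell2_def dist_ell2_def sgn_ell2_def uniformity_ell2_def open_ell2_def)

end

lemma ell2_norm_square: "(norm f)\<^sup>2 = (\<Sum>\<^sub>\<infinity>x. (cmod (Rep_ell2 f x))\<^sup>2)"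
  by (simp add: power2_norm_eq_inner) (simp add: inner_ell2_def)

lemma ell2_sum_le_norm_square: "finite F \<Longrightarrow> (\<Sum>x\<in>F. (cmod (Rep_ell2 f x))\<^sup>2) \<le> (norm f)\<^sup>2"
  unfolding ell2_norm_square by (intro finite_sum_le_infsum ell2_summable) auto

lemma ell2_component_le_norm: "cmod (Rep_ell2 f x) \<le> norm f"
  by (rule power2_le_imp_le) (use ell2_sum_le_norm_square[of "{x}" f] in auto)

lemma ell2_norm_square_le:
  assumes "\<And>F. finite F \<Longrightarrow> (\<Sum>x\<in>F. (cmod (f x))\<^sup>2) \<le> K"
  shows "(\<lambda>x. (cmod (f x))\<^sup>2) summable_on UNIV" "(\<Sum>\<^sub>\<infinity>x. (cmod (f x))\<^sup>2) \<le> K"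
proof -
  show "(\<lambda>x. (cmod (f x))\<^sup>2) summable_on UNIV"
    using assms by (intro nonneg_bdd_above_summable_on bdd_aboveI2[of _ _ K]) auto
  then show "(\<Sum>\<^sub>\<infinity>x. (cmod (f x))\<^sup>2) \<le> K"
    using assms by (intro infsum_le_finite_sums) auto
qed

instance ell2 :: (type) banach
proof
  fix X :: "nat \<Rightarrow> 'a ell2"
  assume X: "Cauchy X"
  have "Cauchy (\<lambda>n. Rep_ell2 (X n) x)" for x
  proof (rule CauchyI)
    fix e :: real assume "e > 0"
    then obtain N where N: "\<And>m n. m \<ge> N \<Longrightarrow> n \<ge> N \<Longrightarrow> norm (X m - X n) < e"
      using CauchyD[OF X] by blast
    have "norm (Rep_ell2 (X m) x - Rep_ell2 (X n) x) < e" if "m \<ge> N" "n \<ge> N" for m n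
      using ell2_component_le_norm[of "X m - X n" x] N[OF that] by (simp add: Rep_ell2_simps)
    then show "\<exists>M. \<forall>m\<ge>M. \<forall>n\<ge>M. norm (Rep_ell2 (X m) x - Rep_ell2 (X n) x) < e"
      by blast
  qed
  then have "\<exists>l. (\<lambda>n. Rep_ell2 (X n) x) \<longlonglongrightarrow> l" for x
    using Cauchy_convergent_iff convergent_def by blast
  then obtain l where l: "\<And>x. (\<lambda>n. Rep_ell2 (X n) x) \<longlonglongrightarrow> l x"
    by metis
  \<comment> \<open>The Cauchy estimate is passed to the limit on finite sets, so that no limit is
    exchanged with an infinite sum.\<close>
  have bound: "(\<Sum>x\<in>F. (cmod (Rep_ell2 (X m) x - l x))\<^sup>2) \<le> e\<^sup>2"
    if N: "\<And>m n. m \<ge> N \<Longrightarrow> n \<ge> N \<Longrightarrow> norm (X m - X n) < e" and "m \<ge> N" "finite F" for e N m F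
  proof (rule tendsto_le)
    show "(\<lambda>n. \<Sum>x\<in>F. (cmod (Rep_ell2 (X m) x - Rep_ell2 (X n) x))\<^sup>2) \<longlonglongrightarrow>
        (\<Sum>x\<in>F. (cmod (Rep_ell2 (X m) x - l x))\<^sup>2)"
      by (intro tendsto_intros l)
    show "\<forall>\<^sub>F n in sequentially. (\<Sum>x\<in>F. (cmod (Rep_ell2 (X m) x - Rep_ell2 (X n) x))\<^sup>2) \<le> e\<^sup>2"
    proof (rule eventually_sequentiallyI)
      fix n assume "n \<ge> N"
      have "(\<Sum>x\<in>F. (cmod (Rep_ell2 (X m) x - Rep_ell2 (X n) x))\<^sup>2) \<le> (norm (X m - X n))\<^sup>2"
        using ell2_sum_le_norm_square[OF \<open>finite F\<close>, of "X m - X n"] by (simp add: Rep_ell2_simps)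
      also have "\<dots> \<le> e\<^sup>2"
        using N[OF \<open>m \<ge> N\<close> \<open>n \<ge> N\<close>] by (intro power_mono) auto
      finally show "(\<Sum>x\<in>F. (cmod (Rep_ell2 (X m) x - Rep_ell2 (X n) x))\<^sup>2) \<le> e\<^sup>2" .
    qed
  qed auto
  obtain N where N: "\<And>m n. m \<ge> N \<Longrightarrow> n \<ge> N \<Longrightarrow> norm (X m - X n) < 1"
    using CauchyD[OF X, of 1] by auto
  \<comment> \<open>The pointwise limit is square-summable because it differs from
    \<open>X N\<close> by a square-summable function.\<close>
  have "(\<lambda>x. (cmod (Rep_ell2 (X N) x - l x))\<^sup>2) summable_on UNIV"
  proof (rule ell2_norm_square_le(1))
    show "(\<Sum>x\<in>F. (cmod (Rep_ell2 (X N) x - l x))\<^sup>2) \<le> 1\<^sup>2" if "finite F" for F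
      using bound[of N 1 N F] N that by simp
  qed
  moreover define d where "d = Abs_ell2 (\<lambda>x. Rep_ell2 (X N) x - l x)"
  ultimately have d: "Rep_ell2 d x = Rep_ell2 (X N) x - l x" for x
    by (simp add: Abs_ell2_inverse)
  define L where "L = X N - d"
  have L: "Rep_ell2 L x = l x" for x
    by (simp add: L_def Rep_ell2_simps d)
  have "X \<longlonglongrightarrow> L"
  proof (rule LIMSEQ_I)
    fix e :: real assume "e > 0"
    then obtain N where N: "\<And>m n. m \<ge> N \<Longrightarrow> n \<ge> N \<Longrightarrow> norm (X m - X n) < e / 2"
      using CauchyD[OF X, of "e / 2"] by auto
    have "norm (X m - L) < e" if "m \<ge> N" for m
    proof -
      have "(norm (X m - L))\<^sup>2 \<le> (e / 2)\<^sup>2"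
        unfolding ell2_norm_square Rep_ell2_simps L
      proof (rule ell2_norm_square_le(2))
        show "(\<Sum>x\<in>F. (cmod (Rep_ell2 (X m) x - l x))\<^sup>2) \<le> (e / 2)\<^sup>2" if "finite F" for F
          using bound[of N "e / 2" m F] N \<open>m \<ge> N\<close> that by blast
      qed
      then have "norm (X m - L) \<le> e / 2"
        by (rule power2_le_imp_le) (use \<open>e > 0\<close> in simp)
      with \<open>e > 0\<close> show ?thesis by simp
    qed
    then show "\<exists>no. \<forall>n\<ge>no. norm (X n - L) < e" by blast
  qed
  then show "convergent X"
    by (auto simp: convergent_def)
qed

lemma norm_cmult_ell2: "norm (cmult_ell2 z f) = cmod z * norm f"
proof -
  have "(norm (cmult_ell2 z f))\<^sup>2 = (cmod z * norm f)\<^sup>2"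
    by (simp add: ell2_norm_square Rep_ell2_simps norm_mult power_mult_distrib infsum_cmult_right ell2_summable)
  then show ?thesis
    by (rule power2_eq_imp_eq) auto
qed

lemma inner_cmult_ell2: "inner (cmult_ell2 z f) g = inner f (cmult_ell2 (cnj z) g)"
  by (simp add: inner_ell2_def Rep_ell2_simps inner_complex_def algebra_simps)

section \<open>Adjointable operators on square-summable functions\<close>

lift_definition cmult_blinfun :: "complex \<Rightarrow> 'x ell2 \<Rightarrow>\<^sub>L 'x ell2" is cmult_ell2
proof (rule bounded_linear_intro)
  fix z :: complex and f g :: "'x ell2" and r :: real
  show "cmult_ell2 z (f + g) = cmult_ell2 z f + cmult_ell2 z g"
    "cmult_ell2 z (r *\<^sub>R f) = r *\<^sub>R cmult_ell2 z f"
    by (rule ell2_eqI, simp add: Rep_ell2_simps distrib_left)+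
  show "norm (cmult_ell2 z f) \<le> norm f * cmod z"
    by (simp add: norm_cmult_ell2)
qed

definition ell2_linear :: "('x ell2 \<Rightarrow>\<^sub>L 'x ell2) \<Rightarrow> bool" where
  "ell2_linear T \<longleftrightarrow> (\<forall>z f. blinfun_apply T (cmult_ell2 z f) = cmult_ell2 z (blinfun_apply T f))"

definition ell2_adjoint :: "('x ell2 \<Rightarrow>\<^sub>L 'x ell2) \<Rightarrow> ('x ell2 \<Rightarrow>\<^sub>L 'x ell2) \<Rightarrow> bool" where
  "ell2_adjoint T S \<longleftrightarrow> (\<forall>f g. inner (blinfun_apply T f) g = inner f (blinfun_apply S g))"

lemma ell2_adjoint_sym: "ell2_adjoint T S \<Longrightarrow> ell2_adjoint S T"
  unfolding ell2_adjoint_def by (metis inner_commute)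

lemma ell2_adjointD:
  "ell2_adjoint T S \<Longrightarrow> inner f (blinfun_apply S g) = inner (blinfun_apply T f) g"
  by (simp only: ell2_adjoint_def)

lemma ell2_linearD: "ell2_linear T \<Longrightarrow> blinfun_apply T (cmult_ell2 z f) = cmult_ell2 z (blinfun_apply T f)"
  by (simp only: ell2_linear_def)

lemma inner_eqI: "(\<And>f. inner f a = inner f b) \<Longrightarrow> a = (b :: 'v::real_inner)"
  using inner_eq_zero_iff[of "a - b"] by (simp add: inner_diff_right)

lemma ell2_adjoint_unique: "ell2_adjoint T S \<Longrightarrow> ell2_adjoint T S' \<Longrightarrow> S = S'"
  by (rule blinfun_eqI, rule inner_eqI) (simp only: ell2_adjointD)

lemma ell2_adjoint_linear:
  assumes "ell2_adjoint T S" "ell2_linear T"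
  shows "ell2_linear S"
  unfolding ell2_linear_def
proof (intro allI, rule inner_eqI)
  fix z f g
  have "inner g (blinfun_apply S (cmult_ell2 z f)) = inner (blinfun_apply T g) (cmult_ell2 z f)"
    by (rule ell2_adjointD[OF assms(1)])
  also have "\<dots> = inner (blinfun_apply T (cmult_ell2 (cnj z) g)) f"
    by (simp add: ell2_linearD[OF assms(2)] inner_cmult_ell2)
  also have "\<dots> = inner (cmult_ell2 (cnj z) g) (blinfun_apply S f)"
    by (rule ell2_adjointD[OF assms(1), symmetric])
  also have "\<dots> = inner g (cmult_ell2 z (blinfun_apply S f))"
    by (simp add: inner_cmult_ell2)
  finally show "inner g (blinfun_apply S (cmult_ell2 z f)) = inner g (cmult_ell2 z (blinfun_apply S f))" .
qed

lemma ell2_adjoint_norm_le: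
  assumes "ell2_adjoint T S"
  shows "norm S \<le> norm T"
proof (rule norm_blinfun_bound)
  fix g
  have "norm (blinfun_apply S g) * norm (blinfun_apply S g) = inner (blinfun_apply T (blinfun_apply S g)) g"
    by (simp add: power2_norm_eq_inner ell2_adjointD[OF assms] flip: power2_eq_square)
  also have "\<dots> \<le> norm (blinfun_apply T (blinfun_apply S g)) * norm g"
    by (rule norm_cauchy_schwarz)
  also have "\<dots> \<le> norm T * norm (blinfun_apply S g) * norm g"
    by (intro mult_right_mono norm_blinfun) auto
  finally have "norm (blinfun_apply S g) * norm (blinfun_apply S g) \<le>
      norm (blinfun_apply S g) * (norm T * norm g)"
    by (simp add: mult_ac)
  then show "norm (blinfun_apply S g) \<le> norm T * norm g"
    by (cases "norm (blinfun_apply S g) = 0") (auto simp: mult_le_cancel_left)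
qed auto

text \<open>Existence of an adjoint is built into the type, so none has to be produced from bounded
  functionals; the operators used later come with an explicit one.\<close>

typedef 'x ell2_op = "{T :: 'x ell2 \<Rightarrow>\<^sub>L 'x ell2. ell2_linear T \<and> (\<exists>S. ell2_adjoint T S)}"
  by (intro exI[of _ 0]) (auto simp: ell2_linear_def ell2_adjoint_def Rep_ell2_simps
      intro!: exI[of _ 0] ell2_eqI)

setup_lifting type_definition_ell2_op

lemma cmult_ell2_simps:
  "cmult_ell2 z (f + g) = cmult_ell2 z f + cmult_ell2 z g"
  "cmult_ell2 z (f - g) = cmult_ell2 z f - cmult_ell2 z g"
  "cmult_ell2 z (- f) = - cmult_ell2 z f" "cmult_ell2 z 0 = 0"
  "cmult_ell2 z (r *\<^sub>R f) = r *\<^sub>R cmult_ell2 z f"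
  "cmult_ell2 z (cmult_ell2 w f) = cmult_ell2 (z * w) f"
  "cmult_ell2 (z + w) f = cmult_ell2 z f + cmult_ell2 w f"
  "cmult_ell2 (complex_of_real r) f = r *\<^sub>R f"
  by (rule ell2_eqI, simp add: Rep_ell2_simps algebra_simps scaleR_conv_of_real)+

lemma blinfun_apply_cmult: "blinfun_apply (cmult_blinfun z) f = cmult_ell2 z f"
  by (simp add: cmult_blinfun.rep_eq)

instantiation ell2_op :: (type) "{zero, plus, uminus, minus, scaleR, times}"
begin

lift_definition zero_ell2_op :: "'a ell2_op" is 0
  by (auto simp: ell2_linear_def ell2_adjoint_def cmult_ell2_simps intro!: exI[of _ 0])

lift_definition plus_ell2_op :: "'a ell2_op \<Rightarrow> 'a ell2_op \<Rightarrow> 'a ell2_op" is "(+)"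
proof safe
  fix T T' S S' :: "'a ell2 \<Rightarrow>\<^sub>L 'a ell2"
  assume "ell2_linear T" "ell2_linear T'" "ell2_adjoint T S" "ell2_adjoint T' S'"
  then show "ell2_linear (T + T')" "\<exists>R. ell2_adjoint (T + T') R"
    by (auto simp: ell2_linear_def ell2_adjoint_def blinfun.bilinear_simps cmult_ell2_simps
        inner_add_left inner_add_right intro!: exI[of _ "S + S'"])
qed

lift_definition uminus_ell2_op :: "'a ell2_op \<Rightarrow> 'a ell2_op" is uminus
proof safe
  fix T S :: "'a ell2 \<Rightarrow>\<^sub>L 'a ell2"
  assume "ell2_linear T" "ell2_adjoint T S"
  then show "ell2_linear (- T)" "\<exists>R. ell2_adjoint (- T) R"
    by (auto simp: ell2_linear_def ell2_adjoint_def blinfun.bilinear_simps cmult_ell2_simps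
        intro!: exI[of _ "- S"])
qed

definition minus_ell2_op :: "'a ell2_op \<Rightarrow> 'a ell2_op \<Rightarrow> 'a ell2_op" where
  "T - S = T + - (S :: 'a ell2_op)"

lift_definition scaleR_ell2_op :: "real \<Rightarrow> 'a ell2_op \<Rightarrow> 'a ell2_op" is scaleR
proof safe
  fix T S :: "'a ell2 \<Rightarrow>\<^sub>L 'a ell2" and r :: real
  assume "ell2_linear T" "ell2_adjoint T S"
  then show "ell2_linear (r *\<^sub>R T)" "\<exists>R. ell2_adjoint (r *\<^sub>R T) R"
    by (auto simp: ell2_linear_def ell2_adjoint_def blinfun.bilinear_simps cmult_ell2_simps
        intro!: exI[of _ "r *\<^sub>R S"])
qed

lift_definition times_ell2_op :: "'a ell2_op \<Rightarrow> 'a ell2_op \<Rightarrow> 'a ell2_op" is blinfun_compose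
proof safe
  fix T T' S S' :: "'a ell2 \<Rightarrow>\<^sub>L 'a ell2"
  assume "ell2_linear T" "ell2_linear T'" "ell2_adjoint T S" "ell2_adjoint T' S'"
  then show "ell2_linear (T o\<^sub>L T')" "\<exists>R. ell2_adjoint (T o\<^sub>L T') R"
    by (auto simp: ell2_linear_def ell2_adjoint_def intro!: exI[of _ "S' o\<^sub>L S"])
qed

instance ..

end

definition apply_op :: "'x ell2_op \<Rightarrow> 'x ell2 \<Rightarrow> 'x ell2" where
  "apply_op T = blinfun_apply (Rep_ell2_op T)"

lemma ell2_op_eqI: "(\<And>f. apply_op T f = apply_op S f) \<Longrightarrow> T = S"
  by (simp add: apply_op_def blinfun_eqI flip: Rep_ell2_op_inject)

lemma apply_op_simps:
  "apply_op 0 f = 0" "apply_op (T + S) f = apply_op T f + apply_op S f" "apply_op (- T) f = - apply_op T f"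
  "apply_op (T - S) f = apply_op T f - apply_op S f" "apply_op (r *\<^sub>R T) f = r *\<^sub>R apply_op T f"
  "apply_op (T * S) f = apply_op T (apply_op S f)"
  by (simp_all add: apply_op_def minus_ell2_op_def plus_ell2_op.rep_eq zero_ell2_op.rep_eq
      uminus_ell2_op.rep_eq scaleR_ell2_op.rep_eq times_ell2_op.rep_eq blinfun.bilinear_simps)

lemma apply_op_linear:
  "apply_op T (f + g) = apply_op T f + apply_op T g" "apply_op T (f - g) = apply_op T f - apply_op T g"
  "apply_op T (- f) = - apply_op T f"
  "apply_op T 0 = 0" "apply_op T (r *\<^sub>R f) = r *\<^sub>R apply_op T f"
  "apply_op T (cmult_ell2 z f) = cmult_ell2 z (apply_op T f)"
  using Rep_ell2_op[of T] by (simp_all add: apply_op_def blinfun.bilinear_simps ell2_linear_def)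

instance ell2_op :: (type) real_algebra
  by standard (rule ell2_op_eqI, simp add: apply_op_simps apply_op_linear algebra_simps)+

instantiation ell2_op :: (type) real_normed_algebra
begin

definition norm_ell2_op :: "'a ell2_op \<Rightarrow> real" where "norm_ell2_op T = norm (Rep_ell2_op T)"

definition dist_ell2_op :: "'a ell2_op \<Rightarrow> 'a ell2_op \<Rightarrow> real" where "dist_ell2_op T S = norm (T - S)"

definition sgn_ell2_op :: "'a ell2_op \<Rightarrow> 'a ell2_op" where "sgn_ell2_op T = inverse (norm T) *\<^sub>R T"

definition uniformity_ell2_op :: "('a ell2_op \<times> 'a ell2_op) filter" where
  "uniformity_ell2_op = (INF e\<in>{0 <..}. principal {(x, y). dist x y < e})"

definition open_ell2_op :: "'a ell2_op set \<Rightarrow> bool" where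
  "open_ell2_op S \<longleftrightarrow> (\<forall>x\<in>S. \<forall>\<^sub>F (x', y) in uniformity. x' = x \<longrightarrow> y \<in> S)"

instance
proof
  fix T S :: "'a ell2_op" and r :: real
  show "norm T = 0 \<longleftrightarrow> T = 0"
    using Rep_ell2_op_inject[of T 0] by (simp add: norm_ell2_op_def zero_ell2_op.rep_eq)
  show "norm (T + S) \<le> norm T + norm S"
    by (simp add: norm_ell2_op_def plus_ell2_op.rep_eq norm_triangle_ineq)
  show "norm (r *\<^sub>R T) = \<bar>r\<bar> * norm T"
    by (simp add: norm_ell2_op_def scaleR_ell2_op.rep_eq)
  show "norm (T * S) \<le> norm T * norm S"
    by (simp add: norm_ell2_op_def times_ell2_op.rep_eq norm_blinfun_compose)
qed (simp_all add: dist_ell2_op_def sgn_ell2_op_def uniformity_ell2_op_def open_ell2_op_def)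

end

lemma norm_apply_op: "norm (apply_op T f) \<le> norm T * norm f"
  by (simp add: apply_op_def norm_ell2_op_def norm_blinfun)

lemma norm_ell2_op_bound: "0 \<le> b \<Longrightarrow> (\<And>f. norm (apply_op T f) \<le> b * norm f) \<Longrightarrow> norm T \<le> b"
  by (simp add: apply_op_def norm_ell2_op_def norm_blinfun_bound)

lemma ell2_adjoint_The: "ell2_adjoint T S \<Longrightarrow> (THE R. ell2_adjoint T R) = S"
  by (rule the_equality) (simp_all add: ell2_adjoint_unique)

lift_definition adjoint_op :: "'x ell2_op \<Rightarrow> 'x ell2_op" is "\<lambda>T. THE S. ell2_adjoint T S"
proof safe
  fix T S :: "'x ell2 \<Rightarrow>\<^sub>L 'x ell2"
  assume T: "ell2_linear T" "ell2_adjoint T S"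
  show "ell2_linear (THE S. ell2_adjoint T S)" "\<exists>R. ell2_adjoint (THE S. ell2_adjoint T S) R"
    using T ell2_adjoint_linear[OF T(2,1)] ell2_adjoint_sym[OF T(2)]
    by (auto simp: ell2_adjoint_The)
qed

lemma Rep_adjoint_op: "ell2_adjoint (Rep_ell2_op T) (Rep_ell2_op (adjoint_op T))"
proof -
  obtain S where "ell2_adjoint (Rep_ell2_op T) S"
    using Rep_ell2_op[of T] by auto
  then show ?thesis
    by (simp add: adjoint_op.rep_eq ell2_adjoint_The)
qed

lemma inner_adjoint_op: "inner (apply_op T f) g = inner f (apply_op (adjoint_op T) g)"
  using Rep_adjoint_op[of T] by (simp add: ell2_adjoint_def apply_op_def)

lemma adjoint_op_eqI:
  assumes "\<And>f g. inner (apply_op T f) g = inner f (apply_op S g)"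
  shows "adjoint_op T = S"
  by (rule ell2_op_eqI, rule inner_eqI) (simp flip: inner_adjoint_op assms)

lemma norm_adjoint_op_le: "norm (adjoint_op T) \<le> norm T"
  using ell2_adjoint_norm_le[OF Rep_adjoint_op] by (simp add: norm_ell2_op_def)

lemma adjoint_op_diff: "adjoint_op (T - S) = adjoint_op T - adjoint_op S"
  by (rule adjoint_op_eqI) (simp add: apply_op_simps inner_diff_left inner_diff_right inner_adjoint_op)

text \<open>Taking adjoints does not increase norms, so the adjoints of a Cauchy sequence converge
  too, and their limit is an adjoint of the limit operator.\<close>

instance ell2_op :: (type) banach
proof
  fix X :: "nat \<Rightarrow> 'a ell2_op"
  assume X: "Cauchy X"
  have Rep_diff: "Rep_ell2_op T - Rep_ell2_op S = Rep_ell2_op (T - S)" for T S :: "'a ell2_op"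
    unfolding minus_ell2_op_def plus_ell2_op.rep_eq uminus_ell2_op.rep_eq by simp
  have Cauchy: "Cauchy (\<lambda>n. Rep_ell2_op (g (X n)))"
    if "\<And>T S :: 'a ell2_op. norm (g T - g S) \<le> norm (T - S)" for g :: "'a ell2_op \<Rightarrow> 'a ell2_op"
  proof -
    have le: "norm (Rep_ell2_op (g T) - Rep_ell2_op (g S)) \<le> norm (T - S)" for T S
      using that[of T S] by (simp add: Rep_diff norm_ell2_op_def)
    with X show ?thesis
      unfolding Cauchy_iff by (meson order_le_less_trans)
  qed
  have "convergent (\<lambda>n. Rep_ell2_op (X n))" "convergent (\<lambda>n. Rep_ell2_op (adjoint_op (X n)))"
    using Cauchy[of "\<lambda>T. T"] Cauchy[of adjoint_op]
    by (simp_all add: Cauchy_convergent norm_adjoint_op_le flip: adjoint_op_diff)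
  then obtain T S where TS: "(\<lambda>n. Rep_ell2_op (X n)) \<longlonglongrightarrow> T" "(\<lambda>n. Rep_ell2_op (adjoint_op (X n))) \<longlonglongrightarrow> S"
    unfolding convergent_def by blast
  note lim = blinfun.tendsto[OF TS(1) tendsto_const]
  have "ell2_linear T"
    unfolding ell2_linear_def
  proof (intro allI)
    fix z f
    have "(\<lambda>n. cmult_ell2 z (apply_op (X n) f)) \<longlonglongrightarrow> cmult_ell2 z (blinfun_apply T f)"
      unfolding blinfun_apply_cmult[symmetric] apply_op_def by (intro blinfun.tendsto tendsto_const TS)
    moreover have "(\<lambda>n. cmult_ell2 z (apply_op (X n) f)) \<longlonglongrightarrow> blinfun_apply T (cmult_ell2 z f)"
      unfolding apply_op_linear(6)[symmetric] unfolding apply_op_def by (rule lim)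
    ultimately show "blinfun_apply T (cmult_ell2 z f) = cmult_ell2 z (blinfun_apply T f)"
      using LIMSEQ_unique by blast
  qed
  moreover have "ell2_adjoint T S"
    unfolding ell2_adjoint_def
  proof (intro allI)
    fix f g
    have "(\<lambda>n. inner (apply_op (X n) f) g) \<longlonglongrightarrow> inner (blinfun_apply T f) g"
      unfolding apply_op_def by (intro tendsto_intros TS)
    moreover have "(\<lambda>n. inner (apply_op (X n) f) g) \<longlonglongrightarrow> inner f (blinfun_apply S g)"
      unfolding inner_adjoint_op unfolding apply_op_def by (intro tendsto_intros TS)
    ultimately show "inner (blinfun_apply T f) g = inner f (blinfun_apply S g)"
      using LIMSEQ_unique by blast
  qed
  ultimately have T: "Rep_ell2_op (Abs_ell2_op T) = T"
    by (intro Abs_ell2_op_inverse) auto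
  have "X \<longlonglongrightarrow> Abs_ell2_op T"
    using TS(1) unfolding LIMSEQ_iff norm_ell2_op_def by (simp add: T flip: Rep_diff)
  then show "convergent X"
    by (auto simp: convergent_def)
qed

instantiation ell2_op :: (type) cstar_algebra
begin

lift_definition scaleC_ell2_op :: "complex \<Rightarrow> 'a ell2_op \<Rightarrow> 'a ell2_op" is "\<lambda>z T. cmult_blinfun z o\<^sub>L T"
proof safe
  fix T S :: "'a ell2 \<Rightarrow>\<^sub>L 'a ell2" and z :: complex
  assume "ell2_linear T" "ell2_adjoint T S"
  then show "ell2_linear (cmult_blinfun z o\<^sub>L T)" "\<exists>R. ell2_adjoint (cmult_blinfun z o\<^sub>L T) R"
    by (auto simp: ell2_linear_def ell2_adjoint_def blinfun_apply_cmult cmult_ell2_simps mult.commute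
        inner_cmult_ell2 intro!: exI[of _ "S o\<^sub>L cmult_blinfun (cnj z)"])
qed

definition adj_ell2_op :: "'a ell2_op \<Rightarrow> 'a ell2_op" where "adj_ell2_op = adjoint_op"

lemma apply_op_scaleC: "apply_op (z *\<^sub>C T) f = cmult_ell2 z (apply_op T f)"
  by (simp add: apply_op_def scaleC_ell2_op.rep_eq blinfun_apply_cmult)

instance
proof
  fix T S :: "'a ell2_op" and r :: real and z w :: complex
  note simps = apply_op_simps apply_op_linear apply_op_scaleC cmult_ell2_simps
  show "r *\<^sub>R T = complex_of_real r *\<^sub>C T" "z *\<^sub>C (T + S) = z *\<^sub>C T + z *\<^sub>C S"
    "(z + w) *\<^sub>C T = z *\<^sub>C T + w *\<^sub>C T" "z *\<^sub>C w *\<^sub>C T = (z * w) *\<^sub>C T"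
    "(z *\<^sub>C T) * S = z *\<^sub>C (T * S)" "T * (z *\<^sub>C S) = z *\<^sub>C (T * S)"
    by (rule ell2_op_eqI, simp add: simps)+
  show "norm (z *\<^sub>C T) = cmod z * norm T"
  proof (rule antisym)
    show "norm (z *\<^sub>C T) \<le> cmod z * norm T"
      by (rule norm_ell2_op_bound)
        (auto simp: simps norm_cmult_ell2 mult.assoc intro!: mult_left_mono norm_apply_op)
    show "cmod z * norm T \<le> norm (z *\<^sub>C T)"
    proof (cases "z = 0")
      case False
      have "norm T \<le> norm (z *\<^sub>C T) / cmod z"
      proof (rule norm_ell2_op_bound)
        fix f
        have "cmod z * norm (apply_op T f) \<le> norm (z *\<^sub>C T) * norm f"
          using norm_apply_op[of "z *\<^sub>C T" f] by (simp add: simps norm_cmult_ell2)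
        then show "norm (apply_op T f) \<le> norm (z *\<^sub>C T) / cmod z * norm f"
          using False by (simp add: field_simps)
      qed auto
      with False show ?thesis by (simp add: field_simps)
    qed simp
  qed
  show "adj (T + S) = adj T + adj S" "adj (z *\<^sub>C T) = cnj z *\<^sub>C adj T" "adj (T * S) = adj S * adj T"
    unfolding adj_ell2_op_def
    by (rule adjoint_op_eqI,
      simp add: simps inner_add_left inner_add_right inner_adjoint_op inner_cmult_ell2)+
  show "adj (adj T) = T"
    unfolding adj_ell2_op_def by (rule adjoint_op_eqI) (metis inner_adjoint_op inner_commute)
  show "norm (adj T * T) = (norm T)\<^sup>2"
  proof (rule antisym)
    have "norm (adj T * T) \<le> norm (adj T) * norm T"
      by (rule norm_mult_ineq)
    also have "\<dots> \<le> norm T * norm T"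
      unfolding adj_ell2_op_def by (intro mult_right_mono norm_adjoint_op_le) auto
    finally show "norm (adj T * T) \<le> (norm T)\<^sup>2"
      by (simp add: power2_eq_square)
    \<comment> \<open>The nontrivial half of the C*-identity: the square of
      \<open>norm (apply_op T f)\<close> is the inner product of \<open>f\<close> with
      \<open>apply_op (adj T * T) f\<close>, to which the Cauchy-Schwarz inequality applies.\<close>
    have "norm T \<le> sqrt (norm (adj T * T))"
    proof (rule norm_ell2_op_bound)
      fix f
      have "(norm (apply_op T f))\<^sup>2 = inner f (apply_op (adj T * T) f)"
        by (simp add: power2_norm_eq_inner inner_adjoint_op adj_ell2_op_def simps)
      also have "\<dots> \<le> norm f * norm (apply_op (adj T * T) f)"
        by (rule norm_cauchy_schwarz)
      also have "\<dots> \<le> norm f * (norm (adj T * T) * norm f)"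
        by (intro mult_left_mono norm_apply_op) auto
      also have "\<dots> = (sqrt (norm (adj T * T)) * norm f)\<^sup>2"
        by (simp add: power_mult_distrib power2_eq_square mult_ac)
      finally show "norm (apply_op T f) \<le> sqrt (norm (adj T * T)) * norm f"
        by (rule power2_le_imp_le) simp
    qed simp
    then have "(norm T)\<^sup>2 \<le> (sqrt (norm (adj T * T)))\<^sup>2"
      by (intro power_mono) auto
    then show "(norm T)\<^sup>2 \<le> norm (adj T * T)"
      by simp
  qed
qed

end

section \<open>Operators given by monomial matrices\<close>

definition monomial :: "('x \<Rightarrow> 'x \<Rightarrow> complex) \<Rightarrow> bool" where
  "monomial w \<longleftrightarrow> (\<forall>x y. cmod (w x y) \<le> 1) \<and>
     (\<forall>x y y'. w x y \<noteq> 0 \<longrightarrow> w x y' \<noteq> 0 \<longrightarrow> y = y') \<and> (\<forall>x x' y. w x y \<noteq> 0 \<longrightarrow> w x' y \<noteq> 0 \<longrightarrow> x = x')"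

text \<open>The product of a matrix with a vector. A row of a monomial matrix has at most one
  nonzero entry, so no infinite sum has to be formed.\<close>

definition mat_fun :: "('x \<Rightarrow> 'x \<Rightarrow> complex) \<Rightarrow> ('x \<Rightarrow> complex) \<Rightarrow> 'x \<Rightarrow> complex" where
  "mat_fun w f x = (if \<exists>y. w x y \<noteq> 0 then w x (THE y. w x y \<noteq> 0) * f (THE y. w x y \<noteq> 0) else 0)"

definition mat_adj :: "('x \<Rightarrow> 'x \<Rightarrow> complex) \<Rightarrow> 'x \<Rightarrow> 'x \<Rightarrow> complex" where
  "mat_adj w y x = cnj (w x y)"

definition mat_op :: "('x \<Rightarrow> 'x \<Rightarrow> complex) \<Rightarrow> 'x ell2_op" where
  "mat_op w = Abs_ell2_op (Blinfun (\<lambda>f. Abs_ell2 (mat_fun w (Rep_ell2 f))))"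

lemma monomial_adj: "monomial w \<Longrightarrow> monomial (mat_adj w)"
  by (simp add: monomial_def mat_adj_def)

lemma mat_fun_nonzero: "monomial w \<Longrightarrow> w x y \<noteq> 0 \<Longrightarrow> mat_fun w f x = w x y * f y"
proof -
  assume w: "monomial w" "w x y \<noteq> 0"
  then have "(THE y. w x y \<noteq> 0) = y"
    by (intro the_equality) (auto simp: monomial_def)
  with w show ?thesis
    by (auto simp: mat_fun_def)
qed

lemma mat_fun_zero: "(\<And>y. w x y = 0) \<Longrightarrow> mat_fun w f x = 0"
  by (simp add: mat_fun_def)

context
  fixes w :: "'x \<Rightarrow> 'x \<Rightarrow> complex"
  assumes w: "monomial w"
begin

lemma mat_fun_sum_le:
  assumes "finite F"
  shows "(\<Sum>x\<in>F. (cmod (mat_fun w (Rep_ell2 f) x))\<^sup>2) \<le> (norm f)\<^sup>2"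
proof -
  define D r where "D = {x. \<exists>y. w x y \<noteq> 0}" and "r x = (SOME y. w x y \<noteq> 0)" for x
  have r: "w x (r x) \<noteq> 0" if "x \<in> D" for x
    using that someI_ex[of "\<lambda>y. w x y \<noteq> 0"] by (simp add: r_def D_def)
  \<comment> \<open>Each column is used by at most one row, so the rows pick out distinct components
    of \<open>f\<close>.\<close>
  have inj: "inj_on r (F \<inter> D)"
    using r w unfolding monomial_def by (metis IntD2 inj_onI)
  have "(\<Sum>x\<in>F. (cmod (mat_fun w (Rep_ell2 f) x))\<^sup>2) = (\<Sum>x\<in>F \<inter> D. (cmod (mat_fun w (Rep_ell2 f) x))\<^sup>2)"
    using assms by (intro sum.mono_neutral_right) (auto simp: D_def mat_fun_zero)
  also have "\<dots> \<le> (\<Sum>x\<in>F \<inter> D. (cmod (Rep_ell2 f (r x)))\<^sup>2)"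
  proof (rule sum_mono)
    fix x assume "x \<in> F \<inter> D"
    then have "mat_fun w (Rep_ell2 f) x = w x (r x) * Rep_ell2 f (r x)"
      using mat_fun_nonzero[OF w r] by blast
    moreover have "cmod (w x (r x)) \<le> 1"
      using w by (simp add: monomial_def)
    ultimately show "(cmod (mat_fun w (Rep_ell2 f) x))\<^sup>2 \<le> (cmod (Rep_ell2 f (r x)))\<^sup>2"
      by (intro power_mono) (simp_all add: norm_mult mult_left_le_one_le)
  qed
  also have "\<dots> = (\<Sum>y\<in>r ` (F \<inter> D). (cmod (Rep_ell2 f y))\<^sup>2)"
    using inj by (simp add: sum.reindex)
  also have "\<dots> \<le> (norm f)\<^sup>2"
    using assms by (intro ell2_sum_le_norm_square) auto
  finally show ?thesis .
qed

lemma Rep_mat_fun: "Rep_ell2 (Abs_ell2 (mat_fun w (Rep_ell2 f))) = mat_fun w (Rep_ell2 f)"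
  using ell2_norm_square_le(1)[OF mat_fun_sum_le, of f] by (intro Abs_ell2_inverse) simp

lemma mat_fun_linear:
  "mat_fun w (Rep_ell2 (f + g)) x = mat_fun w (Rep_ell2 f) x + mat_fun w (Rep_ell2 g) x"
  "mat_fun w (Rep_ell2 (r *\<^sub>R f)) x = r *\<^sub>R mat_fun w (Rep_ell2 f) x"
  "mat_fun w (Rep_ell2 (cmult_ell2 z f)) x = z * mat_fun w (Rep_ell2 f) x"
  by (simp_all add: mat_fun_def Rep_ell2_simps distrib_left mult.left_commute)

lemma bounded_linear_mat_fun: "bounded_linear (\<lambda>f. Abs_ell2 (mat_fun w (Rep_ell2 f)))"
proof (rule bounded_linear_intro[where K = 1])
  fix f g :: "'x ell2" and r :: real
  show "Abs_ell2 (mat_fun w (Rep_ell2 (f + g))) =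
      Abs_ell2 (mat_fun w (Rep_ell2 f)) + Abs_ell2 (mat_fun w (Rep_ell2 g))"
    "Abs_ell2 (mat_fun w (Rep_ell2 (r *\<^sub>R f))) = r *\<^sub>R Abs_ell2 (mat_fun w (Rep_ell2 f))"
    by (rule ell2_eqI, simp add: Rep_mat_fun mat_fun_linear Rep_ell2_simps(1,5))+
  have "(norm (Abs_ell2 (mat_fun w (Rep_ell2 f))))\<^sup>2 \<le> (norm f)\<^sup>2"
    unfolding ell2_norm_square[of "Abs_ell2 _"] Rep_mat_fun
    by (rule ell2_norm_square_le(2)[OF mat_fun_sum_le])
  then have "norm (Abs_ell2 (mat_fun w (Rep_ell2 f))) \<le> norm f"
    by (rule power2_le_imp_le) simp
  then show "norm (Abs_ell2 (mat_fun w (Rep_ell2 f))) \<le> norm f * 1"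
    by simp
qed

end

text \<open>Both sides sum over the nonzero entries, listed by rows on the left and by columns on
  the right; the injective map \<open>r\<close> from rows to columns matches them.\<close>

lemma mat_fun_adjoint:
  assumes w: "monomial w"
  shows "(\<Sum>\<^sub>\<infinity>x. inner (mat_fun w f x) (g x)) = (\<Sum>\<^sub>\<infinity>y. inner (f y) (mat_fun (mat_adj w) g y))"
proof -
  define D r where "D = {x. \<exists>y. w x y \<noteq> 0}" and "r x = (SOME y. w x y \<noteq> 0)" for x
  have r: "w x (r x) \<noteq> 0" if "x \<in> D" for x
    using that someI_ex[of "\<lambda>y. w x y \<noteq> 0"] by (simp add: r_def D_def)
  have inj: "inj_on r D"
    using r w unfolding monomial_def by (metis inj_onI)
  have D: "w x y = 0" if "x \<notin> D" for x y
    using that by (auto simp: D_def)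
  have rD: "mat_adj w y x = 0" if "y \<notin> r ` D" for x y
  proof (rule ccontr)
    assume "mat_adj w y x \<noteq> 0"
    then have "w x y \<noteq> 0" by (simp add: mat_adj_def)
    then have "x \<in> D"
      by (auto simp: D_def)
    then have "y = r x"
      using r[of x] w \<open>w x y \<noteq> 0\<close> unfolding monomial_def by blast
    with that \<open>x \<in> D\<close> show False by blast
  qed
  have "(\<Sum>\<^sub>\<infinity>x. inner (mat_fun w f x) (g x)) = (\<Sum>\<^sub>\<infinity>x\<in>D. inner (mat_fun w f x) (g x))"
    by (rule infsum_cong_neutral) (auto simp: mat_fun_zero D)
  also have "\<dots> = (\<Sum>\<^sub>\<infinity>x\<in>D. inner (f (r x)) (mat_fun (mat_adj w) g (r x)))"
  proof (rule infsum_cong)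
    fix x assume x: "x \<in> D"
    have "mat_adj w (r x) x \<noteq> 0"
      using r[OF x] by (simp add: mat_adj_def)
    then show "inner (mat_fun w f x) (g x) = inner (f (r x)) (mat_fun (mat_adj w) g (r x))"
      using mat_fun_nonzero[OF w r[OF x]] mat_fun_nonzero[OF monomial_adj[OF w]]
      by (simp add: mat_adj_def inner_complex_def algebra_simps)
  qed
  also have "\<dots> = (\<Sum>\<^sub>\<infinity>y\<in>r ` D. inner (f y) (mat_fun (mat_adj w) g y))"
    using infsum_reindex[OF inj, of "\<lambda>y. inner (f y) (mat_fun (mat_adj w) g y)"] by (simp add: o_def)
  also have "\<dots> = (\<Sum>\<^sub>\<infinity>y. inner (f y) (mat_fun (mat_adj w) g y))"
    by (rule infsum_cong_neutral) (auto simp: mat_fun_zero rD)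
  finally show ?thesis .
qed

lemma apply_mat_op:
  assumes w: "monomial w"
  shows "Rep_ell2 (apply_op (mat_op w) f) = mat_fun w (Rep_ell2 f)"
proof -
  have app: "Rep_ell2 (blinfun_apply (Blinfun (\<lambda>f. Abs_ell2 (mat_fun v (Rep_ell2 f)))) f) = mat_fun v (Rep_ell2 f)"
    if "monomial v" for v :: "'a \<Rightarrow> 'a \<Rightarrow> complex" and f
    using that by (simp add: bounded_linear_Blinfun_apply bounded_linear_mat_fun Rep_mat_fun)
  let ?T = "Blinfun (\<lambda>f. Abs_ell2 (mat_fun w (Rep_ell2 f)))"
    and ?S = "Blinfun (\<lambda>f. Abs_ell2 (mat_fun (mat_adj w) (Rep_ell2 f)))"
  have "ell2_adjoint ?T ?S"
    by (simp add: ell2_adjoint_def inner_ell2_def app w monomial_adj mat_fun_adjoint)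
  moreover have "ell2_linear ?T"
    unfolding ell2_linear_def
    by (intro allI ell2_eqI) (simp add: app w mat_fun_linear Rep_ell2_simps(6))
  ultimately have "Rep_ell2_op (mat_op w) = ?T"
    unfolding mat_op_def by (intro Abs_ell2_op_inverse) auto
  then show ?thesis
    by (simp add: apply_op_def app w)
qed

lemma adj_mat_op:
  assumes w: "monomial w"
  shows "adj (mat_op w) = mat_op (mat_adj w)"
  unfolding adj_ell2_op_def
  by (rule adjoint_op_eqI) (simp add: inner_ell2_def apply_mat_op w monomial_adj mat_fun_adjoint)

lemma Rep_apply_op_eqI: "(\<And>f x. Rep_ell2 (apply_op T f) x = Rep_ell2 (apply_op S f) x) \<Longrightarrow> T = S"
  by (intro ell2_op_eqI ell2_eqI)

lemma mat_op_nonzero: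
  assumes w: "monomial w" and "w x y \<noteq> 0"
  shows "mat_op w \<noteq> 0"
proof
  assume "mat_op w = 0"
  define d :: "'a \<Rightarrow> complex" where "d z = (if z = y then 1 else 0)" for z
  have "(\<lambda>z. (cmod (d z))\<^sup>2) summable_on UNIV"
    using summable_on_cong_neutral[of "{y}" UNIV "\<lambda>z. (cmod (d z))\<^sup>2" "\<lambda>z. (cmod (d z))\<^sup>2"] by (simp add: d_def)
  then have "Rep_ell2 (Abs_ell2 d) = d"
    by (intro Abs_ell2_inverse) simp
  then have "mat_fun w d x = 0"
    using fun_cong[OF apply_mat_op[OF w, of "Abs_ell2 d"], of x] \<open>mat_op w = 0\<close>
    by (simp add: apply_op_simps Rep_ell2_simps)
  with mat_fun_nonzero[OF assms, of d] assms(2) show False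
    by (simp add: d_def)
qed

section \<open>The representation on the paths leading to an infinite path\<close>

context pgraph
begin

text \<open>Degrees can be cancelled, so the remaining factors have equal degree and unique
  factorisation applies.\<close>

lemma cmp_right_cancel:
  assumes "composable \<Lambda> \<mu> \<nu>" "composable \<Lambda> \<mu>' \<nu>" "cmp \<Lambda> \<mu> \<nu> = cmp \<Lambda> \<mu>' \<nu>"
  shows "\<mu> = \<mu>'"
proof -
  have "deg \<Lambda> \<mu> + deg \<Lambda> \<nu> = deg \<Lambda> \<mu>' + deg \<Lambda> \<nu>"
    using assms by (metis deg_cmp)
  then show ?thesis
    using cmp_eqD[OF assms(1,2) _ refl assms(3)] by simp
qed

lemma cmp_left_cancel:
  assumes "composable \<Lambda> \<mu> \<nu>" "composable \<Lambda> \<mu>' \<nu>'" "deg \<Lambda> \<mu> = deg \<Lambda> \<mu>'" "cmp \<Lambda> \<mu> \<nu> = cmp \<Lambda> \<mu>' \<nu>'"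
  shows "\<mu> = \<mu>' \<and> \<nu> = \<nu>'"
proof -
  have "deg \<Lambda> \<mu> + deg \<Lambda> \<nu> = deg \<Lambda> \<mu> + deg \<Lambda> \<nu>'"
    using assms by (metis deg_cmp)
  then show ?thesis
    using cmp_eqD[OF assms(1,2,3) _ assms(4)] by simp
qed

end

text \<open>The infinite path \<open>x\<^sub>0x\<^sub>1x\<^sub>2\<dots>\<close> has all edges of degree \<open>(1,\<dots>,1)\<close>, and \<open>x\<^sub>n\<close> has range \<open>base n\<close>.  The
  Hilbert space to be constructed is the direct limit of the spaces \<open>\<ell>\<^sup>2{\<mu>. s(\<mu>) = base n}\<close> along
  \<open>\<delta>\<^sub>\<mu> \<mapsto> c(\<mu>,x\<^sub>n) \<delta>\<close> at \<open>\<mu>x\<^sub>n\<close>.  An orthonormal basis is indexed by those \<open>(n, \<mu>)\<close> for which \<open>\<mu>\<close> does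
  not end with \<open>x\<close> at \<open>n-1\<close>: the vector \<open>\<delta>\<^sub>\<mu>\<close> of stage \<open>n\<close> is \<open>phase n \<mu>\<close> times the basis vector
  \<open>root n \<mu>\<close>.\<close>

locale path_rep = pgraph k \<Lambda>
  for k :: nat
    and \<Lambda> :: "('l, (nat \<Rightarrow> nat) \<times> 'f::{ab_group_add, countable}) graded_category" +
  fixes c :: "'l \<Rightarrow> 'l \<Rightarrow> complex" and v\<^sub>0 :: 'l
  assumes row_finite: "row_finite k \<Lambda>" and no_sources: "no_sources k \<Lambda>"
    and cocycle: "cocycle \<Lambda> c" and v\<^sub>0: "v\<^sub>0 \<in> vertices \<Lambda>"
begin

text \<open>Multiples of this degree eventually dominate every degree: elements of F are invertible,
  so only the first \<open>k\<close> coordinates have to grow. For \<open>k = 0\<close> the infinite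
  path is constant.\<close>

definition step :: "(nat \<Rightarrow> nat) \<times> 'f" where
  "step = (\<lambda>i. if i < k then 1 else 0, 0)"

definition next_edge :: "'l \<Rightarrow> 'l" where
  "next_edge v = (SOME \<alpha>. \<alpha> \<in> paths_from \<Lambda> v step)"

primrec base :: "nat \<Rightarrow> 'l" where
  "base 0 = v\<^sub>0"
| "base (Suc n) = src \<Lambda> (next_edge (base n))"

definition edge :: "nat \<Rightarrow> 'l" where
  "edge n = next_edge (base n)"

lemma step_in_NF: "step \<in> NF k"
  by (simp add: step_def NF_def)

lemma edge: "base n \<in> vertices \<Lambda> \<and> edge n \<in> arr \<Lambda> \<and> deg \<Lambda> (edge n) = step \<and>
    rng \<Lambda> (edge n) = base n \<and> src \<Lambda> (edge n) = base (Suc n)"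
proof (induction n)
  have *: "edge n \<in> paths_from \<Lambda> (base n) step" if "base n \<in> vertices \<Lambda>" for n
  proof -
    have "\<exists>\<alpha>. \<alpha> \<in> paths_from \<Lambda> (base n) step"
      using no_sources that step_in_NF unfolding no_sources_def by blast
    then show ?thesis
      unfolding edge_def next_edge_def by (rule someI_ex)
  qed
  case 0
  then show ?case
    using *[of 0] v\<^sub>0 by (simp add: paths_from_def edge_def)
  case (Suc n)
  then have "base (Suc n) \<in> vertices \<Lambda>"
    using src_vertex by metis
  then show ?case
    using *[of "Suc n"] by (simp add: paths_from_def edge_def)
qed

definition stage :: "nat \<Rightarrow> 'l \<Rightarrow> bool" where
  "stage n \<mu> \<longleftrightarrow> \<mu> \<in> arr \<Lambda> \<and> src \<Lambda> \<mu> = base n"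

definition shift :: "nat \<Rightarrow> 'l \<Rightarrow> 'l" where
  "shift n \<mu> = cmp \<Lambda> \<mu> (edge n)"

lemma composable_edge: "stage n \<mu> \<Longrightarrow> composable \<Lambda> \<mu> (edge n)"
  using edge[of n] by (simp add: stage_def composable_def)

lemma shift: "stage n \<mu> \<Longrightarrow> stage (Suc n) (shift n \<mu>)" "stage n \<mu> \<Longrightarrow> rng \<Lambda> (shift n \<mu>) = rng \<Lambda> \<mu>"
  "stage n \<mu> \<Longrightarrow> deg \<Lambda> (shift n \<mu>) = deg \<Lambda> \<mu> + step"
  using composable_edge[of n \<mu>] edge[of n]
  by (simp_all add: shift_def stage_def[of "Suc n"] cmp_in src_cmp rng_cmp deg_cmp)

lemma shift_inject: "stage n \<mu> \<Longrightarrow> stage n \<nu> \<Longrightarrow> shift n \<mu> = shift n \<nu> \<Longrightarrow> \<mu> = \<nu>"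
  unfolding shift_def using cmp_right_cancel composable_edge by blast

lemma stage_cmp: "composable \<Lambda> \<alpha> \<mu> \<Longrightarrow> stage n \<mu> \<Longrightarrow> stage n (cmp \<Lambda> \<alpha> \<mu>)"
  by (simp add: stage_def cmp_in src_cmp)

lemma composable_shift: "composable \<Lambda> \<alpha> \<mu> \<Longrightarrow> stage n \<mu> \<Longrightarrow> composable \<Lambda> \<alpha> (shift n \<mu>)"
  using shift[of n \<mu>] by (simp add: composable_def stage_def)

lemma cmp_shift: "composable \<Lambda> \<alpha> \<mu> \<Longrightarrow> stage n \<mu> \<Longrightarrow> cmp \<Lambda> \<alpha> (shift n \<mu>) = shift n (cmp \<Lambda> \<alpha> \<mu>)"
  unfolding shift_def using cmp_assoc composable_edge by simp

text \<open>Trailing edges of the infinite path are stripped as long as possible; the first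
  component is the earliest stage at which the vector appears.\<close>

fun root :: "nat \<Rightarrow> 'l \<Rightarrow> nat \<times> 'l" where
  "root 0 \<mu> = (0, \<mu>)"
| "root (Suc n) \<mu> = (if \<exists>\<nu>. stage n \<nu> \<and> \<mu> = shift n \<nu>
     then root n (THE \<nu>. stage n \<nu> \<and> \<mu> = shift n \<nu>) else (Suc n, \<mu>))"

text \<open>The conjugate arises from solving the identification of \<delta> at \<nu> with c(\<nu>,
  x_n) times \<delta> at \<nu>x_n for the latter.\<close>

fun phase :: "nat \<Rightarrow> 'l \<Rightarrow> complex" where
  "phase 0 \<mu> = 1"
| "phase (Suc n) \<mu> = (if \<exists>\<nu>. stage n \<nu> \<and> \<mu> = shift n \<nu>
     then (let \<nu> = (THE \<nu>. stage n \<nu> \<and> \<mu> = shift n \<nu>) in cnj (c \<nu> (edge n)) * phase n \<nu>) else 1)"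

lemma root_shift: "stage n \<nu> \<Longrightarrow> root (Suc n) (shift n \<nu>) = root n \<nu>"
  and phase_shift: "stage n \<nu> \<Longrightarrow> phase (Suc n) (shift n \<nu>) = cnj (c \<nu> (edge n)) * phase n \<nu>"
proof -
  assume \<nu>: "stage n \<nu>"
  then have "(THE \<nu>'. stage n \<nu>' \<and> shift n \<nu> = shift n \<nu>') = \<nu>"
    by (intro the_equality) (auto dest: shift_inject)
  then show "root (Suc n) (shift n \<nu>) = root n \<nu>"
    "phase (Suc n) (shift n \<nu>) = cnj (c \<nu> (edge n)) * phase n \<nu>"
    using \<nu> by (auto simp: Let_def)
qed

lemma cocycle_unit: "composable \<Lambda> \<mu> \<nu> \<Longrightarrow> cnj (c \<mu> \<nu>) * c \<mu> \<nu> = 1" "composable \<Lambda> \<mu> \<nu> \<Longrightarrow> cmod (c \<mu> \<nu>) = 1"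
  using cocycle complex_norm_square[of "c \<mu> \<nu>"] by (auto simp: cocycle_def mult.commute)

lemma norm_phase: "stage n \<mu> \<Longrightarrow> cmod (phase n \<mu>) = 1"
proof (induction n arbitrary: \<mu>)
  case (Suc n)
  show ?case
  proof (cases "\<exists>\<nu>. stage n \<nu> \<and> \<mu> = shift n \<nu>")
    case True
    then obtain \<nu> where \<nu>: "stage n \<nu>" "\<mu> = shift n \<nu>" by blast
    then show ?thesis
      using Suc.IH cocycle_unit(2)[OF composable_edge] by (simp add: phase_shift norm_mult del: phase.simps)
  next
    case False
    then have "phase (Suc n) \<mu> = 1"
      unfolding phase.simps(2) by (rule if_not_P)
    then show ?thesis by simp
  qed
qed simp

text \<open>Stripping at least one edge at stage \<open>Suc n\<close> leaves an index of at most
  \<open>n\<close>, so stripped and unstripped paths are never confused. Two stripped paths are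
  compared by induction.\<close>

lemma root_inject:
  assumes "stage n \<mu>" "stage n \<nu>" "root n \<mu> = root n \<nu>"
  shows "\<mu> = \<nu>"
proof -
  have le: "fst (root n \<mu>) \<le> n" for n \<mu>
    by (induction n arbitrary: \<mu>) (auto intro: le_SucI)
  from assms show ?thesis
  proof (induction n arbitrary: \<mu> \<nu>)
    case (Suc n)
    have shifted: "\<exists>\<nu>. stage n \<nu> \<and> \<mu> = shift n \<nu> \<and> root (Suc n) \<mu> = root n \<nu>"
      if *: "\<not> root (Suc n) \<mu> = (Suc n, \<mu>)" for \<mu>
    proof -
      obtain \<nu> where "stage n \<nu>" "\<mu> = shift n \<nu>"
        using * unfolding root.simps(2) by meson
      then show ?thesis using root_shift by blast
    qed
    show ?case
    proof (cases "root (Suc n) \<mu> = (Suc n, \<mu>) \<or> root (Suc n) \<nu> = (Suc n, \<nu>)")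
      case True
      have "root (Suc n) \<mu> = (Suc n, \<mu>) \<and> root (Suc n) \<nu> = (Suc n, \<nu>)"
      proof (rule ccontr)
        assume "\<not> ?thesis"
        then obtain \<kappa> where "root (Suc n) \<mu> = root n \<kappa>"
          using shifted Suc.prems(3) by metis
        with True Suc.prems(3) le[of n \<kappa>] show False by auto
      qed
      then have "(Suc n, \<mu>) = (Suc n, \<nu>)"
        using Suc.prems(3) by metis
      then show ?thesis by simp
    next
      case False
      then show ?thesis
        using shifted[of \<mu>] shifted[of \<nu>] Suc.IH Suc.prems(3) by metis
    qed
  qed simp
qed

text \<open>The coefficient with which \<alpha> maps the basis vector \<open>root n \<mu>\<close> to
  \<open>root n (cmp \<Lambda> \<alpha> \<mu>)\<close>, obtained from \<delta>_\<mu> -> c(\<alpha>,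
  \<mu>) \<delta>_(\<alpha>\<mu>) after both vectors are expressed in the basis.\<close>

definition weight :: "nat \<Rightarrow> 'l \<Rightarrow> 'l \<Rightarrow> complex" where
  "weight n \<alpha> \<mu> = c \<alpha> \<mu> * phase n (cmp \<Lambda> \<alpha> \<mu>) * cnj (phase n \<mu>)"

text \<open>This is the cocycle identity for \<alpha>, \<mu> and the next edge: the coefficient does
  not depend on the stage.\<close>

lemma weight_shift:
  assumes "composable \<Lambda> \<alpha> \<mu>" "stage n \<mu>"
  shows "weight (Suc n) \<alpha> (shift n \<mu>) = weight n \<alpha> \<mu>"
proof -
  have cc: "c \<alpha> \<mu> * c (cmp \<Lambda> \<alpha> \<mu>) (edge n) = c \<mu> (edge n) * c \<alpha> (cmp \<Lambda> \<mu> (edge n))"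
    using cocycle assms composable_edge by (simp add: cocycle_def)
  have u: "cnj (c (cmp \<Lambda> \<alpha> \<mu>) (edge n)) * c (cmp \<Lambda> \<alpha> \<mu>) (edge n) = 1"
    using assms stage_cmp composable_edge cocycle_unit(1) by blast
  have "weight (Suc n) \<alpha> (shift n \<mu>) = (c \<mu> (edge n) * c \<alpha> (cmp \<Lambda> \<mu> (edge n))) *
      cnj (c (cmp \<Lambda> \<alpha> \<mu>) (edge n)) * phase n (cmp \<Lambda> \<alpha> \<mu>) * cnj (phase n \<mu>)"
    unfolding weight_def cmp_shift[OF assms] phase_shift[OF stage_cmp[OF assms]] phase_shift[OF assms(2)]
    by (simp add: shift_def mult_ac)
  also have "\<dots> = c \<alpha> \<mu> * (cnj (c (cmp \<Lambda> \<alpha> \<mu>) (edge n)) * c (cmp \<Lambda> \<alpha> \<mu>) (edge n)) *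
      phase n (cmp \<Lambda> \<alpha> \<mu>) * cnj (phase n \<mu>)"
    unfolding cc[symmetric] by (simp add: mult_ac)
  also have "\<dots> = weight n \<alpha> \<mu>"
    by (simp only: u weight_def mult_1_right)
  finally show ?thesis .
qed

definition entry :: "nat \<Rightarrow> 'l \<Rightarrow> nat \<times> 'l \<Rightarrow> nat \<times> 'l \<Rightarrow> complex \<Rightarrow> bool" where
  "entry n \<alpha> x y z \<longleftrightarrow> (\<exists>\<mu>. composable \<Lambda> \<alpha> \<mu> \<and> stage n \<mu> \<and> x = root n (cmp \<Lambda> \<alpha> \<mu>) \<and> y = root n \<mu> \<and>
     z = weight n \<alpha> \<mu>)"

text \<open>Appending an edge changes neither the roots nor the weight. Any two entries can
  therefore be compared at a common stage, where cancellation and \<open>root_inject\<close>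
  decide.\<close>

lemma entry_mono:
  assumes "entry m \<alpha> x y z" "m \<le> n"
  shows "entry n \<alpha> x y z"
  using assms(2,1)
proof (induction rule: dec_induct)
  case (step n)
  then obtain \<mu> where \<mu>: "composable \<Lambda> \<alpha> \<mu>" "stage n \<mu>" "x = root n (cmp \<Lambda> \<alpha> \<mu>)" "y = root n \<mu>" "z = weight n \<alpha> \<mu>"
    by (auto simp: entry_def)
  show ?case
    unfolding entry_def
    by (intro exI[of _ "shift n \<mu>"])
      (simp add: \<mu> composable_shift shift cmp_shift root_shift stage_cmp weight_shift del: root.simps)
qed

lemma entry_common:
  assumes "entry m \<alpha> x y z" "entry n \<beta> x' y' z'"
  obtains N where "entry N \<alpha> x y z" "entry N \<beta> x' y' z'"
  using entry_mono[OF assms(1), of "max m n"] entry_mono[OF assms(2), of "max m n"] that by simp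

lemma entry_unique_right: "entry m \<alpha> x y z \<Longrightarrow> entry n \<alpha> x' y z' \<Longrightarrow> x = x' \<and> z = z'"
  by (erule (1) entry_common) (auto simp: entry_def dest: root_inject)

lemma entry_unique_left:
  assumes "entry m \<alpha> x y z" "entry n \<alpha> x y' z'"
  shows "y = y' \<and> z = z'"
proof -
  obtain N where "entry N \<alpha> x y z" "entry N \<alpha> x y' z'"
    using entry_common[OF assms] .
  then obtain \<mu> \<nu> where st: "composable \<Lambda> \<alpha> \<mu>" "stage N \<mu>" "composable \<Lambda> \<alpha> \<nu>" "stage N \<nu>"
    "root N (cmp \<Lambda> \<alpha> \<mu>) = root N (cmp \<Lambda> \<alpha> \<nu>)" and yz: "y = root N \<mu>" "y' = root N \<nu>"
    "z = weight N \<alpha> \<mu>" "z' = weight N \<alpha> \<nu>"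
    unfolding entry_def by blast
  have "cmp \<Lambda> \<alpha> \<mu> = cmp \<Lambda> \<alpha> \<nu>"
    by (rule root_inject[OF stage_cmp[OF st(1,2)] stage_cmp[OF st(3,4)] st(5)])
  then have "\<mu> = \<nu>"
    using cmp_left_cancel[OF st(1,3)] by simp
  then show ?thesis by (simp add: yz)
qed

lemma entry_norm: "entry n \<alpha> x y z \<Longrightarrow> cmod z = 1"
  by (auto simp: entry_def weight_def norm_mult norm_phase stage_cmp cocycle_unit)

definition mat :: "'l \<Rightarrow> nat \<times> 'l \<Rightarrow> nat \<times> 'l \<Rightarrow> complex" where
  "mat \<alpha> x y = (if \<exists>n z. entry n \<alpha> x y z then THE z. \<exists>n. entry n \<alpha> x y z else 0)"

lemma mat_entry: "entry n \<alpha> x y z \<Longrightarrow> mat \<alpha> x y = z"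
proof -
  assume e: "entry n \<alpha> x y z"
  then have "(THE z. \<exists>n. entry n \<alpha> x y z) = z"
    by (intro the_equality) (auto dest: entry_unique_left)
  with e show ?thesis by (auto simp: mat_def)
qed

lemma mat_nonzero: "mat \<alpha> x y \<noteq> 0 \<longleftrightarrow> (\<exists>n z. entry n \<alpha> x y z)"
proof
  assume "\<exists>n z. entry n \<alpha> x y z"
  then obtain n z where e: "entry n \<alpha> x y z" by blast
  show "mat \<alpha> x y \<noteq> 0"
    using mat_entry[OF e] entry_norm[OF e] by auto
next
  assume "mat \<alpha> x y \<noteq> 0"
  then show "\<exists>n z. entry n \<alpha> x y z"
    unfolding mat_def by meson
qed

lemma mat_eq_0_iff: "mat \<alpha> x y = 0 \<longleftrightarrow> (\<forall>n z. \<not> entry n \<alpha> x y z)"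
  using mat_nonzero[of \<alpha> x y] by blast

lemma monomial_mat: "monomial (mat \<alpha>)"
proof -
  have "cmod (mat \<alpha> x y) \<le> 1" for x y
  proof (cases "mat \<alpha> x y = 0")
    case False
    then obtain n z where e: "entry n \<alpha> x y z"
      using mat_nonzero by blast
    then show ?thesis
      using entry_norm[OF e] by (simp add: mat_entry[OF e])
  qed simp
  moreover have "y = y'" if "mat \<alpha> x y \<noteq> 0" "mat \<alpha> x y' \<noteq> 0" for x y y'
    using that entry_unique_left unfolding mat_nonzero by blast
  moreover have "x = x'" if "mat \<alpha> x y \<noteq> 0" "mat \<alpha> x' y \<noteq> 0" for x x' y
    using that entry_unique_right unfolding mat_nonzero by blast
  ultimately show ?thesis
    unfolding monomial_def by blast
qed

text \<open>The basis vectors in the range of the operator of \<alpha>; its range projection is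
  multiplication by the indicator function of this set.\<close>

definition targets :: "'l \<Rightarrow> (nat \<times> 'l) set" where
  "targets \<alpha> = {x. \<exists>n y z. entry n \<alpha> x y z}"

lemma mat_fun_entry: "entry n \<alpha> x y z \<Longrightarrow> mat_fun (mat \<alpha>) f x = z * f y"
  using mat_fun_nonzero[OF monomial_mat, of \<alpha> x y f] mat_entry mat_nonzero by blast

lemma mat_fun_adj_entry: "entry n \<alpha> x y z \<Longrightarrow> mat_fun (mat_adj (mat \<alpha>)) f y = cnj z * f x"
  using mat_fun_nonzero[OF monomial_adj[OF monomial_mat], of \<alpha> y x f] mat_entry mat_nonzero[of \<alpha> x y]
  by (simp add: mat_adj_def) blast

lemma mat_fun_not_target: "x \<notin> targets \<alpha> \<Longrightarrow> mat_fun (mat \<alpha>) f x = 0"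
proof (rule mat_fun_zero)
  fix y
  assume "x \<notin> targets \<alpha>"
  then show "mat \<alpha> x y = 0"
    unfolding mat_eq_0_iff targets_def by blast
qed

lemma mat_fun_adj_none: "(\<And>n x z. \<not> entry n \<alpha> x y z) \<Longrightarrow> mat_fun (mat_adj (mat \<alpha>)) f y = 0"
  by (rule mat_fun_zero) (simp add: mat_adj_def mat_eq_0_iff)

lemma targets_iff: "x \<in> targets \<alpha> \<longleftrightarrow> (\<exists>n \<mu>. composable \<Lambda> \<alpha> \<mu> \<and> stage n \<mu> \<and> x = root n (cmp \<Lambda> \<alpha> \<mu>))"
  unfolding targets_def entry_def by blast

section \<open>The Cuntz-Krieger relations for the matrices\<close>

lemma entry_vertex:
  assumes v: "v \<in> vertices \<Lambda>"
  shows "entry n v x y z \<longleftrightarrow> (\<exists>\<mu>. rng \<Lambda> \<mu> = v \<and> stage n \<mu> \<and> x = root n \<mu> \<and> y = root n \<mu> \<and> z = 1)"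
proof -
  have "composable \<Lambda> v \<mu> \<longleftrightarrow> rng \<Lambda> \<mu> = v" if "stage n \<mu>" for \<mu>
    using that vertexD[OF v] by (auto simp: composable_def stage_def)
  moreover have "cmp \<Lambda> v \<mu> = \<mu>" "weight n v \<mu> = 1" if "stage n \<mu>" "rng \<Lambda> \<mu> = v" for \<mu>
  proof -
    have \<mu>: "\<mu> \<in> arr \<Lambda>" using that by (simp add: stage_def)
    show "cmp \<Lambda> v \<mu> = \<mu>"
      using cmp_rng[OF \<mu>] that by simp
    then show "weight n v \<mu> = 1"
      using cocycle \<mu> that norm_phase[OF that(1)] complex_norm_square[of "phase n \<mu>"]
      by (auto simp: weight_def cocycle_def)
  qed
  ultimately show ?thesis
    unfolding entry_def by (metis (no_types, lifting))
qed

lemma mat_fun_vertex: "v \<in> vertices \<Lambda> \<Longrightarrow> mat_fun (mat v) f x = (if x \<in> targets v then f x else 0)"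
proof -
  assume v: "v \<in> vertices \<Lambda>"
  show ?thesis
  proof (cases "x \<in> targets v")
    case True
    then obtain n where "entry n v x x 1"
      by (auto simp: targets_def entry_vertex[OF v])
    with True show ?thesis by (simp add: mat_fun_entry)
  qed (simp add: mat_fun_not_target)
qed

lemma mat_adj_vertex: "v \<in> vertices \<Lambda> \<Longrightarrow> mat_adj (mat v) = mat v"
proof (intro ext)
  fix x y assume v: "v \<in> vertices \<Lambda>"
  show "mat_adj (mat v) x y = mat v x y"
  proof (cases "mat v x y \<noteq> 0 \<or> mat v y x \<noteq> 0")
    case True
    then have "x = y" "\<exists>n. entry n v x x 1"
      unfolding mat_nonzero entry_vertex[OF v] by auto
    then show ?thesis
      by (auto simp: mat_adj_def mat_entry)
  qed (simp add: mat_adj_def)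
qed

lemma targets_vertex_disjoint:
  assumes "v \<in> vertices \<Lambda>" "v' \<in> vertices \<Lambda>" "x \<in> targets v" "x \<in> targets v'"
  shows "v = v'"
proof -
  obtain m n y z y' z' where "entry m v x y z" "entry n v' x y' z'"
    using assms by (auto simp: targets_def)
  then obtain N where "entry N v x y z" "entry N v' x y' z'"
    by (rule entry_common)
  then show ?thesis
    using assms root_inject by (auto simp: entry_vertex)
qed

text \<open>At a common stage both sides lead from \<mu> to \<alpha>\<beta>\<mu>. The phase of
  \<beta>\<mu> cancels, and the cocycle identity for \<alpha>, \<beta>, \<mu> compares the
  coefficients.\<close>

lemma mat_fun_cmp:
  assumes "composable \<Lambda> \<alpha> \<beta>"
  shows "mat_fun (mat \<alpha>) (mat_fun (mat \<beta>) f) x = c \<alpha> \<beta> * mat_fun (mat (cmp \<Lambda> \<alpha> \<beta>)) f x"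
proof (cases "x \<in> targets (cmp \<Lambda> \<alpha> \<beta>)")
  case True
  then obtain n \<mu> where \<mu>: "composable \<Lambda> (cmp \<Lambda> \<alpha> \<beta>) \<mu>" "stage n \<mu>" "x = root n (cmp \<Lambda> (cmp \<Lambda> \<alpha> \<beta>) \<mu>)"
    by (auto simp: targets_iff)
  then have \<beta>\<mu>: "composable \<Lambda> \<beta> \<mu>" and \<alpha>\<beta>\<mu>: "composable \<Lambda> \<alpha> (cmp \<Lambda> \<beta> \<mu>)"
    using assms by (auto simp: composable_def src_cmp rng_cmp cmp_in)
  note assoc = cmp_assoc[OF assms \<beta>\<mu>]
  have st: "stage n (cmp \<Lambda> \<beta> \<mu>)"
    using \<beta>\<mu> \<mu>(2) by (rule stage_cmp)
  have 1: "entry n (cmp \<Lambda> \<alpha> \<beta>) x (root n \<mu>) (weight n (cmp \<Lambda> \<alpha> \<beta>) \<mu>)"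
    using \<mu> by (auto simp: entry_def)
  have 2: "entry n \<beta> (root n (cmp \<Lambda> \<beta> \<mu>)) (root n \<mu>) (weight n \<beta> \<mu>)"
    using \<beta>\<mu> \<mu> by (auto simp: entry_def)
  have 3: "entry n \<alpha> x (root n (cmp \<Lambda> \<beta> \<mu>)) (weight n \<alpha> (cmp \<Lambda> \<beta> \<mu>))"
    using \<alpha>\<beta>\<mu> \<mu> st assoc by (auto simp: entry_def)
  have "phase n (cmp \<Lambda> \<beta> \<mu>) * cnj (phase n (cmp \<Lambda> \<beta> \<mu>)) = 1"
    using norm_phase[OF st] complex_norm_square[of "phase n (cmp \<Lambda> \<beta> \<mu>)"] by simp
  then have "weight n \<alpha> (cmp \<Lambda> \<beta> \<mu>) * weight n \<beta> \<mu> =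
      (c \<beta> \<mu> * c \<alpha> (cmp \<Lambda> \<beta> \<mu>)) * phase n (cmp \<Lambda> \<alpha> (cmp \<Lambda> \<beta> \<mu>)) * cnj (phase n \<mu>)"
    unfolding weight_def by (simp add: mult_ac)
  also have "c \<beta> \<mu> * c \<alpha> (cmp \<Lambda> \<beta> \<mu>) = c \<alpha> \<beta> * c (cmp \<Lambda> \<alpha> \<beta>) \<mu>"
    using cocycle assms \<beta>\<mu> by (simp add: cocycle_def)
  finally have "weight n \<alpha> (cmp \<Lambda> \<beta> \<mu>) * weight n \<beta> \<mu> = c \<alpha> \<beta> * weight n (cmp \<Lambda> \<alpha> \<beta>) \<mu>"
    by (simp add: weight_def assoc mult_ac)
  then show ?thesis
    by (simp add: mat_fun_entry[OF 1] mat_fun_entry[OF 2] mat_fun_entry[OF 3] flip: mult.assoc)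
next
  case False
  have "mat_fun (mat \<alpha>) (mat_fun (mat \<beta>) f) x = 0"
  proof (cases "x \<in> targets \<alpha>")
    case True
    then obtain n y z where e: "entry n \<alpha> x y z"
      by (auto simp: targets_def)
    \<comment> \<open>Otherwise \<open>x\<close> would come from a path \<alpha>\<beta>\<nu> at some
      stage and be a target of the composite.\<close>
    have "y \<notin> targets \<beta>"
    proof
      assume "y \<in> targets \<beta>"
      then obtain m y' z' where "entry m \<beta> y y' z'"
        by (auto simp: targets_def)
      with e obtain N where N: "entry N \<alpha> x y z" "entry N \<beta> y y' z'"
        by (rule entry_common)
      then obtain \<mu> \<nu> where 1: "composable \<Lambda> \<alpha> \<mu>" "stage N \<mu>" "x = root N (cmp \<Lambda> \<alpha> \<mu>)" "y = root N \<mu>"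
        and 2: "composable \<Lambda> \<beta> \<nu>" "stage N \<nu>" "y = root N (cmp \<Lambda> \<beta> \<nu>)"
        unfolding entry_def by blast
      have "\<mu> = cmp \<Lambda> \<beta> \<nu>"
        using root_inject[OF 1(2) stage_cmp[OF 2(1,2)]] 1(4) 2(3) by simp
      then have "x = root N (cmp \<Lambda> (cmp \<Lambda> \<alpha> \<beta>) \<nu>)"
        using 1 2 cmp_assoc[OF assms 2(1)] by simp
      moreover have "composable \<Lambda> (cmp \<Lambda> \<alpha> \<beta>) \<nu>"
        using assms 2(1) by (simp add: composable_def cmp_in src_cmp)
      ultimately show False
        using False 2(2) by (auto simp: targets_iff)
    qed
    then show ?thesis
      by (simp add: mat_fun_entry[OF e] mat_fun_not_target)
  qed (simp add: mat_fun_not_target)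
  with False show ?thesis
    by (simp add: mat_fun_not_target)
qed

text \<open>Identifies the initial space of the operator of \<alpha> with the range of the
  projection at its source, as (CK3) requires.\<close>

lemma entry_right_iff:
  assumes "\<alpha> \<in> arr \<Lambda>"
  shows "(\<exists>n x z. entry n \<alpha> x y z) \<longleftrightarrow> y \<in> targets (src \<Lambda> \<alpha>)"
proof
  assume "\<exists>n x z. entry n \<alpha> x y z"
  then obtain n \<mu> where "composable \<Lambda> \<alpha> \<mu>" "stage n \<mu>" "y = root n \<mu>"
    unfolding entry_def by blast
  then have "entry n (src \<Lambda> \<alpha>) y y 1"
    unfolding entry_vertex[OF src_vertex[OF assms]] composable_def by metis
  then show "y \<in> targets (src \<Lambda> \<alpha>)"
    unfolding targets_def by blast
next
  assume "y \<in> targets (src \<Lambda> \<alpha>)"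
  then obtain n \<mu> where "rng \<Lambda> \<mu> = src \<Lambda> \<alpha>" "stage n \<mu>" "y = root n \<mu>"
    unfolding targets_def entry_vertex[OF src_vertex[OF assms]] by blast
  moreover from this have "composable \<Lambda> \<alpha> \<mu>"
    using assms by (simp add: composable_def stage_def)
  ultimately show "\<exists>n x z. entry n \<alpha> x y z"
    unfolding entry_def by blast
qed

lemma mat_fun_isometry:
  assumes "\<alpha> \<in> arr \<Lambda>"
  shows "mat_fun (mat_adj (mat \<alpha>)) (mat_fun (mat \<alpha>) f) y = mat_fun (mat (src \<Lambda> \<alpha>)) f y"
proof (cases "y \<in> targets (src \<Lambda> \<alpha>)")
  case True
  then obtain n x z where e: "entry n \<alpha> x y z"
    using entry_right_iff[OF assms] by blast
  have "cnj z * z = 1"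
    using entry_norm[OF e] complex_norm_square[of z] by (simp add: mult.commute)
  then show ?thesis
    using True by (simp add: mat_fun_adj_entry[OF e] mat_fun_entry[OF e] mat_fun_vertex src_vertex assms flip: mult.assoc)
next
  case False
  then show ?thesis
    using entry_right_iff[OF assms, of y] by (subst mat_fun_adj_none) (auto simp: mat_fun_not_target)
qed

lemma mat_fun_range: "mat_fun (mat \<alpha>) (mat_fun (mat_adj (mat \<alpha>)) f) x = (if x \<in> targets \<alpha> then f x else 0)"
proof (cases "x \<in> targets \<alpha>")
  case True
  then obtain n y z where e: "entry n \<alpha> x y z"
    by (auto simp: targets_def)
  have "z * cnj z = 1"
    using entry_norm[OF e] complex_norm_square[of z] by simp
  then show ?thesis
    using True by (simp add: mat_fun_adj_entry[OF e] mat_fun_entry[OF e] flip: mult.assoc)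
qed (simp add: mat_fun_not_target)

text \<open>Shifting far along the infinite path makes the degree larger than \<open>p\<close>.\<close>

lemma targets_path:
  assumes v: "v \<in> vertices \<Lambda>" and p: "p \<in> NF k" and x: "x \<in> targets v"
  shows "\<exists>\<alpha>\<in>paths_from \<Lambda> v p. x \<in> targets \<alpha>"
proof -
  obtain n \<mu> where \<mu>: "rng \<Lambda> \<mu> = v" "stage n \<mu>" "x = root n \<mu>"
    using x by (auto simp: targets_def entry_vertex[OF v])
  have "\<exists>\<nu>. rng \<Lambda> \<nu> = v \<and> stage (n + j) \<nu> \<and> x = root (n + j) \<nu> \<and> (\<forall>i<k. j \<le> fst (deg \<Lambda> \<nu>) i)" for j
  proof (induction j)
    case 0
    then show ?case using \<mu> by auto
  next
    case (Suc j)
    then obtain \<nu> where \<nu>: "rng \<Lambda> \<nu> = v" "stage (n + j) \<nu>" "x = root (n + j) \<nu>" "\<forall>i<k. j \<le> fst (deg \<Lambda> \<nu>) i"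
      by blast
    then show ?case
      using shift[OF \<nu>(2)] root_shift[OF \<nu>(2)]
      by (intro exI[of _ "shift (n + j) \<nu>"]) (auto simp: step_def simp del: root.simps)
  qed
  \<comment> \<open>The sum of the coordinates bounds each of them, so this many shifts
    suffice.\<close>
  moreover define j where "j = (\<Sum>i<k. fst p i)"
  ultimately obtain \<nu> where \<nu>: "rng \<Lambda> \<nu> = v" "stage (n + j) \<nu>" "x = root (n + j) \<nu>"
    "\<And>i. i < k \<Longrightarrow> j \<le> fst (deg \<Lambda> \<nu>) i"
    by blast
  have \<nu>_arr: "\<nu> \<in> arr \<Lambda>"
    using \<nu>(2) by (simp add: stage_def)
  \<comment> \<open>Subtraction of natural numbers is truncated, hence the need for
    \<open>le\<close>; in F it is unrestricted.\<close>
  define q where "q = (\<lambda>i. fst (deg \<Lambda> \<nu>) i - fst p i, snd (deg \<Lambda> \<nu>) - snd p)"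
  have le: "fst p i \<le> fst (deg \<Lambda> \<nu>) i" for i
  proof (cases "i < k")
    case True
    then have "fst p i \<le> j"
      unfolding j_def by (intro member_le_sum) auto
    with \<nu>(4)[OF True] show ?thesis by simp
  next
    case False
    then show ?thesis using p by (simp add: NF_def)
  qed
  have q: "q \<in> NF k" "deg \<Lambda> \<nu> = p + q"
    using deg_in[OF \<nu>_arr] le by (auto simp: q_def NF_def prod_eq_iff fun_eq_iff)
  obtain \<alpha> \<kappa> where "composable \<Lambda> \<alpha> \<kappa>" "deg \<Lambda> \<alpha> = p" "\<nu> = cmp \<Lambda> \<alpha> \<kappa>"
    using ex1_implies_ex[OF factorisation[OF \<nu>_arr p q]] by blast
  then have "\<alpha> \<in> paths_from \<Lambda> v p" "x \<in> targets \<alpha>"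
    using \<nu> by (auto simp: paths_from_def rng_cmp composable_def targets_iff stage_def src_cmp)
  then show ?thesis by blast
qed

lemma targets_path_unique:
  assumes "\<alpha> \<in> paths_from \<Lambda> v p" "\<beta> \<in> paths_from \<Lambda> v p" "x \<in> targets \<alpha>" "x \<in> targets \<beta>"
  shows "\<alpha> = \<beta>"
proof -
  obtain m n y z y' z' where "entry m \<alpha> x y z" "entry n \<beta> x y' z'"
    using assms by (auto simp: targets_def)
  then obtain N where "entry N \<alpha> x y z" "entry N \<beta> x y' z'"
    by (rule entry_common)
  then obtain \<mu> \<nu> where 1: "composable \<Lambda> \<alpha> \<mu>" "composable \<Lambda> \<beta> \<nu>" "stage N \<mu>" "stage N \<nu>"
    "root N (cmp \<Lambda> \<alpha> \<mu>) = root N (cmp \<Lambda> \<beta> \<nu>)"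
    unfolding entry_def by blast
  have "cmp \<Lambda> \<alpha> \<mu> = cmp \<Lambda> \<beta> \<nu>"
    by (rule root_inject[OF stage_cmp[OF 1(1,3)] stage_cmp[OF 1(2,4)] 1(5)])
  then show ?thesis
    using cmp_left_cancel[OF 1(1,2)] assms by (auto simp: paths_from_def)
qed

lemma path_targets_vertex:
  assumes "\<alpha> \<in> paths_from \<Lambda> v p" "v \<in> vertices \<Lambda>"
  shows "targets \<alpha> \<subseteq> targets v"
proof
  fix x assume "x \<in> targets \<alpha>"
  then obtain n \<mu> where "composable \<Lambda> \<alpha> \<mu>" "stage n \<mu>" "x = root n (cmp \<Lambda> \<alpha> \<mu>)"
    unfolding targets_iff by blast
  then have "entry n v x x 1"
    unfolding entry_vertex[OF assms(2)] using assms(1) stage_cmp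
    by (intro exI[of _ "cmp \<Lambda> \<alpha> \<mu>"]) (simp add: paths_from_def rng_cmp)
  then show "x \<in> targets v"
    unfolding targets_def by blast
qed

definition T :: "'l \<Rightarrow> (nat \<times> 'l) ell2_op" where
  "T \<alpha> = mat_op (mat \<alpha>)"

lemma Rep_T:
  "Rep_ell2 (apply_op (T \<alpha>) f) = mat_fun (mat \<alpha>) (Rep_ell2 f)"
  "Rep_ell2 (apply_op (adj (T \<alpha>)) f) = mat_fun (mat_adj (mat \<alpha>)) (Rep_ell2 f)"
  by (simp_all add: T_def adj_mat_op apply_mat_op monomial_mat monomial_adj)

theorem CK_family_T: "CK_family k \<Lambda> c type_cstar T"
proof
  note simps = apply_op_simps apply_op_scaleC Rep_ell2_simps Rep_T
  fix v w :: 'l and p :: "(nat \<Rightarrow> nat) \<times> 'f" and \<mu> \<nu> :: 'l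
  show "T \<mu> \<in> carrier type_cstar" by simp
  show "T v \<otimes>\<^bsub>type_cstar\<^esub> T v = T v \<and> star type_cstar (T v) = T v" if v: "v \<in> vertices \<Lambda>"
    using v by (auto intro!: Rep_apply_op_eqI simp: simps mat_fun_vertex mat_adj_vertex)
  show "T v \<otimes>\<^bsub>type_cstar\<^esub> T w = \<zero>\<^bsub>type_cstar\<^esub>" if "v \<in> vertices \<Lambda>" "w \<in> vertices \<Lambda>" "v \<noteq> w"
  proof -
    have "\<not> (x \<in> targets v \<and> x \<in> targets w)" for x
      using that targets_vertex_disjoint[of v w x] by blast
    with that show ?thesis
      by (auto intro!: Rep_apply_op_eqI simp: simps mat_fun_vertex)
  qed
  show "T \<mu> \<otimes>\<^bsub>type_cstar\<^esub> T \<nu> = c \<mu> \<nu> \<odot>\<^bsub>type_cstar\<^esub> T (cmp \<Lambda> \<mu> \<nu>)" if "composable \<Lambda> \<mu> \<nu>"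
    using mat_fun_cmp[OF that] by (auto intro!: Rep_apply_op_eqI simp: simps)
  show "star type_cstar (T \<mu>) \<otimes>\<^bsub>type_cstar\<^esub> T \<mu> = T (src \<Lambda> \<mu>)" if "\<mu> \<in> arr \<Lambda>"
    using mat_fun_isometry[OF that] by (auto intro!: Rep_apply_op_eqI simp: simps)
  show "T v = (\<Oplus>\<^bsub>type_cstar\<^esub>\<alpha>\<in>paths_from \<Lambda> v p. T \<alpha> \<otimes>\<^bsub>type_cstar\<^esub> star type_cstar (T \<alpha>))"
    if v: "v \<in> vertices \<Lambda>" and p: "p \<in> NF k"
  proof -
    let ?I = "paths_from \<Lambda> v p"
    have fin: "finite ?I"
      using row_finite v p by (simp add: row_finite_def)
    have sum: "Rep_ell2 (apply_op (sum g I) f) x = (\<Sum>i\<in>I. Rep_ell2 (apply_op (g i) f) x)"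
      for I and g :: "'l \<Rightarrow> (nat \<times> 'l) ell2_op" and f x
      by (induction I rule: infinite_finite_induct) (simp_all add: simps(1-6) Rep_ell2_simps)
    \<comment> \<open>The sets \<open>targets \<alpha>\<close>, for the paths of degree
      \<open>p\<close> with range \<open>v\<close>, partition \<open>targets v\<close>, so the
      indicator functions add up.\<close>
    have "T v = (\<Sum>\<alpha>\<in>?I. T \<alpha> * adj (T \<alpha>))"
    proof (rule Rep_apply_op_eqI)
      fix f x
      have "Rep_ell2 (apply_op (\<Sum>\<alpha>\<in>?I. T \<alpha> * adj (T \<alpha>)) f) x = (\<Sum>\<alpha>\<in>?I. if x \<in> targets \<alpha> then Rep_ell2 f x else 0)"
        unfolding sum by (simp add: apply_op_simps Rep_T mat_fun_range)
      also have "\<dots> = (if x \<in> targets v then Rep_ell2 f x else 0)"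
      proof (cases "x \<in> targets v")
        case True
        then obtain \<alpha> where \<alpha>: "\<alpha> \<in> ?I" "x \<in> targets \<alpha>"
          using targets_path[OF v p] by blast
        have "(\<Sum>\<beta>\<in>?I. if x \<in> targets \<beta> then Rep_ell2 f x else 0) = (\<Sum>\<beta>\<in>?I. if \<beta> = \<alpha> then Rep_ell2 f x else 0)"
          using \<alpha> targets_path_unique by (intro sum.cong) auto
        with True \<alpha> fin show ?thesis by simp
      next
        case False
        have "x \<notin> targets \<alpha>" if "\<alpha> \<in> ?I" for \<alpha>
          using path_targets_vertex[OF that v] False by blast
        with False show ?thesis
          by simp
      qed
      also have "\<dots> = Rep_ell2 (apply_op (T v) f) x"
        using v by (simp add: Rep_T mat_fun_vertex)
      finally show "Rep_ell2 (apply_op (T v) f) x = Rep_ell2 (apply_op (\<Sum>\<alpha>\<in>?I. T \<alpha> * adj (T \<alpha>)) f) x" ..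
    qed
    then show ?thesis
      using fin by (simp add: finsum_type_cstar)
  qed
qed

theorem T_v\<^sub>0_nonzero: "T v\<^sub>0 \<noteq> 0"
proof -
  have "entry 0 v\<^sub>0 (root 0 v\<^sub>0) (root 0 v\<^sub>0) 1"
    using v\<^sub>0 vertexD[OF v\<^sub>0] unfolding entry_vertex[OF v\<^sub>0] by (intro exI[of _ v\<^sub>0]) (simp add: stage_def)
  then show ?thesis
    unfolding T_def using mat_op_nonzero[OF monomial_mat] mat_nonzero by blast
qed

end

section \<open>The gauge-invariant uniqueness theorem\<close>

theorem induced_hom_unique:
  fixes \<pi> \<pi>' :: "'a::cstar_algebra \<Rightarrow> 'b::cstar_algebra"
  assumes "generates_cstar (s ` arr \<Lambda>)" "is_induced_hom \<Lambda> s t \<pi>" "is_induced_hom \<Lambda> s t \<pi>'"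
  shows "\<pi> = \<pi>'"
proof -
  let ?S = "{x. \<pi> x = \<pi>' x}"
  have hom: "star_hom type_cstar type_cstar \<pi>" "star_hom type_cstar type_cstar \<pi>'"
    using assms by (auto simp: is_induced_hom_def)
  have "closed ?S"
    by (intro closed_Collect_eq bounded_linear.continuous_on[OF star_hom_bounded_linear[OF hom(1)]]
      bounded_linear.continuous_on[OF star_hom_bounded_linear[OF hom(2)]] continuous_on_id)
  moreover have "star_subalgebra ?S"
    by (auto simp: star_subalgebra_def star_homD[OF hom(1)] star_homD[OF hom(2)])
  moreover have "s ` arr \<Lambda> \<subseteq> ?S"
    using assms(2,3) by (auto simp: is_induced_hom_def)
  ultimately have "?S = UNIV"
    using assms(1) by (auto simp: generates_cstar_def)
  then show ?thesis
    by (auto simp: fun_eq_iff)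
qed

lemma universal_vertex_nonzero:
  fixes \<Lambda> :: "('l, (nat \<Rightarrow> nat) \<times> 'f::{ab_group_add, countable}) graded_category"
    and s :: "'l \<Rightarrow> 'a::cstar_algebra"
  assumes "pgraph k \<Lambda>" "row_finite k \<Lambda>" "no_sources k \<Lambda>" "cocycle \<Lambda> c" "is_universal k \<Lambda> c s"
    and v: "v \<in> vertices \<Lambda>"
  shows "s v \<noteq> 0"
proof -
  interpret path_rep k \<Lambda> c v
    using assms by (intro path_rep.intro path_rep_axioms.intro)
  have "ck_rep k \<Lambda> c T"
    using assms CK_family_T by (intro ck_rep.intro ck_rep_axioms.intro)
  then obtain \<phi> where \<phi>: "is_induced_hom \<Lambda> s T \<phi>"
    using ex_induced_hom assms(5) by blast
  then have "\<phi> (s v) \<noteq> 0"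
    using T_v\<^sub>0_nonzero vertexD[OF v] by (simp add: is_induced_hom_def)
  then show ?thesis
    using \<phi> star_homD(5)[of \<phi>] by (auto simp: is_induced_hom_def)
qed

text \<open>The adjoint of t_\<nu> is scaled by the conjugate of \<xi>(d(\<nu>)), which is its
  inverse because \<xi> has values in the circle; so a product is scaled by \<xi> at the difference
  of the degrees.\<close>

lemma (in ck_rep) graded_eigenvector:
  assumes \<beta>: "star_hom type_cstar type_cstar \<beta>" and \<xi>: "\<xi> \<in> dual k"
    and eigen: "\<And>\<alpha>. \<alpha> \<in> arr \<Lambda> \<Longrightarrow> \<beta> (t \<alpha>) = \<xi> (to_ZF (deg \<Lambda> \<alpha>)) *\<^sub>C t \<alpha>"
    and x: "x \<in> cspan (graded g)"
  shows "\<beta> x = \<xi> g *\<^sub>C x"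
  using x
proof (induction rule: cspan.induct)
  case zero
  then show ?case by (simp add: star_homD[OF \<beta>])
next
  case (step x y z)
  from step obtain \<mu> \<nu> where x: "x = t \<mu> * adj (t \<nu>)" "\<mu> \<in> arr \<Lambda>" "\<nu> \<in> arr \<Lambda>"
    "to_ZF (deg \<Lambda> \<mu>) - to_ZF (deg \<Lambda> \<nu>) = g"
    by (auto simp: graded_def)
  define h where "h = to_ZF (deg \<Lambda> \<nu>)"
  have h: "h \<in> ZF k" "g \<in> ZF k" "to_ZF (deg \<Lambda> \<mu>) = g + h"
    using to_ZF_in[OF deg_in[OF x(2)]] to_ZF_in[OF deg_in[OF x(3)]] x(4)
    by (simp_all add: h_def ZF_diff flip: x(4))
  have "\<xi> (g + h) = \<xi> g * \<xi> h" "cmod (\<xi> h) = 1"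
    using \<xi> h by (auto simp: dual_def)
  then have "cnj (\<xi> h) * \<xi> (g + h) = \<xi> g"
    using complex_norm_square[of "\<xi> h"] by (simp add: mult_ac)
  then have "\<beta> x = \<xi> g *\<^sub>C x"
    using x h by (simp add: star_homD[OF \<beta>] eigen mult_scaleC_left mult_scaleC_right scaleC_scaleC
      h_def[symmetric])
  then show ?case
    by (simp add: star_homD[OF \<beta>] step.IH scaleC_add_right scaleC_scaleC mult.commute)
qed

theorem proposition5p9:
  fixes k :: nat
    and \<Lambda> :: "('l, (nat \<Rightarrow> nat) \<times> 'f::{ab_group_add, countable}) graded_category"
    and c :: "'l \<Rightarrow> 'l \<Rightarrow> complex"
    and s :: "'l \<Rightarrow> 'a::cstar_algebra"
    and t :: "'l \<Rightarrow> 'b::cstar_algebra"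
    and \<beta> :: "((nat \<Rightarrow> int) \<times> 'f \<Rightarrow> complex) \<Rightarrow> 'b \<Rightarrow> 'b"
  assumes "pgraph k \<Lambda>" and "row_finite k \<Lambda>" and "no_sources k \<Lambda>"
    and "cocycle \<Lambda> c"
    and "is_universal k \<Lambda> c s"
    and "CK_family k \<Lambda> c type_cstar t"
    and "dual_action k \<beta>"
    and "\<And>\<xi> \<alpha>. \<xi> \<in> dual k \<Longrightarrow> \<alpha> \<in> arr \<Lambda> \<Longrightarrow> \<beta> \<xi> (t \<alpha>) = \<xi> (to_ZF (deg \<Lambda> \<alpha>)) *\<^sub>C t \<alpha>"
  shows "(\<exists>!\<pi>. is_induced_hom \<Lambda> s t \<pi>) \<and>
    (\<forall>\<pi>. is_induced_hom \<Lambda> s t \<pi> \<longrightarrow> (inj \<pi> \<longleftrightarrow> (\<forall>v\<in>vertices \<Lambda>. t v \<noteq> 0)))"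
proof (intro conjI allI impI)
  have s: "CK_family k \<Lambda> c type_cstar s" and gen: "generates_cstar (s ` arr \<Lambda>)"
    using assms(5) by (auto simp: is_universal_def)
  interpret A: ck_rep k \<Lambda> c s
    using assms s by (intro ck_rep.intro ck_rep_axioms.intro)
  interpret B: ck_rep k \<Lambda> c t
    using assms by (intro ck_rep.intro ck_rep_axioms.intro)
  show "\<exists>!\<pi>. is_induced_hom \<Lambda> s t \<pi>"
    using ex_induced_hom[OF B.ck_rep_axioms assms(5)] induced_hom_unique[OF gen] by blast
  fix \<pi> assume \<pi>: "is_induced_hom \<Lambda> s t \<pi>"
  then have hom: "star_hom type_cstar type_cstar \<pi>" and \<pi>_s: "\<And>\<alpha>. \<alpha> \<in> arr \<Lambda> \<Longrightarrow> \<pi> (s \<alpha>) = t \<alpha>"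
    by (auto simp: is_induced_hom_def)
  show "inj \<pi> \<longleftrightarrow> (\<forall>v\<in>vertices \<Lambda>. t v \<noteq> 0)"
  proof
    assume "inj \<pi>"
    show "\<forall>v\<in>vertices \<Lambda>. t v \<noteq> 0"
    proof
      fix v assume v: "v \<in> vertices \<Lambda>"
      have "\<pi> (s v) \<noteq> \<pi> 0"
        using \<open>inj \<pi>\<close> universal_vertex_nonzero[OF assms(1-5) v] by (simp add: inj_eq)
      then show "t v \<noteq> 0"
        using v A.vertexD by (simp add: \<pi>_s star_homD(5)[OF hom])
    qed
  next
    assume nonzero: "\<forall>v\<in>vertices \<Lambda>. t v \<noteq> 0"
    interpret ck_morphism k \<Lambda> c s t \<pi>
      by unfold_locales (use hom \<pi>_s nonzero in auto)
    have "norm (\<pi> x) = norm x" for x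
    proof (rule isometric[OF gen])
      fix S f h
      assume S: "finite S" "S \<subseteq> ZF k" "h \<in> S" and f: "\<And>g. g \<in> S \<Longrightarrow> f g \<in> cspan (B.graded g)"
      have "norm (f h) \<le> norm (f h + sum f (S - {h}))"
      proof (rule norm_eigenvector_le[where X = "dual k" and G = "ZF k" and \<beta> = \<beta> and \<phi> = "\<lambda>\<xi>. \<xi>"])
        show hom: "star_hom type_cstar type_cstar (\<beta> \<xi>)" if "\<xi> \<in> dual k" for \<xi>
          using assms(7) that by (rule dual_action.hom)
        show "cmod (\<xi> g) = 1" if "\<xi> \<in> dual k" "g \<in> ZF k" for \<xi> g
          using that by (auto simp: dual_def)
        show "\<exists>\<xi>\<in>dual k. \<xi> g \<noteq> \<xi> h" if "g \<in> ZF k" "h \<in> ZF k" "g \<noteq> h" for g h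
          using dual_separates[OF that] by blast
        show "\<beta> \<xi> (f g) = \<xi> g *\<^sub>C f g" if \<xi>: "\<xi> \<in> dual k" and g: "g \<in> insert h (S - {h})" for \<xi> g
          by (rule B.graded_eigenvector[OF hom[OF \<xi>] \<xi> assms(8)[OF \<xi>] f]) (use g S in auto)
      qed (use S in auto)
      then show "norm (f h) \<le> norm (sum f S)"
        using S by (simp add: sum.remove)
    qed
    then show "inj \<pi>"
      by (intro injI) (metis homD(7) norm_eq_zero right_minus_eq)
  qed
qed

end
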